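(* Let $S_{g,k}$ be an oriented surface of genus $g$ with $k\ge 1$ punctures and negative Euler characteristic, let $T$ be a bipartite ideal triangulation of $S_{g,k}$, and let $\rho:\pi_1(S_{g,k})\to \mathrm{PU}(2,1)$ be a $T$-bent representation. Then the unique discrete and faithful representation $\rho_0:\pi_1(S_{g,k})\to\mathrm{PO}(2,1)$ in the bending fiber of $\rho$ (so the existence and uniqueness of such a representation is part of the assertion) dominates $\rho$, i.e. $\ell(\rho(\gamma))\le\ell(\rho_0(\gamma))$ for all $\gamma\in\pi_1(S_{g,k})$, and it keeps the Bergman translation lengths of the peripheral loops unchanged, i.e. $\ell(\rho(\gamma))=\ell(\rho_0(\gamma))$ for every peripheral loop $\gamma$.
   Context: Complex hyperbolic plane: equip $\mathbb{C}^3$ with the Hermitian form of signature $(2,1)$ $\langle \mathbf z,\mathbf w\rangle=z_1\bar w_3+z_2\bar w_2+z_3\bar w_1$, with matrix $J=\begin{pmatrix}0&0&1\\0&1&0\\1&0&0\end{pmatrix}$. $\mathbf{H}^2_{\mathbb C}$ is the set of complex lines in $\mathbb{C}^3$ spanned by negative vectors, and $\partial \mathbf{H}^2_{\mathbb C}$ the set of complex lines spanned by non-zero null vectors. $\mathrm{U}(2,1)=\{A\in \mathrm{GL}_3(\mathbb C): A^*JA=J\}$ and $\mathrm{PU}(2,1)$ is its quotient by unit scalars; it is the group of holomorphic isometries of $\mathbf{H}^2_{\mathbb C}$. $\mathrm{PO}(2,1)$ denotes the identity component of the isometry group of the real hyperbolic plane $\mathbf{H}^2_{\mathbb R}$, regarded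 as a subgroup of $\mathrm{PU}(2,1)$ (the image of the identity component of the group of real matrices preserving $J$). Translation length: for $A\in \mathrm{PU}(2,1)$ with lift $\tilde A\in \mathrm{U}(2,1)$, the Bergman translation length is $\ell(A):=2\ln\sigma(\tilde A)$, where $\sigma$ is the spectral radius (maximum modulus of an eigenvalue); it does not depend on the lift. Real ideal triangles: a real plane is a non-empty intersection of $\mathbf{H}^2_{\mathbb C}$ with (the projectivization of) a totally real subspace, i.e. a totally geodesic Lagrangian copy of $\mathbf{H}^2_{\mathbb R}$ in $\mathbf{H}^2_{\mathbb C}$. A real ideal triangle is a triple of distinct points of $\partial\mathbf{H}^2_{\mathbb C}$ lying on the boundary of a common real plane. $T$-bent representations: an ideal triangulation $T$ of $S_{g,k}$ has its vertices at the punctures; it is bipartite if its dual graph is bipartite. Let $\widetilde T$ be its lift to the universal cover $\widetilde S_{g,k}$ and let $\mathcal F_\infty\subset\partial\widetilde S_{g,k}$ be the set of lifts of the punctures, i.e. the set of vertices of $\widetilde T$, on which $\pi_1(S_{g,k})$ acts. A representation $\rho:\pi_1(S_{g,k})\to\mathrm{PU}(2,1)$ is $T$-bent if there is a $\rho$-equivariant map (framing) $\phi:\mathcal F_\infty\to\partial\mathbf{H}^2_{\mathbb C}$ such that for every ideal triangle of $\widetilde T$ with vertices $a,b,c$, the points $\phi(a),\phi(b),\phi(c)$ form a real ideal triangle. A $T$-bent representation is considered together with its framing, and such pairs $(\rho,\phi)$ are considered up to the action $g\cdot(\rho,\phi)=(g\rho g^{-1},g\circ\phi)$ of isometries $g$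 of $\mathbf{H}^2_{\mathbb C}$. ${\tt Z}$-invariants: let $\tau_1=(p_1,p_2,p_3)$ and $\tau_2=(p_3,p_4,p_1)$ be two adjacent real ideal triangles (sharing $p_1,p_3$), let $\mathbf p_i$ be lifts of $p_i$ to $\mathbb C^3$, and let $\mathbf v$ be a non-zero vector orthogonal to $\mathbf p_1$ and $\mathbf p_3$. Then $${\tt Z}(\tau_1,\tau_2):=-\frac{\langle \mathbf p_4,\mathbf v\rangle\langle\mathbf p_2,\mathbf p_1\rangle}{\langle\mathbf p_2,\mathbf v\rangle\langle\mathbf p_4,\mathbf p_1\rangle}\in\mathbb C\setminus\{-1,0\},$$ and ${\tt Z}(\tau_2,\tau_1)=\overline{{\tt Z}(\tau_1,\tau_2)}$. Given a $T$-bent $\rho$ with framing $\phi$ and an edge of $T$, lift the edge to $\widetilde T$, let $a,b,c,d$ be the vertices, in the cyclic order given by the orientation of the surface, of the ideal quadrilateral formed by the two triangles adjacent to the lifted edge $ac$, and assign to the edge the invariant ${\tt Z}$ of the pair $(\phi(a),\phi(b),\phi(c))$, $(\phi(c),\phi(d),\phi(a))$. Its modulus does not depend on the choices. Bending fiber: two $T$-bent representations are in the same bending fiber if, for each edge of $T$, the absolute values of their ${\tt Z}$-invariants at that edge coincide. A peripheral loop is an element of $\pi_1(S_{g,k})$ freely homotopic into a neighbourhood of a puncture.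
   Formalization: "Discrete and faithful" is read as also being the holonomy of a hyperbolic structure on S_{g,k} itself; uniqueness (up to isometry of framed pairs) is among such representations, since for the abstract free group it fails, e.g. a pair-of-pants group on S_{1,1}. *)

theory Defs
  imports "HOL-Analysis.Analysis" "HOL-Algebra.Coset"
begin

section \<open>The complex hyperbolic plane\<close>

definition herm :: "complex^3 \<Rightarrow> complex^3 \<Rightarrow> complex" where
  "herm z w = z$1 * cnj (w$3) + z$2 * cnj (w$2) + z$3 * cnj (w$1)"

definition herm_matrix :: "complex^3^3" where
  "herm_matrix = vector [vector [0, 0, 1], vector [0, 1, 0], vector [1, 0, 0]]"

definition conj_transpose :: "complex^3^3 \<Rightarrow> complex^3^3" where
  "conj_transpose A = (\<chi> i j. cnj (A$j$i))"

text \<open>The complex line spanned by \<open>v\<close>. Points of the complex hyperbolic plane and of its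
  boundary are complex lines, represented as sets of vectors.\<close>

definition cline :: "complex^3 \<Rightarrow> (complex^3) set" where
  "cline v = range (\<lambda>c. c *s v)"

definition hyp_plane :: "(complex^3) set set" where
  "hyp_plane = {cline v | v. Re (herm v v) < 0}"

definition hyp_boundary :: "(complex^3) set set" where
  "hyp_boundary = {cline v | v. v \<noteq> 0 \<and> herm v v = 0}"

definition U21 :: "(complex^3^3) monoid" where
  "U21 = \<lparr>carrier = {A. invertible A \<and> conj_transpose A ** herm_matrix ** A = herm_matrix},
          mult = (**), one = mat 1\<rparr>"

definition unit_scalars :: "(complex^3^3) set" where
  "unit_scalars = {mat c | c. cmod c = 1}"

text \<open>An element of \<open>PU21\<close> is the set of all its lifts to \<open>U21\<close>.\<close>

definition PU21 :: "(complex^3^3) set monoid" where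
  "PU21 = U21 Mod unit_scalars"

definition proj_act :: "(complex^3^3) set \<Rightarrow> (complex^3) set \<Rightarrow> (complex^3) set" where
  "proj_act A p = {M *v x | M x. M \<in> A \<and> x \<in> p}"

definition real_O21 :: "(complex^3^3) set" where
  "real_O21 = {A \<in> carrier U21. \<forall>i j. A$i$j \<in> \<real>}"

definition PO21 :: "(complex^3^3) set set" where
  "PO21 = (\<lambda>A. unit_scalars #>\<^bsub>U21\<^esub> A) ` connected_component_set real_O21 (mat 1)"

definition spectral_radius :: "complex^3^3 \<Rightarrow> real" where
  "spectral_radius M = Max {cmod c | c. \<exists>v. v \<noteq> 0 \<and> M *v v = c *s v}"

definition translation_length :: "(complex^3^3) set \<Rightarrow> real" where
  "translation_length A = 2 * ln (spectral_radius (SOME M. M \<in> A))"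

text \<open>Discreteness for the quotient topology of \<open>PU21\<close>: every element of \<open>G\<close> is isolated in \<open>G\<close>.
  The projection from \<open>U21\<close> being open, this means that in the preimage \<open>\<Union>G\<close> of \<open>G\<close> the fibre
  over each element is relatively open.\<close>

definition discrete_in_PU21 :: "(complex^3^3) set set \<Rightarrow> bool" where
  "discrete_in_PU21 G \<longleftrightarrow> (\<forall>A\<in>G. openin (top_of_set (\<Union>G)) A)"

text \<open>Lifts to \<open>\<complex>\<^sup>3\<close> of the isometries of the complex hyperbolic plane, the holomorphic and the
  antiholomorphic ones.\<close>

definition isometry_lift :: "(complex^3 \<Rightarrow> complex^3) \<Rightarrow> bool" where
  "isometry_lift F \<longleftrightarrow> (\<exists>A \<in> carrier U21.
     F = (\<lambda>x. A *v x) \<or> F = (\<lambda>x. A *v (\<chi> i. cnj (x$i))))"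


section \<open>Real ideal triangles and the invariant Z\<close>

definition totally_real :: "(complex^3) set \<Rightarrow> bool" where
  "totally_real R \<longleftrightarrow> subspace R \<and> dim R = 3 \<and> (\<forall>x\<in>R. \<i> *s x \<in> R \<longrightarrow> x = 0)
     \<and> (\<forall>x\<in>R. \<forall>y\<in>R. herm x y \<in> \<real>)"

definition real_plane :: "(complex^3) set \<Rightarrow> (complex^3) set set" where
  "real_plane R = {cline v | v. v \<in> R \<and> Re (herm v v) < 0}"

definition real_plane_boundary :: "(complex^3) set \<Rightarrow> (complex^3) set set" where
  "real_plane_boundary R = {cline v | v. v \<in> R \<and> v \<noteq> 0 \<and> herm v v = 0}"

definition real_ideal_triangle ::
    "(complex^3) set \<Rightarrow> (complex^3) set \<Rightarrow> (complex^3) set \<Rightarrow> bool" where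
  "real_ideal_triangle p q r \<longleftrightarrow> p \<noteq> q \<and> q \<noteq> r \<and> p \<noteq> r \<and>
     (\<exists>R. totally_real R \<and> real_plane R \<noteq> {} \<and> {p, q, r} \<subseteq> real_plane_boundary R)"

text \<open>The open geodesic triangle with vertices \<open>p, q, r\<close>: if the lifts of the vertices are
  normalised to have negative real pairwise products, it consists of the lines spanned by the
  combinations with positive coefficients (which are absorbed in \<open>x, y, z\<close>).\<close>

definition open_ideal_triangle ::
    "(complex^3) set \<Rightarrow> (complex^3) set \<Rightarrow> (complex^3) set \<Rightarrow> (complex^3) set set" where
  "open_ideal_triangle p q r = {cline (x + y + z) | x y z. x \<in> p \<and> y \<in> q \<and> z \<in> r \<and>
     (\<forall>c \<in> {herm x y, herm y z, herm z x}. c \<in> \<real> \<and> Re c < 0)}"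

definition point_lift :: "(complex^3) set \<Rightarrow> complex^3" where
  "point_lift p = (SOME x. x \<in> p \<and> x \<noteq> 0)"

text \<open>The invariant \<open>Z\<close> of the pair of triangles \<open>(p1, p2, p3)\<close>, \<open>(p3, p4, p1)\<close>. The value does
  not depend on the lifts nor on the polar vector \<open>v\<close>.\<close>

definition Z_inv :: "(complex^3) set \<Rightarrow> (complex^3) set \<Rightarrow> (complex^3) set \<Rightarrow> (complex^3) set
    \<Rightarrow> complex" where
  "Z_inv p1 p2 p3 p4 =
     (let q1 = point_lift p1; q2 = point_lift p2; q3 = point_lift p3; q4 = point_lift p4;
          v = (SOME v. v \<noteq> 0 \<and> herm v q1 = 0 \<and> herm v q3 = 0)
      in - (herm q4 v * herm q2 q1) / (herm q2 v * herm q4 q1))"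


section \<open>Ideally triangulated surfaces\<close>

text \<open>An oriented punctured surface with an ideal triangulation is a gluing of finitely many
  oriented triangles along their sides. A dart is a side of a triangle, oriented as the boundary
  of the triangle; \<open>nxt\<close> sends a side to the following side of the same triangle and \<open>opp\<close> sends
  it to the side it is glued to, i.e. to the same edge with the reverse orientation, seen from the
  triangle across. The darts \<open>d\<close> and \<open>nxt (opp d)\<close> have the same origin, so that the vertices
  (the punctures) are the orbits of this permutation.\<close>

record 'd triangulation =
  darts :: "'d set"
  nxt :: "'d \<Rightarrow> 'd"
  opp :: "'d \<Rightarrow> 'd"

definition triangle_of :: "'d triangulation \<Rightarrow> 'd \<Rightarrow> 'd set" where
  "triangle_of T d = {d, nxt T d, nxt T (nxt T d)}"

definition triangles :: "'d triangulation \<Rightarrow> 'd set set" where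
  "triangles T = triangle_of T ` darts T"

definition edges :: "'d triangulation \<Rightarrow> 'd set set" where
  "edges T = (\<lambda>d. {d, opp T d}) ` darts T"

definition punctures :: "'d triangulation \<Rightarrow> 'd set set" where
  "punctures T = (\<lambda>d. range (\<lambda>n. ((nxt T \<circ> opp T) ^^ n) d)) ` darts T"

text \<open>A walk is a sequence of moves on darts: turning to the next side of a triangle, and crossing
  an edge.\<close>

datatype move = Nxt | Opp

type_synonym walk = "move list"

fun walk_end :: "'d triangulation \<Rightarrow> walk \<Rightarrow> 'd \<Rightarrow> 'd" where
  "walk_end T [] d = d"
| "walk_end T (Nxt # w) d = walk_end T w (nxt T d)"
| "walk_end T (Opp # w) d = walk_end T w (opp T d)"

text \<open>\<open>ideal_triangulation g k T\<close>: the surface triangulated by \<open>T\<close> is connected, with genus \<open>g\<close>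
  (by the Euler characteristic of the closed surface obtained by filling in the punctures) and with
  \<open>k\<close> punctures.\<close>

definition ideal_triangulation :: "nat \<Rightarrow> nat \<Rightarrow> 'd triangulation \<Rightarrow> bool" where
  "ideal_triangulation g k T \<longleftrightarrow>
     finite (darts T) \<and> darts T \<noteq> {} \<and>
     (\<forall>d\<in>darts T. nxt T d \<in> darts T \<and> nxt T d \<noteq> d \<and> nxt T (nxt T (nxt T d)) = d) \<and>
     (\<forall>d\<in>darts T. opp T d \<in> darts T \<and> opp T d \<noteq> d \<and> opp T (opp T d) = d) \<and>
     (\<forall>d\<in>darts T. \<forall>e\<in>darts T. \<exists>w. walk_end T w d = e) \<and>
     card (punctures T) = k \<and>
     int (card (punctures T)) - int (card (edges T)) + int (card (triangles T)) = 2 - 2 * int g"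

text \<open>The dual graph has the triangles as vertices and one edge for each edge of the
  triangulation.\<close>

definition bipartite_triangulation :: "'d triangulation \<Rightarrow> bool" where
  "bipartite_triangulation T \<longleftrightarrow> (\<exists>B \<subseteq> triangles T. \<forall>d\<in>darts T.
     triangle_of T d \<in> B \<longleftrightarrow> triangle_of T (opp T d) \<notin> B)"


section \<open>Fundamental group and universal cover\<close>

text \<open>Homotopy of walks with fixed ends: running around a triangle once, and crossing an edge back
  and forth, are null-homotopic. The graph of darts with discs attached along these walks is homotopy
  equivalent to the punctured surface, so that the homotopy classes of closed walks at \<open>d0\<close>
  form its fundamental group.\<close>

inductive walk_homotopic :: "walk \<Rightarrow> walk \<Rightarrow> bool" where
  refl: "walk_homotopic u u"
| sym: "walk_homotopic u v \<Longrightarrow> walk_homotopic v u"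
| trans: "walk_homotopic u v \<Longrightarrow> walk_homotopic v w \<Longrightarrow> walk_homotopic u w"
| triangle: "walk_homotopic (u @ [Nxt, Nxt, Nxt] @ v) (u @ v)"
| edge: "walk_homotopic (u @ [Opp, Opp] @ v) (u @ v)"

definition walk_class :: "walk \<Rightarrow> walk set" where
  "walk_class w = {u. walk_homotopic w u}"

definition class_append :: "walk set \<Rightarrow> walk set \<Rightarrow> walk set" where
  "class_append A B = {w. \<exists>a\<in>A. \<exists>b\<in>B. walk_homotopic (a @ b) w}"

definition fund_group :: "'d triangulation \<Rightarrow> 'd \<Rightarrow> walk set monoid" where
  "fund_group T d0 = \<lparr>carrier = {walk_class w | w. walk_end T w d0 = d0},
                      mult = class_append, one = walk_class []\<rparr>"

text \<open>The darts of the lift of \<open>T\<close> to the universal cover are the homotopy classes of all walks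
  starting at \<open>d0\<close>; the class of \<open>w\<close> lies over the dart \<open>walk_end T w d0\<close>. The fundamental group
  acts by concatenation on the left. (As the homotopy relation does not depend on \<open>T\<close>, the
  lifted triangulation is always the same one, the Farey tessellation; only the action
  depends on \<open>T\<close>.)\<close>

definition lifted_darts :: "walk set set" where
  "lifted_darts = range walk_class"

definition lift_nxt :: "walk set \<Rightarrow> walk set" where
  "lift_nxt X = class_append X (walk_class [Nxt])"

definition lift_opp :: "walk set \<Rightarrow> walk set" where
  "lift_opp X = class_append X (walk_class [Opp])"

definition lift_triangle :: "walk set \<Rightarrow> walk set set" where
  "lift_triangle X = {X, lift_nxt X, lift_nxt (lift_nxt X)}"

definition walk_inverse :: "walk \<Rightarrow> walk" where
  "walk_inverse w = concat (map (\<lambda>s. case s of Nxt \<Rightarrow> [Nxt, Nxt] | Opp \<Rightarrow> [Opp]) (rev w))"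

text \<open>The walks that turn, in either direction, around the origin of the initial dart, i.e. those
  that stay in a neighbourhood of a puncture.\<close>

definition turning_walks :: "walk set" where
  "turning_walks = range (\<lambda>n. concat (replicate n [Opp, Nxt]))
     \<union> range (\<lambda>n. walk_inverse (concat (replicate n [Opp, Nxt])))"

text \<open>A vertex of the lifted triangulation is identified with the set of the lifted darts that
  start from it.\<close>

definition origin :: "walk set \<Rightarrow> walk set set" where
  "origin X = {walk_class (w @ c) | w c. walk_class w = X \<and> c \<in> turning_walks}"

definition lifted_vertices :: "walk set set set" where
  "lifted_vertices = origin ` lifted_darts"

definition vertex_act :: "walk set \<Rightarrow> walk set set \<Rightarrow> walk set set" where
  "vertex_act \<gamma> V = class_append \<gamma> ` V"

text \<open>A loop freely homotopic (along \<open>u\<close>) to a loop \<open>c\<close> around a puncture.\<close>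

definition peripheral :: "'d triangulation \<Rightarrow> 'd \<Rightarrow> walk set \<Rightarrow> bool" where
  "peripheral T d0 \<gamma> \<longleftrightarrow> (\<exists>u c. c \<in> turning_walks \<and>
     walk_end T c (walk_end T u d0) = walk_end T u d0 \<and>
     \<gamma> = walk_class (u @ c @ walk_inverse u))"


section \<open>Bent representations\<close>

definition T_bent :: "'d triangulation \<Rightarrow> 'd \<Rightarrow> (walk set \<Rightarrow> (complex^3^3) set) \<Rightarrow>
    (walk set set \<Rightarrow> (complex^3) set) \<Rightarrow> bool" where
  "T_bent T d0 \<rho> \<phi> \<longleftrightarrow>
     \<rho> \<in> hom (fund_group T d0) PU21 \<and>
     \<phi> ` lifted_vertices \<subseteq> hyp_boundary \<and>
     (\<forall>\<gamma> \<in> carrier (fund_group T d0). \<forall>V \<in> lifted_vertices.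
        \<phi> (vertex_act \<gamma> V) = proj_act (\<rho> \<gamma>) (\<phi> V)) \<and>
     (\<forall>X \<in> lifted_darts. real_ideal_triangle
        (\<phi> (origin X)) (\<phi> (origin (lift_nxt X))) (\<phi> (origin (lift_nxt (lift_nxt X)))))"

text \<open>The invariant of the lifted edge \<open>X\<close>. The dart \<open>X\<close> runs from \<open>c\<close> to \<open>a\<close> in the triangle
  \<open>(a, b, c)\<close> and \<open>lift_opp X\<close> runs from \<open>a\<close> to \<open>c\<close> in the triangle \<open>(c, d, a)\<close>.\<close>

definition Z_edge :: "(walk set set \<Rightarrow> (complex^3) set) \<Rightarrow> walk set \<Rightarrow> complex" where
  "Z_edge \<phi> X =
     (let a = origin (lift_nxt X); b = origin (lift_nxt (lift_nxt X)); c = origin X;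
          d = origin (lift_nxt (lift_nxt (lift_opp X)))
      in Z_inv (\<phi> a) (\<phi> b) (\<phi> c) (\<phi> d))"

text \<open>For the framing of a bent representation the modulus is the same for all lifts, and both
  orientations, of an edge of \<open>T\<close>.\<close>

definition same_bending_fiber :: "(walk set set \<Rightarrow> (complex^3) set) \<Rightarrow>
    (walk set set \<Rightarrow> (complex^3) set) \<Rightarrow> bool" where
  "same_bending_fiber \<phi> \<phi>' \<longleftrightarrow> (\<forall>X \<in> lifted_darts. cmod (Z_edge \<phi> X) = cmod (Z_edge \<phi>' X))"

text \<open>\<open>(\<rho>', \<phi>') = g \<cdot> (\<rho>, \<phi>)\<close> for an isometry \<open>g\<close>, with lift \<open>F\<close>.\<close>

definition isometric_pairs :: "'d triangulation \<Rightarrow> 'd \<Rightarrow>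
    (walk set \<Rightarrow> (complex^3^3) set) \<Rightarrow> (walk set set \<Rightarrow> (complex^3) set) \<Rightarrow>
    (walk set \<Rightarrow> (complex^3^3) set) \<Rightarrow> (walk set set \<Rightarrow> (complex^3) set) \<Rightarrow> bool" where
  "isometric_pairs T d0 \<rho> \<phi> \<rho>' \<phi>' \<longleftrightarrow> (\<exists>F. isometry_lift F \<and>
     (\<forall>\<gamma> \<in> carrier (fund_group T d0).
        \<rho>' \<gamma> = {M'. \<exists>M \<in> \<rho> \<gamma>. \<forall>x. M' *v F x = F (M *v x)}) \<and>
     (\<forall>V \<in> lifted_vertices. \<phi>' V = F ` \<phi> V))"

definition discrete_faithful_PO21 ::
    "'d triangulation \<Rightarrow> 'd \<Rightarrow> (walk set \<Rightarrow> (complex^3^3) set) \<Rightarrow> bool" where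
  "discrete_faithful_PO21 T d0 \<rho> \<longleftrightarrow>
     \<rho> ` carrier (fund_group T d0) \<subseteq> PO21 \<and>
     discrete_in_PU21 (\<rho> ` carrier (fund_group T d0)) \<and>
     inj_on \<rho> (carrier (fund_group T d0))"

text \<open>\<open>\<rho>\<close> is the holonomy of a hyperbolic structure on the surface itself: some framing develops
  the lifted triangulation onto a family of ideal triangles with disjoint interiors.
  Discreteness and faithfulness alone do not imply this: as an abstract group, the (free)
  fundamental group is also that of other surfaces, e.g. a Fuchsian group of a pair of pants gives
  a discrete and faithful representation of the group of the once punctured torus.\<close>

definition hyperbolic_holonomy ::
    "'d triangulation \<Rightarrow> 'd \<Rightarrow> (walk set \<Rightarrow> (complex^3^3) set) \<Rightarrow> bool" where
  "hyperbolic_holonomy T d0 \<rho> \<longleftrightarrow> (\<exists>\<psi>. T_bent T d0 \<rho> \<psi> \<and>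
     (\<forall>X \<in> lifted_darts. \<forall>Y \<in> lifted_darts. lift_triangle X \<noteq> lift_triangle Y \<longrightarrow>
        open_ideal_triangle (\<psi> (origin X)) (\<psi> (origin (lift_nxt X)))
            (\<psi> (origin (lift_nxt (lift_nxt X)))) \<inter>
        open_ideal_triangle (\<psi> (origin Y)) (\<psi> (origin (lift_nxt Y)))
            (\<psi> (origin (lift_nxt (lift_nxt Y)))) = {}))"

end

theory Submission
  imports Defs "HOL-Real_Asymp.Real_Asymp" "HOL-Computational_Algebra.Fundamental_Theorem_Algebra"
begin

text \<open>A real ideal triangle has trivial stabiliser in \<open>PU(2,1)\<close>, so a framing amounts to a family of
  frames, one for each dart of the Farey tessellation, and the frames of neighbouring darts differ by
  a fixed rotation or by an antidiagonal matrix with entries \<open>t, y, 1/t\<close>, where \<open>y/t\<close> is the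
  invariant \<open>Z\<close> of the edge. Replacing the phases \<open>y\<close> by \<open>1\<close> gives \<open>\<rho>\<^sub>0\<close>. Along a path without
  backtracking the matrices of \<open>\<rho>\<^sub>0\<close> are symmetric squares of non-negative two by two matrices
  and dominate those of \<open>\<rho>\<close> entrywise. Comparing the growth of powers gives the inequality of
  spectral radii; loops around a puncture give triangular matrices with diagonals of equal moduli.
  Non-negativity also separates the triangles of \<open>\<rho>\<^sub>0\<close>, hence discreteness and faithfulness.

  For uniqueness, let \<open>\<psi>\<close> be a developing framing of \<open>\<rho>\<^sub>1\<close>. Its values are fixed points of real
  isometries, hence real, and disjointness of the triangles makes its invariants positive. Another
  framing of \<open>\<rho>\<^sub>1\<close> may replace the image of a vertex by the other fixed point of its stabiliser, but
  this does not change the cyclic order of the vertices of the quadrilaterals. So the invariants of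
  every framing of \<open>\<rho>\<^sub>1\<close> are positive, and they are determined by their moduli.\<close>

section \<open>Linear algebra of the Hermitian form\<close>

text \<open>The vector \<open>pvec x y\<close> stands for the boundary point x/y of a fixed real
  plane, and every triangle is referred to the standard one with vertices \<infinity>, 0, -1. The
  third vertex is put at -1 so that whatever lies beyond the edge from 0 to \<infinity> sits over
  the positive axis; this is the source of the non-negative matrices. Walks modulo homotopy form the
  group PSL(2,Z), so that one tessellation serves all surfaces, and the surface enters through its
  closed walks. The obstacle is that neither a turn nor a crossing alone has coherent signs, only a
  crossing followed by one or two turns does. A closed walk splits into such blocks only up to turns
  at its two ends, so entrywise domination cannot be claimed for the given element itself. For its
  powers the turns at the ends cost a factor independent of the exponent, which disappears when
  growth rates are compared; so does the polynomial factor that parabolic elements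
  introduce.\<close>

definition vec3 :: "complex \<Rightarrow> complex \<Rightarrow> complex \<Rightarrow> complex^3" where
  "vec3 a b c = vector [a, b, c]"

lemma vec3_nth [simp]: "vec3 a b c $ 1 = a" "vec3 a b c $ 2 = b" "vec3 a b c $ 3 = c"
  by (simp_all add: vec3_def)

lemma vec_eq_iff_3: "(x :: 'a^3) = y \<longleftrightarrow> x$1 = y$1 \<and> x$2 = y$2 \<and> x$3 = y$3"
  by (simp add: vec_eq_iff forall_3)

lemma mat_eq_iff_3: "(A :: 'a^3^3) = B \<longleftrightarrow>
    A$1$1 = B$1$1 \<and> A$1$2 = B$1$2 \<and> A$1$3 = B$1$3 \<and>
    A$2$1 = B$2$1 \<and> A$2$2 = B$2$2 \<and> A$2$3 = B$2$3 \<and>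
    A$3$1 = B$3$1 \<and> A$3$2 = B$3$2 \<and> A$3$3 = B$3$3"
  by (simp add: vec_eq_iff_3)

lemma matrix_mult_nth_3: "((A :: complex^3^3) ** B) $ i $ j
    = A$i$1 * B$1$j + A$i$2 * B$2$j + A$i$3 * B$3$j"
  by (simp add: matrix_matrix_mult_def sum_3)

lemma matrix_vector_nth_3: "((A :: complex^3^3) *v x) $ i = A$i$1 * x$1 + A$i$2 * x$2 + A$i$3 * x$3"
  by (simp add: matrix_vector_mult_def sum_3)

lemma matrix_vector_mult_smult: "(A :: complex^3^3) *v (c *s x) = c *s (A *v x)"
  by (simp add: vec_eq_iff_3 matrix_vector_nth_3 algebra_simps)

lemma mat_mult_vector: "(mat c :: complex^3^3) *v x = c *s x"
  by (simp add: vec_eq_iff_3 matrix_vector_nth_3 mat_def)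

lemma mat_mult_nth: "((mat c :: complex^3^3) ** A) $ i $ j = c * A$i$j"
proof -
  have "i = 1 \<or> i = 2 \<or> i = 3" using exhaust_3 by blast
  then show ?thesis by (auto simp: matrix_mult_nth_3 mat_def)
qed

lemma mat_commute: "(A :: complex^3^3) ** mat c = mat c ** A"
proof -
  have "(A ** mat c) $ i $ j = c * A$i$j" for i j
  proof -
    have "j = 1 \<or> j = 2 \<or> j = 3" using exhaust_3 by blast
    then show ?thesis by (auto simp: matrix_mult_nth_3 mat_def)
  qed
  then show ?thesis by (simp add: vec_eq_iff mat_mult_nth)
qed

lemma mat_mult_mat: "(mat c :: complex^3^3) ** mat d = mat (c * d)"
  by (simp add: vec_eq_iff mat_mult_nth) (simp add: mat_def)

lemma mat_mult_mult: "(mat c ** A) ** (mat d ** B) = mat (c * d) ** ((A :: complex^3^3) ** B)"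
proof -
  have "(mat c ** A) ** (mat d ** B) = mat c ** (A ** mat d) ** B"
    by (simp add: matrix_mul_assoc)
  also have "\<dots> = mat c ** mat d ** (A ** B)"
    unfolding mat_commute[of A d] by (simp add: matrix_mul_assoc)
  finally show ?thesis by (simp add: mat_mult_mat)
qed

lemma herm_smult_left: "herm (c *s x) y = c * herm x y"
  by (simp add: herm_def algebra_simps)

lemma herm_smult_right: "herm x (c *s y) = cnj c * herm x y"
  by (simp add: herm_def algebra_simps)

lemma herm_add_left: "herm (x + x') y = herm x y + herm x' y"
  by (simp add: herm_def algebra_simps)

lemma herm_add_right: "herm x (y + y') = herm x y + herm x y'"
  by (simp add: herm_def algebra_simps)

lemma herm_diff_left: "herm (x - x') y = herm x y - herm x' y"
  by (simp add: herm_def algebra_simps)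

lemma herm_diff_right: "herm x (y - y') = herm x y - herm x y'"
  by (simp add: herm_def algebra_simps)

lemma herm_commute: "herm y x = cnj (herm x y)"
  by (simp add: herm_def algebra_simps)

lemma herm_zero [simp]: "herm 0 y = 0" "herm x 0 = 0"
  by (simp_all add: herm_def)

lemma herm_matrix_eq: "herm_matrix $ 1 = vec3 0 0 1" "herm_matrix $ 2 = vec3 0 1 0"
  "herm_matrix $ 3 = vec3 1 0 0"
  by (simp_all add: herm_matrix_def vec3_def)

lemma herm_mult_mult:
  "herm (A *v x) (A *v y) = (\<Sum>i\<in>UNIV. \<Sum>j\<in>UNIV. cnj (y$i) * (conj_transpose A ** herm_matrix ** A) $
      i $ j * x$j)"
  by (simp add: sum_3 herm_def matrix_vector_nth_3 matrix_mult_nth_3 herm_matrix_eq conj_transpose_def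
      algebra_simps)

lemma herm_eq_sum: "herm x y = (\<Sum>i\<in>UNIV. \<Sum>j\<in>UNIV. cnj (y$i) * herm_matrix $ i $ j * x$j)"
  by (simp add: sum_3 herm_def herm_matrix_eq algebra_simps)

lemma axis_sum: "(\<Sum>i\<in>UNIV. \<Sum>j\<in>UNIV. cnj ((axis k 1 :: complex^3)$i) * (C :: complex^3^3) $ i $ j *
    (axis l 1 :: complex^3)$j)
    = C $ k $ l"
  using exhaust_3[of k] exhaust_3[of l] by (auto simp: sum_3 axis_def)

lemma herm_preserving_imp_matrix:
  assumes "\<And>x y. herm (A *v x) (A *v y) = herm x y"
  shows "conj_transpose A ** herm_matrix ** A = herm_matrix"
proof -
  have "(conj_transpose A ** herm_matrix ** A) $ k $ l = herm_matrix $ k $ l" for k l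
    using assms[of "axis l 1" "axis k 1"] unfolding herm_mult_mult axis_sum
    unfolding herm_eq_sum axis_sum .
  then show ?thesis by (simp add: vec_eq_iff)
qed

lemma matrix_sandwich_invertible:
  assumes "conj_transpose A ** herm_matrix ** A = herm_matrix"
  shows "invertible A"
proof -
  have hh: "herm_matrix ** herm_matrix = mat 1"
    by (simp add: mat_eq_iff_3 matrix_mult_nth_3 herm_matrix_eq mat_def)
  have "(herm_matrix ** conj_transpose A ** herm_matrix) ** A = mat 1"
    using assms hh by (simp add: matrix_mul_assoc[symmetric])
  then show ?thesis using invertible_left_inverse by blast
qed

lemma U21_iff: "A \<in> carrier U21 \<longleftrightarrow> (\<forall>x y. herm (A *v x) (A *v y) = herm x y)"
proof
  assume "A \<in> carrier U21"
  then show "\<forall>x y. herm (A *v x) (A *v y) = herm x y"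
    unfolding herm_mult_mult unfolding herm_eq_sum by (simp add: U21_def)
next
  assume "\<forall>x y. herm (A *v x) (A *v y) = herm x y"
  then show "A \<in> carrier U21"
    using herm_preserving_imp_matrix matrix_sandwich_invertible by (auto simp: U21_def)
qed

lemma U21_herm: "A \<in> carrier U21 \<Longrightarrow> herm (A *v x) (A *v y) = herm x y"
  by (simp add: U21_iff)

lemma U21_invertible: "A \<in> carrier U21 \<Longrightarrow> invertible A"
  by (simp add: U21_def)

lemma U21_mult: "A \<in> carrier U21 \<Longrightarrow> B \<in> carrier U21 \<Longrightarrow> A ** B \<in> carrier U21"
  by (simp add: U21_iff matrix_vector_mul_assoc[symmetric])

lemma U21_one: "mat 1 \<in> carrier U21"
  by (simp add: U21_iff)

lemma U21_unit: "cmod c = 1 \<Longrightarrow> mat c \<in> carrier U21"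
  by (simp add: U21_iff mat_mult_vector herm_smult_left herm_smult_right)
    (metis complex_norm_square mult.commute of_real_1 one_power2)

lemma U21_matrix_inv:
  assumes "A \<in> carrier U21"
  shows "matrix_inv A \<in> carrier U21" "A ** matrix_inv A = mat 1" "matrix_inv A ** A = mat 1"
proof -
  have inv: "invertible A" using assms U21_invertible by blast
  show 1: "A ** matrix_inv A = mat 1" and "matrix_inv A ** A = mat 1"
    using inv by (simp_all add: invertible_def matrix_inv_def someI_ex[of "\<lambda>B. A ** B = mat 1
        \<and> B ** A = mat 1"])
  have "herm (matrix_inv A *v x) (matrix_inv A *v y) = herm x y" for x y
    using U21_herm[OF assms, of "matrix_inv A *v x" "matrix_inv A *v y"]
    by (simp add: matrix_vector_mul_assoc 1)
  then show "matrix_inv A \<in> carrier U21" by (simp add: U21_iff)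
qed

lemma U21_inj: "A \<in> carrier U21 \<Longrightarrow> A *v x = A *v y \<Longrightarrow> x = y"
  by (metis U21_matrix_inv(3) matrix_vector_mul_assoc matrix_vector_mul_lid)

lemma U21_nonzero: "A \<in> carrier U21 \<Longrightarrow> x \<noteq> 0 \<Longrightarrow> A *v x \<noteq> 0"
  using U21_inj[of A x 0] by auto

lemma cline_self: "v \<in> cline v"
  unfolding cline_def by (rule range_eqI[of _ _ 1]) simp

lemma cline_eqD: "cline v = cline w \<Longrightarrow> \<exists>c. v = c *s w"
  using cline_self[of v] by (auto simp: cline_def)

lemma cline_smult: "c \<noteq> 0 \<Longrightarrow> cline (c *s v) = cline v"
proof -
  assume c: "c \<noteq> 0"
  have "range (\<lambda>d. d *s (c *s v)) = (\<lambda>d. d *s v) ` range (\<lambda>d. d * c)"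
    by (simp add: image_image vector_smult_assoc)
  also have "range (\<lambda>d. d * c) = UNIV"
    using c by (intro surjI[of _ "\<lambda>d. d / c"]) simp
  finally show ?thesis by (simp add: cline_def)
qed

lemma cline_eq_nonzero: "cline v = cline w \<Longrightarrow> v \<noteq> 0 \<Longrightarrow> \<exists>c. c \<noteq> 0 \<and> v = c *s w"
  by (metis cline_eqD vector_smult_lzero)

lemma cline_image: "((*v) A) ` cline v = cline (A *v v)"
  unfolding cline_def image_image matrix_vector_mult_smult ..

lemma cline_U21_cancel:
  assumes "A \<in> carrier U21" "cline (A *v v) = cline (A *v w)"
  shows "cline v = cline w"
proof -
  have "cline (matrix_inv A *v (A *v v)) = cline (matrix_inv A *v (A *v w))"
    using assms(2) by (metis cline_image)
  then show ?thesis using assms(1) by (simp add: matrix_vector_mul_assoc U21_matrix_inv)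
qed

lemma null_orth_3:
  assumes "herm w w = 0" "w $ 3 = 0" shows "w $ 2 = 0"
  using assms by (simp add: herm_def)

text \<open>In signature (2,1) isotropic subspaces have dimension at most one. Concretely,
  subtracting from \<open>w\<close> the multiple of \<open>z\<close> that kills the third coordinate
  leaves a null vector on the first axis, and orthogonality to \<open>z\<close> then kills
  it.\<close>

lemma null_orthogonal_imp_parallel:
  assumes z: "herm z z = 0" "z \<noteq> 0" and w: "herm w w = 0" and zw: "herm z w = 0"
  shows "\<exists>c. w = c *s z"
proof (cases "z $ 3 = 0")
  case True
  then have z2: "z $ 2 = 0" using null_orth_3 z by blast
  then have z1: "z $ 1 \<noteq> 0" using z True by (auto simp: vec_eq_iff_3)
  then have w3: "w $ 3 = 0" using zw True z2 by (simp add: herm_def)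
  then have "w $ 2 = 0" using null_orth_3 w by blast
  then have "w = (w$1 / z$1) *s z" using w3 True z1 z2 by (simp add: vec_eq_iff_3)
  then show ?thesis ..
next
  case False
  define u where "u = w - (w$3 / z$3) *s z"
  have wz: "herm w z = 0" using zw herm_commute[of w z] by simp
  have "herm u u = 0" by (simp add: u_def herm_diff_left herm_diff_right herm_smult_left
      herm_smult_right z w zw wz)
  moreover have u3: "u $ 3 = 0" using False by (simp add: u_def)
  ultimately have u2: "u $ 2 = 0" using null_orth_3 by blast
  have "herm u z = 0" by (simp add: u_def herm_diff_left herm_smult_left z wz)
  then have "u $ 1 = 0" using u2 u3 False by (simp add: herm_def)
  then have "u = 0" using u2 u3 by (simp add: vec_eq_iff_3)
  then have "w = (w$3 / z$3) *s z" by (simp add: u_def)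
  then show ?thesis ..
qed

lemma null_orthogonal_imp_cline_eq:
  assumes "herm z z = 0" "z \<noteq> 0" "herm w w = 0" "w \<noteq> 0" "herm z w = 0"
  shows "cline w = cline z"
proof -
  obtain c where c: "w = c *s z" using null_orthogonal_imp_parallel assms by blast
  then have "c \<noteq> 0" using assms(4) by auto
  then show ?thesis using c cline_smult by simp
qed

section \<open>Projective classes\<close>

definition proj_class :: "complex^3^3 \<Rightarrow> (complex^3^3) set" where
  "proj_class A = {mat c ** A | c. cmod c = 1}"

lemma proj_class_coset: "unit_scalars #>\<^bsub>U21\<^esub> A = proj_class A"
  by (auto simp: r_coset_def unit_scalars_def proj_class_def U21_def)

lemma carrier_PU21: "carrier PU21 = proj_class ` carrier U21"
  by (auto simp: PU21_def FactGroup_def RCOSETS_def proj_class_coset)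

lemma proj_class_self: "A \<in> proj_class A"
  unfolding proj_class_def by (simp, rule exI[of _ 1]) simp

lemma proj_class_mult: "proj_class A \<otimes>\<^bsub>PU21\<^esub> proj_class B = proj_class (A ** B)"
proof -
  have "proj_class A \<otimes>\<^bsub>PU21\<^esub> proj_class B = {X ** Y | X Y. X \<in> proj_class A \<and> Y \<in> proj_class B}"
    by (auto simp: PU21_def FactGroup_def set_mult_def U21_def)
  also have "\<dots> = proj_class (A ** B)"
  proof (intro equalityI subsetI)
    fix Z assume "Z \<in> {X ** Y | X Y. X \<in> proj_class A \<and> Y \<in> proj_class B}"
    then obtain c d where "Z = (mat c ** A) ** (mat d ** B)" "cmod c = 1" "cmod d = 1"
      by (auto simp: proj_class_def)
    then show "Z \<in> proj_class (A ** B)"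
      unfolding proj_class_def mat_mult_mult by (auto simp: norm_mult)
  next
    fix Z assume "Z \<in> proj_class (A ** B)"
    then obtain c where c: "Z = mat c ** (A ** B)" "cmod c = 1" by (auto simp: proj_class_def)
    then have "Z = (mat c ** A) ** B" by (simp add: matrix_mul_assoc)
    moreover have "mat c ** A \<in> proj_class A" using c by (auto simp: proj_class_def)
    ultimately show "Z \<in> {X ** Y | X Y. X \<in> proj_class A \<and> Y \<in> proj_class B}"
      using proj_class_self by blast
  qed
  finally show ?thesis .
qed

lemma proj_class_unit:
  assumes c: "cmod c = 1"
  shows "proj_class (mat c ** A) = proj_class A"
proof (intro equalityI subsetI)
  fix Z assume "Z \<in> proj_class (mat c ** A)"
  then obtain d where "Z = mat (d * c) ** A" "cmod d = 1"
    by (auto simp: proj_class_def matrix_mul_assoc mat_mult_mat)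
  then show "Z \<in> proj_class A" using c by (auto simp: proj_class_def norm_mult)
next
  fix Z assume "Z \<in> proj_class A"
  then obtain d where d: "Z = mat d ** A" "cmod d = 1" by (auto simp: proj_class_def)
  have "c \<noteq> 0" using c by auto
  then have "Z = mat (d / c) ** (mat c ** A)" using d by (simp add: matrix_mul_assoc mat_mult_mat)
  moreover have "cmod (d / c) = 1" using c d by (simp add: norm_divide)
  ultimately show "Z \<in> proj_class (mat c ** A)" by (auto simp: proj_class_def)
qed

lemma proj_class_eqI: "B \<in> proj_class A \<Longrightarrow> proj_class B = proj_class A"
proof -
  assume "B \<in> proj_class A"
  then obtain c where "B = mat c ** A" "cmod c = 1" by (auto simp: proj_class_def)
  then show ?thesis using proj_class_unit by simp
qed

lemma PU21_mem_U21:
  assumes "X \<in> carrier PU21" "P \<in> X"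
  shows "P \<in> carrier U21" "X = proj_class P"
proof -
  obtain A where A: "A \<in> carrier U21" "X = proj_class A" using assms carrier_PU21 by auto
  then obtain c where "P = mat c ** A" "cmod c = 1" using assms by (auto simp: proj_class_def)
  then show "P \<in> carrier U21" using A U21_mult U21_unit by simp
  show "X = proj_class P" using A assms proj_class_eqI by blast
qed

lemma PU21_nonempty: "X \<in> carrier PU21 \<Longrightarrow> \<exists>P. P \<in> X"
  unfolding carrier_PU21 using proj_class_self by auto

lemma proj_act_proj_class: "proj_act (proj_class A) (cline v) = cline (A *v v)"
proof -
  have e: "(mat c ** A) *v (d *s v) = (c * d) *s (A *v v)" for c d
    by (simp add: matrix_vector_mul_assoc[symmetric] mat_mult_vector matrix_vector_mult_smult
        vector_smult_assoc)
  show ?thesis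
  proof (intro equalityI subsetI)
    fix z assume "z \<in> proj_act (proj_class A) (cline v)"
    then obtain c d where "z = (mat c ** A) *v (d *s v)"
      by (auto simp: proj_act_def proj_class_def cline_def)
    then show "z \<in> cline (A *v v)" unfolding e by (auto simp: cline_def)
  next
    fix z assume "z \<in> cline (A *v v)"
    then obtain d where d: "z = d *s (A *v v)" by (auto simp: cline_def)
    then have "z = A *v (d *s v)" by (simp add: matrix_vector_mult_smult)
    moreover have "d *s v \<in> cline v" by (auto simp: cline_def)
    ultimately show "z \<in> proj_act (proj_class A) (cline v)"
      using proj_class_self unfolding proj_act_def by blast
  qed
qed

section \<open>The symmetric square\<close>

abbreviation rt2 :: complex where "rt2 \<equiv> complex_of_real (sqrt 2)"

lemma rt2_mult [simp]: "rt2 * rt2 = 2"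
  by (simp flip: of_real_mult)

lemma rt2_mult_left [simp]: "rt2 * (rt2 * z) = 2 * z"
  by (simp flip: mult.assoc of_real_mult)

lemma rt2_nonzero [simp]: "rt2 \<noteq> 0"
  by simp

text \<open>Up to signs, the matrix of the symmetric square of the matrix with rows \<open>(a, b)\<close> and
  \<open>(c, d)\<close>; \<open>pvec\<close> is the equivariant map from the plane to the null cone.\<close>

definition pvec :: "complex \<Rightarrow> complex \<Rightarrow> complex^3" where
  "pvec x y = vec3 (x^2) (rt2 * x * y) (- (y^2))"

definition sym2 :: "real \<Rightarrow> real \<Rightarrow> real \<Rightarrow> real \<Rightarrow> complex^3^3" where
  "sym2 a b c d = vector
     [vec3 (a^2) (rt2 * a * b) (- (b^2)),
      vec3 (rt2 * a * c) (a * d + b * c) (- (rt2 * b * d)),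
      vec3 (- (c^2)) (- (rt2 * c * d)) (d^2)]"

text \<open>For \<open>y = 1\<close> this is the map z -> -t/z of the boundary of the real plane: it
  exchanges 0 and \<infinity> and sends -1 to t. The phase \<open>y\<close> adds a rotation about
  the complex line through 0 and \<infinity>.\<close>

definition bend :: "real \<Rightarrow> complex \<Rightarrow> complex^3^3" where
  "bend t y = vector [vec3 0 0 t, vec3 0 y 0, vec3 (1 / t) 0 0]"

text \<open>The map z -> -1/(z + 1) of order three, which permutes \<infinity>, 0, -1
  cyclically.\<close>

abbreviation rot :: "complex^3^3" where "rot \<equiv> sym2 0 (-1) 1 1"

lemma sym2_nth:
  "sym2 a b c d $ 1 = vec3 (a^2) (rt2 * a * b) (- (b^2))"
  "sym2 a b c d $ 2 = vec3 (rt2 * a * c) (a * d + b * c) (- (rt2 * b * d))"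
  "sym2 a b c d $ 3 = vec3 (- (c^2)) (- (rt2 * c * d)) (d^2)"
  by (simp_all add: sym2_def)

lemma bend_nth:
  "bend t y $ 1 = vec3 0 0 t" "bend t y $ 2 = vec3 0 y 0" "bend t y $ 3 = vec3 (1 / t) 0 0"
  by (simp_all add: bend_def)

lemma pvec_nth [simp]: "pvec x y $ 1 = x^2" "pvec x y $ 2 = rt2 * x * y" "pvec x y $ 3 = - (y^2)"
  by (simp_all add: pvec_def)

lemma sym2_pvec:
  "sym2 a b c d *v pvec x y = pvec (of_real a * x + of_real b * y) (of_real c * x + of_real d * y)"
  by (simp add: vec_eq_iff_3 matrix_vector_nth_3 sym2_nth power2_eq_square algebra_simps)

lemma sym2_mult:
  "sym2 a b c d ** sym2 a' b' c' d' = sym2 (a*a' + b*c') (a*b' + b*d') (c*a' + d*c') (c*b' + d*d')"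
  by (simp add: mat_eq_iff_3 matrix_mult_nth_3 sym2_nth power2_eq_square algebra_simps)

lemma sym2_one: "sym2 1 0 0 1 = mat 1"
  by (simp add: mat_eq_iff_3 sym2_nth mat_def)

lemma sym2_uminus: "sym2 (-a) (-b) (-c) (-d) = sym2 a b c d"
  by (simp add: mat_eq_iff_3 sym2_nth)

lemma pvec_smult: "pvec (k * x) (k * y) = (k^2) *s pvec x y"
  by (simp add: vec_eq_iff_3 power2_eq_square algebra_simps)

lemma U21_eq_0_iff: "A \<in> carrier U21 \<Longrightarrow> A *v x = 0 \<longleftrightarrow> x = 0"
  using U21_nonzero by auto

lemma herm_pvec: "herm (pvec x y) (pvec x' y') = - ((x * cnj y' - y * cnj x')^2)"
  by (simp add: herm_def power2_eq_square algebra_simps)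

lemma pvec_eq_0_iff: "pvec x y = 0 \<longleftrightarrow> x = 0 \<and> y = 0"
  by (auto simp: vec_eq_iff_3)

lemma sym2_U21:
  assumes "a * d - b * c = 1"
  shows "sym2 a b c d \<in> carrier U21"
proof -
  have "conj_transpose (sym2 a b c d) ** herm_matrix ** sym2 a b c d
      = mat (of_real ((a * d - b * c)^2)) ** herm_matrix"
    by (simp add: mat_eq_iff_3 matrix_mult_nth_3 mat_def sym2_nth conj_transpose_def
        herm_matrix_eq power2_eq_square algebra_simps)
  then show ?thesis using assms by (simp add: U21_def matrix_sandwich_invertible)
qed

lemma rot_U21: "rot \<in> carrier U21"
  by (rule sym2_U21) simp

lemma bend_U21:
  assumes "t > 0" "cmod y = 1"
  shows "bend t y \<in> carrier U21"
proof -
  have y: "cnj y * y = 1" using assms(2)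
      by (metis complex_norm_square mult.commute of_real_1 one_power2)
  have "conj_transpose (bend t y) ** herm_matrix ** bend t y = herm_matrix"
    unfolding mat_eq_iff_3 matrix_mult_nth_3 bend_nth vec3_nth
      conj_transpose_def herm_matrix_eq vec_lambda_beta
    using assms y by simp
  then show ?thesis by (simp add: U21_def matrix_sandwich_invertible)
qed

lemma rot_cube: "rot ** rot ** rot = mat 1"
  unfolding sym2_mult by (simp add: sym2_uminus[of "1" 0 0 "1", simplified] sym2_one)

section \<open>Frames of real ideal triangles\<close>

text \<open>A triangle is marked by an isometry that carries the standard triangle \<infinity>, 0,
  -1 to it. The matrix is a lift of that isometry, hence only determined up to a unit
  scalar.\<close>

definition frame :: "(complex^3) set \<Rightarrow> (complex^3) set \<Rightarrow> (complex^3) set \<Rightarrow> complex^3^3 \<Rightarrow> bool" where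
  "frame p q r F \<longleftrightarrow> F \<in> carrier U21 \<and>
     p = cline (F *v pvec 1 0) \<and> q = cline (F *v pvec 0 1) \<and> r = cline (F *v pvec (-1) 1)"

lemma frame_U21: "frame p q r F \<Longrightarrow> F \<in> carrier U21"
  by (simp add: frame_def)

lemma frame_left_mult:
  assumes "frame p q r F" "A \<in> carrier U21"
  shows "frame (((*v) A) ` p) (((*v) A) ` q) (((*v) A) ` r) (A ** F)"
  using assms by (simp add: frame_def cline_image matrix_vector_mul_assoc U21_mult)

lemma frame_unit:
  assumes "frame p q r F" "cmod c = 1"
  shows "frame p q r (mat c ** F)"
proof -
  have "c \<noteq> 0" using assms by auto
  then show ?thesis using assms
    by (simp add: frame_def U21_mult U21_unit matrix_vector_mul_assoc[symmetric] mat_mult_vector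
        cline_smult)
qed

lemma frame_rotate:
  assumes "frame p q r F"
  shows "frame q r p (F ** rot)"
proof -
  have "rot *v pvec 1 0 = pvec 0 1" "rot *v pvec 0 1 = pvec (-1) 1" "rot *v pvec (-1) 1 = pvec 1 0"
    by (simp_all add: sym2_pvec) (simp add: pvec_def)
  then show ?thesis using assms
    by (simp add: frame_def U21_mult rot_U21 matrix_vector_mul_assoc[symmetric])
qed

lemma matrix_eq_on_pvec:
  fixes A B :: "complex^3^3"
  assumes "A *v pvec 1 0 = B *v pvec 1 0" "A *v pvec 0 1 = B *v pvec 0 1"
    "A *v pvec (-1) 1 = B *v pvec (-1) 1"
  shows "A = B"
proof -
  have 1: "A$i$1 = B$i$1" "A$i$3 = B$i$3" "A$i$1 - rt2 * A$i$2 - A$i$3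
      = B$i$1 - rt2 * B$i$2 - B$i$3" for i
    using arg_cong[OF assms(1), of "\<lambda>v. v $ i"] arg_cong[OF assms(2), of "\<lambda>v. v $ i"]
      arg_cong[OF assms(3), of "\<lambda>v. v $ i"] by (auto simp: matrix_vector_nth_3 algebra_simps)
  moreover have "A$i$2 = B$i$2" for i
    using 1(3)[of i] by (simp add: 1(1)[of i] 1(2)[of i])
  ultimately show ?thesis by (simp add: mat_eq_iff_3)
qed

text \<open>The three standard null vectors have pairwise products -1. If the frames differ on them
  by factors a, b, c, preservation of these products gives a * cnj b = a * cnj c = b * cnj c = 1, so
  the factors coincide and have modulus 1.\<close>

lemma frame_unique:
  assumes F: "frame p q r F" and G: "frame p q r G"
  shows "\<exists>c. cmod c = 1 \<and> G = mat c ** F"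
proof -
  have nz: "pvec 1 0 \<noteq> 0" "pvec 0 1 \<noteq> 0" "pvec (-1) 1 \<noteq> 0" by (simp_all add: pvec_eq_0_iff)
  have U: "F \<in> carrier U21" "G \<in> carrier U21" using F G frame_U21 by auto
  obtain a where a: "a \<noteq> 0" "G *v pvec 1 0 = a *s (F *v pvec 1 0)"
    using cline_eq_nonzero U21_nonzero[OF U(2) nz(1)] F G unfolding frame_def by metis
  obtain b where b: "b \<noteq> 0" "G *v pvec 0 1 = b *s (F *v pvec 0 1)"
    using cline_eq_nonzero U21_nonzero[OF U(2) nz(2)] F G unfolding frame_def by metis
  obtain c where c: "c \<noteq> 0" "G *v pvec (-1) 1 = c *s (F *v pvec (-1) 1)"
    using cline_eq_nonzero U21_nonzero[OF U(2) nz(3)] F G unfolding frame_def by metis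
  have ab: "a * cnj b = 1"
    using U21_herm[OF U(2), of "pvec 1 0" "pvec 0 1"]
    unfolding a b herm_smult_left herm_smult_right U21_herm[OF U(1)]
        by (simp add: herm_pvec mult.commute)
  moreover have "a * cnj c = 1"
    using U21_herm[OF U(2), of "pvec 1 0" "pvec (-1) 1"]
    unfolding a c herm_smult_left herm_smult_right U21_herm[OF U(1)]
        by (simp add: herm_pvec mult.commute)
  moreover have bc: "b * cnj c = 1"
    using U21_herm[OF U(2), of "pvec 0 1" "pvec (-1) 1"]
    unfolding b c herm_smult_left herm_smult_right U21_herm[OF U(1)]
        by (simp add: herm_pvec mult.commute)
  ultimately have "cnj b = cnj c" "a = b" using a(1) c(1)
    by (metis mult_cancel_left, metis mult_cancel_right complex_cnj_zero_iff)
  then have eq: "c = b" "a = b" by simp_all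
  have "(cmod b)^2 = 1" using bc eq complex_norm_square[of b] by (metis of_real_eq_1_iff)
  then have "cmod b = 1" by (simp add: power2_eq_1_iff) (use norm_ge_zero[of b] in linarith)
  moreover have "G = mat b ** F"
    by (rule matrix_eq_on_pvec)
      (simp_all add: a b c eq matrix_vector_mul_assoc[symmetric] mat_mult_vector)
  ultimately show ?thesis by blast
qed

text \<open>The Gram determinant of three null vectors is twice this real part, and it is also minus
  a squared modulus because the form has determinant -1. This is the classical bound on the Cartan
  angular invariant.\<close>

lemma gram_det:
  fixes u v w :: "complex^3"
  assumes "herm u u = 0" "herm v v = 0" "herm w w = 0"
  shows "Re (herm u v * herm v w * herm w u) \<le> 0"
proof -
  define A :: "complex^3^3" where "A = transpose (vector [u, v, w])"
  have A: "A *v axis 1 1 = u" "A *v axis 2 1 = v" "A *v axis 3 1 = w"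
    by (simp_all add: A_def vec_eq_iff_3 matrix_vector_nth_3 transpose_def axis_def)
  define G where "G = conj_transpose A ** herm_matrix ** A"
  have G: "G $ k $ l = herm (A *v axis l 1) (A *v axis k 1)" for k l
    unfolding G_def herm_mult_mult axis_sum ..
  have "det (conj_transpose A) = cnj (det A)"
    by (simp add: det_3 conj_transpose_def algebra_simps)
  moreover have "det herm_matrix = -1"
    by (simp add: det_3 herm_matrix_eq)
  ultimately have "det G = - (cnj (det A) * det A)"
    by (simp add: G_def det_mul)
  also have "\<dots> = - of_real ((cmod (det A))^2)"
    unfolding complex_norm_square by (simp add: mult.commute)
  finally have "Re (det G) \<le> 0" by simp
  moreover have "det G = herm u v * herm v w * herm w u + cnj (herm u v * herm v w * herm w u)"
    by (simp add: det_3 G A assms herm_commute[of u v] herm_commute[of w u] herm_commute[of v w])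
  ultimately have "Re (herm u v * herm v w * herm w u) + Re (cnj (herm u v * herm v w * herm w u)) \<le> 0"
    by (metis plus_complex.sel(1))
  then show ?thesis by (simp only: cnj.sel)
qed

lemma frame_of_gram:
  assumes n: "herm u u = 0" "herm v v = 0" "herm w w = 0"
    and g: "herm u v = -1" "herm v w = -1" "herm w u = -1"
  shows "\<exists>F. frame (cline u) (cline v) (cline w) F"
proof -
  \<comment> \<open>The unit vector orthogonal to \<open>u\<close> and \<open>v\<close>, with the
    sign for which \<open>pvec (-1) 1\<close>, whose image is u - sqrt 2 * e + v, goes to
    \<open>w\<close>.\<close>
  define e where "e = (1 / rt2) *s (u + v - w)"
  define F :: "complex^3^3" where "F = transpose (vector [u, e, - v])"
  have F: "F *v x = x$1 *s u + x$2 *s e - x$3 *s v" for x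
    by (simp add: F_def vec_eq_iff_3 matrix_vector_nth_3 transpose_def)
  have g': "herm v u = -1" "herm w v = -1" "herm u w = -1"
    using g herm_commute[of v u] herm_commute[of w v] herm_commute[of u w] by simp_all
  have i2: "(1 / rt2) * (1 / rt2) = 1 / 2" by simp
  have he: "herm e e = 1" "herm e u = 0" "herm e v = 0" "herm u e = 0" "herm v e = 0"
    by (simp_all add: e_def herm_smult_left herm_smult_right herm_diff_left herm_diff_right
        herm_add_left herm_add_right n g g' flip: of_real_mult)
  have "F \<in> carrier U21"
    unfolding U21_iff F
    by (simp add: herm_smult_left herm_smult_right herm_diff_left herm_diff_right
        herm_add_left herm_add_right n g g' he) (simp add: herm_def algebra_simps)
  moreover have "F *v pvec 1 0 = u" "F *v pvec 0 1 = v" "F *v pvec (-1) 1 = w"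
    unfolding F by (simp_all add: e_def vector_smult_assoc algebra_simps)
  ultimately show ?thesis unfolding frame_def by metis
qed

lemma real_ideal_triangle_frame:
  assumes "real_ideal_triangle p q r"
  shows "\<exists>F. frame p q r F"
proof -
  obtain R where R: "totally_real R" "{p, q, r} \<subseteq> real_plane_boundary R"
    and ne: "p \<noteq> q" "q \<noteq> r" "p \<noteq> r"
    using assms by (auto simp: real_ideal_triangle_def)
  obtain u where u: "p = cline u" "u \<in> R" "u \<noteq> 0" "herm u u = 0"
    using R(2) by (auto simp: real_plane_boundary_def)
  obtain v where v: "q = cline v" "v \<in> R" "v \<noteq> 0" "herm v v = 0"
    using R(2) by (auto simp: real_plane_boundary_def)
  obtain w where w: "r = cline w" "w \<in> R" "w \<noteq> 0" "herm w w = 0"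
    using R(2) by (auto simp: real_plane_boundary_def)
  obtain a b c :: real where abc: "herm u v = of_real a" "herm v w = of_real b" "herm w u = of_real c"
    using R(1) u v w unfolding totally_real_def by (metis Reals_cases)
  have "herm u v \<noteq> 0" "herm v w \<noteq> 0" "herm w u \<noteq> 0"
    using null_orthogonal_imp_cline_eq u v w ne by metis+
  then have nz: "a \<noteq> 0" "b \<noteq> 0" "c \<noteq> 0" using abc by auto
  have "a * b * c \<le> 0" using gram_det[OF u(4) v(4) w(4)] by (simp add: abc)
  then have neg: "a * b * c < 0" using nz by (simp add: less_le)
  \<comment> \<open>Real factors x, y, z are sought that make all three products of the rescaled
    lifts equal to -1. The equations x*y*a = y*z*b = z*x*c = -1 force this value of x^2, which is
    positive by \<open>gram_det\<close>.\<close>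
  define x where "x = sqrt (- b / (a * c))"
  have "- b / (a * c) = - (a * b * c) / (a * c)^2" using nz by (simp add: power2_eq_square)
  moreover have "\<dots> > 0" using neg nz by (intro divide_pos_pos) auto
  ultimately have pos: "- b / (a * c) > 0" by simp
  then have x: "x > 0" "x * x = - b / (a * c)"
    by (simp_all only: x_def real_sqrt_gt_0_iff real_sqrt_mult_self abs_of_pos)
  define y where "y = - 1 / (x * a)"
  define z where "z = - 1 / (x * c)"
  have yz: "y \<noteq> 0" "z \<noteq> 0" "x * y * a = -1" "z * x * c = -1" using x nz by (simp_all add: y_def z_def)
  have "y * z * b = b / (x * x * (a * c))" by (simp add: y_def z_def)
  then have "y * z * b = -1" using nz by (simp add: x)
  note g = yz(3,4) this
  note g' = g[THEN arg_cong[where f = complex_of_real], simplified]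
  have "\<exists>F. frame (cline (of_real x *s u)) (cline (of_real y *s v)) (cline (of_real z *s w)) F"
    using g' by (intro frame_of_gram)
      (simp_all add: herm_smult_left herm_smult_right u v w abc mult.assoc mult.left_commute)
  then show ?thesis using x yz by (simp add: cline_smult u v w)
qed

text \<open>The change of frame across an edge exchanges the lines of its two end points, and its
  middle column is orthogonal to both, so it is antidiagonal. Preservation of the form leaves a
  modulus, a phase and a common unit scalar; the scalar is absorbed by the choice of lift.\<close>

lemma frame_opp:
  assumes F: "frame c a b F" and G: "frame a c d G"
  shows "\<exists>t y. t > 0 \<and> cmod y = 1 \<and> frame a c d (F ** bend t y)"
proof -
  have U: "F \<in> carrier U21" "G \<in> carrier U21" using F G frame_U21 by auto
  define H where "H = matrix_inv F ** G"
  have HU: "H \<in> carrier U21" using U by (simp add: H_def U21_mult U21_matrix_inv)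
  have FH: "F ** H = G" using U by (simp add: H_def matrix_mul_assoc U21_matrix_inv)
  have G': "G *v x = F *v (H *v x)" for x by (simp add: FH matrix_vector_mul_assoc)
  have "cline (H *v pvec 1 0) = cline (pvec 0 1)" "cline (H *v pvec 0 1) = cline (pvec 1 0)"
    using F G U(1) unfolding frame_def G' by (metis cline_U21_cancel)+
  moreover have "H *v pvec 1 0 \<noteq> 0" "H *v pvec 0 1 \<noteq> 0"
    using HU by (simp_all add: U21_eq_0_iff pvec_eq_0_iff)
  ultimately obtain l m where l: "l \<noteq> 0" "H *v pvec 1 0 = l *s pvec 0 1"
    and m: "m \<noteq> 0" "H *v pvec 0 1 = m *s pvec 1 0"
    using cline_eq_nonzero by meson
  have col: "H$1$1 = 0" "H$2$1 = 0" "H$3$1 = - l" "H$1$3 = - m" "H$2$3 = 0" "H$3$3 = 0"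
    using l(2) m(2) by (simp_all add: vec_eq_iff_3 matrix_vector_nth_3 neg_equal_iff_equal)
      (metis minus_equation_iff)+
  define e where "e = vec3 0 1 0"
  have "herm (H *v e) (H *v pvec 1 0) = 0" "herm (H *v e) (H *v pvec 0 1) = 0"
    "herm (H *v e) (H *v e) = 1" "herm (H *v pvec 0 1) (H *v pvec 1 0) = -1"
    unfolding U21_herm[OF HU] by (simp_all add: e_def herm_def)
  then have h: "H$1$2 = 0" "H$3$2 = 0" "H$2$2 * cnj (H$2$2) = 1" "m * cnj l = 1"
    using l(1) m(1) by (simp_all add: e_def herm_def matrix_vector_nth_3 col)
  define t where "t = cmod m"
  \<comment> \<open>The scalar that makes the upper right entry of \<open>H\<close> the positive
    number \<open>t\<close>.\<close>
  define k where "k = - m / of_real t"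
  define y where "y = H$2$2 / k"
  have t: "t > 0" using m by (simp add: t_def)
  have k: "cmod k = 1" using m by (simp add: k_def t_def norm_divide)
  have "(cmod (H$2$2))^2 = 1" using h(3) complex_norm_square[of "H$2$2"] by (metis of_real_eq_1_iff)
  then have "cmod (H$2$2) = 1" by (simp add: power2_eq_1_iff) (use norm_ge_zero[of "H$2$2"] in linarith)
  then have y: "cmod y = 1" using k by (simp add: y_def norm_divide)
  have "cnj m * l = 1" using arg_cong[OF h(4), of cnj] by simp
  moreover have "cnj m * m = of_real t * of_real t"
    by (simp add: t_def mult.commute complex_norm_square[symmetric] power2_eq_square)
  ultimately have "l * (of_real t * of_real t) = m"
    by (metis mult.left_commute mult.right_neutral)
  then have l': "l = m / (of_real t * of_real t)" using t by (simp add: field_simps)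
  have "H = mat k ** bend t y"
    using k t by (auto simp: mat_eq_iff_3 mat_mult_nth bend_nth col h l' k_def y_def)
  then have "G = mat k ** (F ** bend t y)"
    unfolding FH[symmetric] by (simp add: matrix_mul_assoc mat_commute)
  moreover have "k \<noteq> 0" using k by auto
  ultimately have "F ** bend t y = mat (1 / k) ** G"
    by (simp add: matrix_mul_assoc mat_mult_mat)
  then have "frame a c d (F ** bend t y)"
    using frame_unit[OF G, of "1 / k"] k by (simp add: norm_divide)
  then show ?thesis using t y by blast
qed

lemma point_lift_cline:
  assumes "q \<noteq> 0"
  shows "\<exists>k. k \<noteq> 0 \<and> point_lift (cline q) = k *s q"
proof -
  have "point_lift (cline q) \<in> cline q \<and> point_lift (cline q) \<noteq> 0"
    unfolding point_lift_def by (rule someI[of _ q]) (simp add: assms cline_self)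
  then obtain k where "point_lift (cline q) = k *s q" "point_lift (cline q) \<noteq> 0"
    by (auto simp: cline_def)
  then show ?thesis by auto
qed

lemma polar_vector:
  assumes F: "F \<in> carrier U21" and v: "herm v (F *v pvec 0 1) = 0" "herm v (F *v pvec 1 0) = 0"
  shows "\<exists>k. v = k *s (F *v vec3 0 1 0)"
proof -
  define x where "x = matrix_inv F *v v"
  have x: "v = F *v x" using F by (simp add: x_def matrix_vector_mul_assoc U21_matrix_inv)
  have "herm x (pvec 0 1) = 0" "herm x (pvec 1 0) = 0" using v unfolding x U21_herm[OF F] by auto
  then have "x = (x$2) *s vec3 0 1 0" by (simp add: herm_def vec_eq_iff_3)
  then have "v = (x$2) *s (F *v vec3 0 1 0)" by (metis x matrix_vector_mult_smult)
  then show ?thesis ..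
qed

text \<open>The choices hidden in \<open>Z_inv\<close> cancel: polar vectors are proportional by
  \<open>polar_vector\<close>, and each factor of a lift in the numerator recurs in the
  denominator.\<close>

lemma Z_inv_eq:
  assumes F: "F \<in> carrier U21" "cline q1 = cline (F *v pvec 0 1)" "cline q3 = cline (F *v pvec 1 0)"
    and q: "q1 \<noteq> 0" "q2 \<noteq> 0" "q3 \<noteq> 0" "q4 \<noteq> 0"
    and v: "v \<noteq> 0" "herm v q1 = 0" "herm v q3 = 0"
  shows "Z_inv (cline q1) (cline q2) (cline q3) (cline q4)
     = - (herm q4 v * herm q2 q1) / (herm q2 v * herm q4 q1)"
proof -
  obtain k1 where k1: "k1 \<noteq> 0" "point_lift (cline q1) = k1 *s q1" using point_lift_cline q by blast
  obtain k2 where k2: "k2 \<noteq> 0" "point_lift (cline q2) = k2 *s q2" using point_lift_cline q by blast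
  obtain k3 where k3: "k3 \<noteq> 0" "point_lift (cline q3) = k3 *s q3" using point_lift_cline q by blast
  obtain k4 where k4: "k4 \<noteq> 0" "point_lift (cline q4) = k4 *s q4" using point_lift_cline q by blast
  define P where "P = (\<lambda>v. v \<noteq> 0 \<and> herm v (k1 *s q1) = 0 \<and> herm v (k3 *s q3) = 0)"
  define v' where "v' = (SOME v. P v)"
  have "P v'" unfolding v'_def by (rule someI[of _ v]) (simp add: P_def v herm_smult_right)
  then have v': "v' \<noteq> 0" "herm v' q1 = 0" "herm v' q3 = 0" using k1 k3
      by (simp_all add: P_def herm_smult_right)
  obtain c1 c3 where c: "c1 \<noteq> 0" "q1 = c1 *s (F *v pvec 0 1)" "c3 \<noteq> 0" "q3 = c3 *s (F *v pvec 1 0)"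
    using F q cline_eq_nonzero by meson
  obtain k where k: "v = k *s (F *v vec3 0 1 0)"
    using polar_vector[OF F(1), of v] v c by (auto simp: herm_smult_right)
  obtain k' where k': "v' = k' *s (F *v vec3 0 1 0)"
    using polar_vector[OF F(1), of v'] v' c by (auto simp: herm_smult_right)
  have kn: "k \<noteq> 0" "k' \<noteq> 0" using k v k' v' by auto
  then have "v' = (k' / k) *s v" by (simp add: k k' vector_smult_assoc)
  moreover define m where "m = k' / k"
  ultimately have m: "v' = m *s v" "m \<noteq> 0" using kn by auto
  have "Z_inv (cline q1) (cline q2) (cline q3) (cline q4)
    = - (herm (k4 *s q4) v' * herm (k2 *s q2) (k1 *s q1)) / (herm (k2 *s q2) v' * herm (k4 *s q4)
        (k1 *s q1))"
    by (simp add: Z_inv_def k1 k2 k3 k4 Let_def v'_def P_def)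
  also have "\<dots> = - (herm q4 v * herm q2 q1) / (herm q2 v * herm q4 q1)"
    using m k1 k2 k3 k4 by (simp add: herm_smult_left herm_smult_right)
  finally show ?thesis .
qed

lemma Z_inv_frame:
  assumes F: "frame c a b F" and G: "frame a c d (F ** bend t y)" and ty: "t > 0" "cmod y = 1"
  shows "Z_inv a b c d = y / of_real t"
proof -
  have U: "F \<in> carrier U21" using F frame_U21 by auto
  have e: "(F ** bend t y) *v pvec (-1) 1 = F *v (bend t y *v pvec (-1) 1)"
    by (simp add: matrix_vector_mul_assoc)
  have b0: "bend t y *v pvec (-1) 1 \<noteq> 0" using ty
      by (intro U21_nonzero bend_U21) (auto simp: pvec_eq_0_iff)
  have "Z_inv (cline (F *v pvec 0 1)) (cline (F *v pvec (-1) 1)) (cline (F *v pvec 1 0)) (cline (F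
      *v (bend t y *v pvec (-1) 1)))
     = - (herm (F *v (bend t y *v pvec (-1) 1)) (F *v vec3 0 1 0) * herm (F *v pvec (-1) 1) (F *v
         pvec 0 1))
     / (herm (F *v pvec (-1) 1) (F *v vec3 0 1 0) * herm (F *v (bend t y *v pvec (-1) 1)) (F *v pvec
         0 1))"
    using U b0 by (intro Z_inv_eq[where F = F])
      (simp_all add: U21_eq_0_iff pvec_eq_0_iff U21_herm, simp_all add: herm_def vec_eq_iff_3)
  also have "\<dots> = y / of_real t"
    unfolding U21_herm[OF U] using ty by (simp add: herm_def matrix_vector_nth_3 bend_nth)
  finally show ?thesis using F G unfolding frame_def e by simp
qed

lemma Z_inv_isometry:
  assumes F: "frame c a b F" and G: "frame a c d G" and A: "A \<in> carrier U21"
  shows "Z_inv (((*v) A) ` a) (((*v) A) ` b) (((*v) A) ` c) (((*v) A) ` d) = Z_inv a b c d"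
proof -
  obtain t y where ty: "t > 0" "cmod y = 1" "frame a c d (F ** bend t y)"
    using frame_opp[OF F G] by blast
  then show ?thesis
    using Z_inv_frame[OF frame_left_mult[OF F A], of _ t y] frame_left_mult[OF ty(3) A]
    by (simp add: matrix_mul_assoc Z_inv_frame[OF F ty(3)])
qed

section \<open>Walks\<close>

lemma walk_homotopic_append_cong:
  assumes "walk_homotopic u u'" "walk_homotopic v v'"
  shows "walk_homotopic (u @ v) (u' @ v')"
proof -
  have ctx: "walk_homotopic (a @ w @ b) (a @ w' @ b)" if "walk_homotopic w w'" for a b w w'
    using that
  proof (induction rule: walk_homotopic.induct)
    case (triangle u v)
    then show ?case using walk_homotopic.triangle[of "a @ u" "v @ b"] by simp
  next
    case (edge u v)
    then show ?case using walk_homotopic.edge[of "a @ u" "v @ b"] by simp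
  qed (auto intro: walk_homotopic.intros)
  show ?thesis using ctx[OF assms(1), of "[]" v] ctx[OF assms(2), of u' "[]"]
    by (auto intro: walk_homotopic.trans)
qed

lemmas homotopic_refl = walk_homotopic.refl
lemmas homotopic_sym = walk_homotopic.sym
lemmas homotopic_trans = walk_homotopic.trans

lemma homotopic_left: "walk_homotopic v v' \<Longrightarrow> walk_homotopic (u @ v) (u @ v')"
  by (intro walk_homotopic_append_cong homotopic_refl)

lemma homotopic_right: "walk_homotopic u u' \<Longrightarrow> walk_homotopic (u @ v) (u' @ v)"
  by (intro walk_homotopic_append_cong homotopic_refl)

lemma homotopic_NNN: "walk_homotopic (u @ Nxt # Nxt # Nxt # v) (u @ v)"
  using walk_homotopic.triangle[of u v] by simp

lemma homotopic_OO: "walk_homotopic (u @ Opp # Opp # v) (u @ v)"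
  using walk_homotopic.edge[of u v] by simp

lemma walk_class_eq_iff: "walk_class u = walk_class v \<longleftrightarrow> walk_homotopic u v"
  unfolding walk_class_def by (auto intro: walk_homotopic.intros)

lemma mem_walk_class: "u \<in> walk_class w \<longleftrightarrow> walk_homotopic w u"
  by (simp add: walk_class_def)

lemma class_append_walk_class: "class_append (walk_class u) (walk_class v) = walk_class (u @ v)"
proof (intro equalityI subsetI)
  fix w assume "w \<in> class_append (walk_class u) (walk_class v)"
  then obtain a b where "walk_homotopic u a" "walk_homotopic v b" "walk_homotopic (a @ b) w"
    by (auto simp: class_append_def mem_walk_class)
  then show "w \<in> walk_class (u @ v)"
    unfolding mem_walk_class using walk_homotopic_append_cong homotopic_trans by blast
next
  fix w assume "w \<in> walk_class (u @ v)"
  then show "w \<in> class_append (walk_class u) (walk_class v)"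
    using mem_walk_class homotopic_refl unfolding class_append_def by blast
qed

lemma lift_nxt_walk_class: "lift_nxt (walk_class w) = walk_class (w @ [Nxt])"
  by (simp add: lift_nxt_def class_append_walk_class)

lemma lift_opp_walk_class: "lift_opp (walk_class w) = walk_class (w @ [Opp])"
  by (simp add: lift_opp_def class_append_walk_class)

lemma lift_triangle_walk_class:
  "lift_triangle (walk_class w) = {walk_class w, walk_class (w @ [Nxt]), walk_class (w @ [Nxt, Nxt])}"
  by (simp add: lift_triangle_def lift_nxt_walk_class)

lemma walk_inverse_append: "walk_inverse (u @ v) = walk_inverse v @ walk_inverse u"
  by (simp add: walk_inverse_def)

lemma walk_inverse_Nil [simp]: "walk_inverse [] = []"
  by (simp add: walk_inverse_def)

lemma walk_inverse_Cons:
  "walk_inverse (m # w) = walk_inverse w @ (case m of Nxt \<Rightarrow> [Nxt, Nxt] | Opp \<Rightarrow> [Opp])"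
  by (simp add: walk_inverse_def)

lemma append_walk_inverse: "walk_homotopic (w @ walk_inverse w) []"
proof (induction w)
  case (Cons m w)
  let ?i = "case m of Nxt \<Rightarrow> [Nxt, Nxt] | Opp \<Rightarrow> [Opp]"
  have "walk_homotopic ([m] @ (w @ walk_inverse w) @ ?i) ([m] @ [] @ ?i)"
    using Cons by (intro walk_homotopic_append_cong homotopic_refl)
  moreover have "walk_homotopic ([m] @ [] @ ?i) []"
    using homotopic_NNN[of "[]" "[]"] homotopic_OO[of "[]" "[]"] by (cases m) simp_all
  ultimately show ?case using homotopic_trans by (fastforce simp: walk_inverse_Cons)
qed (simp add: homotopic_refl)

lemma walk_inverse_append_self: "walk_homotopic (walk_inverse w @ w) []"
proof (induction w)
  case (Cons m w)
  let ?i = "case m of Nxt \<Rightarrow> [Nxt, Nxt] | Opp \<Rightarrow> [Opp]"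
  have "walk_homotopic (?i @ [m]) []"
    using homotopic_NNN[of "[]" "[]"] homotopic_OO[of "[]" "[]"] by (cases m) simp_all
  then have "walk_homotopic (walk_inverse w @ (?i @ [m]) @ w) (walk_inverse w @ [] @ w)"
    by (intro walk_homotopic_append_cong homotopic_refl)
  then show ?case using Cons homotopic_trans by (fastforce simp: walk_inverse_Cons)
qed (simp add: homotopic_refl)

lemma homotopic_cancel_left:
  assumes "walk_homotopic (u @ v) (u @ v')" shows "walk_homotopic v v'"
proof -
  have "walk_homotopic (walk_inverse u @ u @ v) (walk_inverse u @ u @ v')"
    using assms by (rule homotopic_left)
  moreover have "walk_homotopic (walk_inverse u @ u @ x) x" for x
    using homotopic_right[OF walk_inverse_append_self, of u x] by simp
  ultimately show ?thesis by (meson homotopic_sym homotopic_trans)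
qed

lemma walk_end_append: "walk_end T (u @ v) d = walk_end T v (walk_end T u d)"
  by (induction u arbitrary: d rule: list.induct) (simp, case_tac x1, simp_all)

text \<open>A block word describes a path in the dual tree without backtracking.\<close>

definition block_word :: "bool list \<Rightarrow> walk" where
  "block_word bs = concat (map (\<lambda>b. if b then [Opp, Nxt] else [Opp, Nxt, Nxt]) bs)"

lemma block_word_simps [simp]:
  "block_word [] = []" "block_word (b # bs) = Opp # Nxt # (if b then [] else [Nxt]) @ block_word bs"
  "block_word (bs @ bs') = block_word bs @ block_word bs'"
  by (simp_all add: block_word_def)

lemma nxt_power_reduce: "\<exists>i<3. walk_homotopic (replicate n Nxt @ w) (replicate i Nxt @ w)"
proof (induction n rule: less_induct)
  case (less n)
  show ?case
  proof (cases "n < 3")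
    case False
    then have n: "n = Suc (Suc (Suc (n - 3)))" by simp
    obtain i where i: "i < 3" "walk_homotopic (replicate (n - 3) Nxt @ w) (replicate i Nxt @ w)"
      using less[of "n - 3"] False by auto
    have "walk_homotopic (replicate n Nxt @ w) (replicate (n - 3) Nxt @ w)"
      using homotopic_NNN[of "[]" "replicate (n - 3) Nxt @ w"] by (subst n) simp
    then show ?thesis using i homotopic_trans by blast
  qed (use homotopic_refl in blast)
qed

text \<open>Modulo homotopy the walks form the free product of cyclic groups of orders 2 and 3, and
  this is its normal form. It claims existence only: a block for \<open>True\<close> followed by
  \<open>Nxt\<close> is the block for \<open>False\<close>.\<close>

lemma walk_normal_form:
  "\<exists>i bs k. i < 3 \<and> k < 3 \<and> walk_homotopic w (replicate i Nxt @ block_word bs @ replicate k Nxt)"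
proof (induction w)
  case Nil
  show ?case
    by (rule exI[of _ 0], rule exI[of _ "[]"], rule exI[of _ 0]) (simp add: homotopic_refl)
next
  case (Cons m w)
  then obtain i bs k where ik: "i < 3" "k < 3"
    and w: "walk_homotopic w (replicate i Nxt @ block_word bs @ replicate k Nxt)" by blast
  have mw: "walk_homotopic (m # w) (m # replicate i Nxt @ block_word bs @ replicate k Nxt)"
    using homotopic_left[OF w, of "[m]"] by simp
  have finish: ?case if "j < 3" "l < 3"
    "walk_homotopic (m # replicate i Nxt @ block_word bs @ replicate k Nxt)
       (replicate j Nxt @ block_word cs @ replicate l Nxt)" for j l cs
    using homotopic_trans[OF mw that(3)] that(1,2) by blast
  show ?case
  proof (cases m)
    case Nxt
    obtain j where j: "j < 3" "walk_homotopic (replicate (Suc i) Nxt @ block_word bs @ replicate k Nxt)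
        (replicate j Nxt @ block_word bs @ replicate k Nxt)"
      using nxt_power_reduce by blast
    show ?thesis by (rule finish[OF j(1) ik(2)]) (use j(2) Nxt in simp)
  next
    case Opp
    consider "i = 1" | "i = 2" | "i = 0" using ik by linarith
    then show ?thesis
    proof cases
      case 1
      then show ?thesis using finish[of 0 k "True # bs"] ik Opp homotopic_refl by simp
    next
      case 2
      then show ?thesis using finish[of 0 k "False # bs"] ik Opp homotopic_refl
          by (simp add: numeral_2_eq_2)
    next
      case i: 3
      show ?thesis
      proof (cases bs)
        case (Cons b cs)
        show ?thesis
        proof (cases b)
          case True
          then show ?thesis using finish[of 1 k cs] ik Opp i Cons
              homotopic_OO[of "[]" "Nxt # block_word cs @ replicate k Nxt"] by simp
        next
          case False
          then show ?thesis using finish[of 2 k cs] ik Opp i Cons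
              homotopic_OO[of "[]" "Nxt # Nxt # block_word cs @ replicate k Nxt"]
            by (simp add: numeral_2_eq_2)
        qed
      next
        case Nil
        consider "k = 1" | "k = 2" | "k = 0" using ik by linarith
        then show ?thesis
        proof cases
          case 1
          then show ?thesis using finish[of 0 0 "[True]"] Opp i Nil homotopic_refl by simp
        next
          case 2
          then show ?thesis using finish[of 0 0 "[False]"] Opp i Nil homotopic_refl
              by (simp add: numeral_2_eq_2)
        next
          \<comment> \<open>A final crossing is not a block; it is completed to
            \<open>[Opp, Nxt]\<close> followed by two more turns.\<close>
          case 3
          then show ?thesis using finish[of 0 2 "[True]"] Opp i Nil
              homotopic_sym[OF homotopic_NNN[of "[Opp]" "[]"]] by (simp add: numeral_2_eq_2)
        qed
      qed
    qed
  qed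
qed

text \<open>Both relations delete an even number of crossings. The parity is a two-colouring of the
  lifted triangles and will tell a triangle from its neighbour.\<close>

lemma homotopic_parity:
  "walk_homotopic u v \<Longrightarrow> even (count_list u Opp) \<longleftrightarrow> even (count_list v Opp)"
  by (induction rule: walk_homotopic.induct) auto

section \<open>Holonomy of positive shear parameters\<close>

text \<open>The matrix that turns a frame at the end of \<open>u\<close> into one at the end of
  \<open>u @ w\<close>, by multiplication on the right, when all phases are 1. The initial walk
  \<open>u\<close> is carried along because the parameter of a crossing depends on the edge.\<close>

fun holonomy :: "(walk \<Rightarrow> real) \<Rightarrow> walk \<Rightarrow> walk \<Rightarrow> complex^3^3" where
  "holonomy t u [] = mat 1"
| "holonomy t u (Nxt # w) = rot ** holonomy t (u @ [Nxt]) w"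
| "holonomy t u (Opp # w) = bend (t u) 1 ** holonomy t (u @ [Opp]) w"

text \<open>Positive coordinates on the edges of the Farey tessellation: the last two conditions
  make the value depend on the edge only, not on the walk or on the side from which it is
  reached.\<close>

definition shear :: "(walk \<Rightarrow> real) \<Rightarrow> bool" where
  "shear t \<longleftrightarrow> (\<forall>u. t u > 0) \<and> (\<forall>u v. walk_homotopic u v \<longrightarrow> t u = t v) \<and> (\<forall>u. t (u @ [Opp]) = t u)"

lemma holonomy_append: "holonomy t u (v @ w) = holonomy t u v ** holonomy t (u @ v) w"
  by (induction t u v rule: holonomy.induct) (simp_all add: matrix_mul_assoc)

lemma holonomy_start:
  assumes "shear t" "walk_homotopic u u'" shows "holonomy t u w = holonomy t u' w"
  using assms(2)
proof (induction w arbitrary: u u')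
  case (Cons m w)
  have "holonomy t (u @ [m]) w = holonomy t (u' @ [m]) w"
    using Cons by (intro Cons.IH homotopic_right)
  moreover have "t u = t u'" using assms(1) Cons.prems by (simp add: shear_def)
  ultimately show ?case by (cases m) simp_all
qed simp

text \<open>Each relation between walks becomes a matrix identity: \<open>rot\<close> has order
  three, and both crossings of an edge carry the same parameter s, for which \<open>bend s 1\<close>
  is an involution.\<close>

lemma holonomy_homotopic:
  assumes "shear t" "walk_homotopic v v'" shows "holonomy t u v = holonomy t u v'"
  using assms(2)
proof (induction arbitrary: u rule: walk_homotopic.induct)
  case (triangle v w)
  have "holonomy t (u @ v @ [Nxt, Nxt, Nxt]) w = holonomy t (u @ v) w"
    using holonomy_start[OF assms(1) homotopic_NNN[of "u @ v" "[]"]] by simp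
  moreover have "rot ** (rot ** (rot ** X)) = X" for X :: "complex^3^3"
    using arg_cong[OF rot_cube, of "\<lambda>R. R ** X"] by (simp flip: matrix_mul_assoc)
  ultimately show ?case by (simp add: holonomy_append flip: matrix_mul_assoc)
next
  case (edge v w)
  have "holonomy t (u @ v @ [Opp, Opp]) w = holonomy t (u @ v) w"
    using holonomy_start[OF assms(1) homotopic_OO[of "u @ v" "[]"]] by simp
  moreover have "t (u @ v @ [Opp]) = t (u @ v)" "t (u @ v) > 0" using assms(1) unfolding shear_def
      by (metis append_assoc, blast)
  moreover have "bend s 1 ** (bend s 1 ** X) = X" if "s > 0" for s and X :: "complex^3^3"
  proof -
    have "bend s 1 ** bend s 1 = mat 1"
      using that by (simp add: mat_eq_iff_3 matrix_mult_nth_3 bend_nth mat_def)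
    then show ?thesis by (simp add: matrix_mul_assoc)
  qed
  ultimately show ?case by (simp add: holonomy_append flip: matrix_mul_assoc)
qed auto

lemma holonomy_U21: "shear t \<Longrightarrow> holonomy t u w \<in> carrier U21"
  by (induction t u w rule: holonomy.induct) (simp_all add: U21_one U21_mult rot_U21 bend_U21 shear_def)

lemma holonomy_equivariant:
  assumes "\<And>w. t (g @ w) = t w" shows "holonomy t (g @ u) w = holonomy t u w"
proof (induction w arbitrary: u)
  case (Cons m w)
  then show ?case using assms by (cases m) simp_all
qed simp

lemma rot_square: "rot ** rot = sym2 (-1) (-1) 1 0"
  by (simp add: sym2_mult)

lemma bend_sym2: "s > 0 \<Longrightarrow> bend (s^2) 1 = mat (-1) ** sym2 0 s (- 1 / s) 0"
  by (simp add: mat_eq_iff_3 mat_mult_nth sym2_nth bend_nth power_divide)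

lemma bend_rot: "s > 0 \<Longrightarrow> bend (s^2) 1 ** rot = mat (-1) ** sym2 s s 0 (1 / s)"
  by (simp add: bend_sym2 matrix_mul_assoc[symmetric] sym2_mult sym2_uminus)

lemma bend_rot_rot: "s > 0 \<Longrightarrow> bend (s^2) 1 ** (rot ** rot) = mat (-1) ** sym2 s 0 (1 / s) (1 / s)"
  by (simp add: bend_sym2 rot_square matrix_mul_assoc[symmetric] sym2_mult)

text \<open>The sign counts the crossings modulo 2, since each of them contributes a factor -1 by
  \<open>bend_sym2\<close>.\<close>

lemma holonomy_sym2:
  assumes "shear t"
  shows "\<exists>e a b c d. (e = 1 \<or> e = -1) \<and> a * d - b * c = 1 \<and> holonomy t u w = mat e ** sym2 a b c d"
proof (induction w arbitrary: u)
  case Nil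
  show ?case
    by (rule exI[of _ 1], rule exI[of _ 1], rule exI[of _ 0], rule exI[of _ 0], rule exI[of _ 1])
        (simp add: sym2_one)
next
  case (Cons m w)
  obtain e a b c d where h: "e = 1 \<or> e = -1" "a * d - b * c = 1"
      "holonomy t (u @ [m]) w = mat e ** sym2 a b c d"
    using Cons.IH by blast
  have step: "(mat e' ** sym2 a' b' c' d') ** (mat e ** sym2 a b c d)
     = mat (e' * e) ** sym2 (a'*a + b'*c) (a'*b + b'*d) (c'*a + d'*c) (c'*b + d'*d)" for e' a' b' c' d'
    unfolding mat_mult_mult sym2_mult ..
  have dets: "(a'*a + b'*c) * (c'*b + d'*d) - (a'*b + b'*d) * (c'*a + d'*c) = 1"
    if "a' * d' - b' * c' = 1" for a' b' c' d'
  proof -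
    have "(a'*a + b'*c) * (c'*b + d'*d) - (a'*b + b'*d) * (c'*a + d'*c)
       = (a' * d' - b' * c') * (a * d - b * c)" by (simp add: algebra_simps)
    then show ?thesis using that h by simp
  qed
  obtain e' a' b' c' d' where m: "e' = 1 \<or> e' = -1" "a' * d' - b' * c' = 1"
      "holonomy t u (m # w) = (mat e' ** sym2 a' b' c' d') ** (mat e ** sym2 a b c d)"
  proof (cases m)
    case Nxt
    then show ?thesis using that[of 1 0 1 "-1" 1] h by simp
  next
    case Opp
    define s where "s = sqrt (t u)"
    have "t u > 0" using assms by (simp add: shear_def)
    then have "s > 0" "t u = s^2" by (simp_all add: s_def)
    then show ?thesis using that[of "-1" 0 0 s "- 1 / s"] h Opp by (simp add: bend_sym2)
  qed
  have "e' * e = 1 \<or> e' * e = -1" using m h by auto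
  then show ?case using dets[OF m(2)] unfolding m(3) step by blast
qed

section \<open>Framings of the lifted triangulation\<close>

definition walk_frame :: "(walk \<Rightarrow> (complex^3) set) \<Rightarrow> walk \<Rightarrow> complex^3^3 \<Rightarrow> bool" where
  "walk_frame f w F \<longleftrightarrow> frame (f w) (f (w @ [Nxt])) (f (w @ [Nxt, Nxt])) F"

definition Z_walk :: "(walk \<Rightarrow> (complex^3) set) \<Rightarrow> walk \<Rightarrow> complex" where
  "Z_walk f w = Z_inv (f (w @ [Nxt])) (f (w @ [Nxt, Nxt])) (f w) (f (w @ [Opp, Nxt, Nxt]))"

definition shear_of :: "(walk \<Rightarrow> (complex^3) set) \<Rightarrow> walk \<Rightarrow> real" where
  "shear_of f w = 1 / cmod (Z_walk f w)"

definition bending_of :: "(walk \<Rightarrow> (complex^3) set) \<Rightarrow> walk \<Rightarrow> complex" where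
  "bending_of f w = Z_walk f w / of_real (cmod (Z_walk f w))"

text \<open>A framing pulled back to walks. The second assumption says that turning about the origin
  of a dart does not change its image, so that \<open>f\<close> comes from a function on vertices,
  see \<open>f_origin\<close>.\<close>

locale framing =
  fixes f :: "walk \<Rightarrow> (complex^3) set"
  assumes f_homotopic: "walk_homotopic u v \<Longrightarrow> f u = f v"
    and f_turn: "f (w @ [Opp, Nxt]) = f w"
    and frame_ex: "\<exists>F. walk_frame f w F"
begin

lemma walk_frame_U21: "walk_frame f w F \<Longrightarrow> F \<in> carrier U21"
  by (simp add: walk_frame_def frame_U21)

lemma walk_frame_homotopic:
  assumes "walk_homotopic u v" shows "walk_frame f u F = walk_frame f v F"
  by (simp add: walk_frame_def f_homotopic[OF assms] f_homotopic[OF homotopic_right[OF assms]])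

lemma walk_frame_unique: "walk_frame f w F \<Longrightarrow> walk_frame f w G \<Longrightarrow> \<exists>c. cmod c = 1 \<and> G = mat c ** F"
  unfolding walk_frame_def by (rule frame_unique)

lemma walk_frame_nxt: "walk_frame f w F \<Longrightarrow> walk_frame f (w @ [Nxt]) (F ** rot)"
  unfolding walk_frame_def using f_homotopic[OF homotopic_NNN[of w "[]"]] frame_rotate by fastforce

lemma f_opp: "f (w @ [Opp]) = f (w @ [Nxt])" "f (w @ [Opp, Nxt]) = f w"
proof -
  have "f (w @ [Opp]) = f ((w @ [Opp]) @ [Opp, Nxt])" by (rule f_turn[symmetric])
  also have "\<dots> = f (w @ [Nxt])" using f_homotopic[OF homotopic_OO[of w "[Nxt]"]] by simp
  finally show "f (w @ [Opp]) = f (w @ [Nxt])" .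
qed (rule f_turn)

lemma frame_opp_iff: "walk_frame f (w @ [Opp]) G \<longleftrightarrow> frame (f (w @ [Nxt])) (f w) (f (w @ [Opp, Nxt,
    Nxt])) G"
  by (simp add: walk_frame_def f_opp)

lemma walk_frame_opp:
  assumes F: "walk_frame f w F"
  shows "shear_of f w > 0" "cmod (bending_of f w) = 1"
    "walk_frame f (w @ [Opp]) (F ** bend (shear_of f w) (bending_of f w))"
    "Z_walk f w = bending_of f w / of_real (shear_of f w)"
proof -
  obtain G where "walk_frame f (w @ [Opp]) G" using frame_ex by blast
  then obtain t y where ty: "t > 0" "cmod y = 1"
    and fr: "frame (f (w @ [Nxt])) (f w) (f (w @ [Opp, Nxt, Nxt])) (F ** bend t y)"
    using F frame_opp unfolding frame_opp_iff unfolding walk_frame_def by blast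
  have Z: "Z_walk f w = y / of_real t"
    unfolding Z_walk_def using F fr ty by (intro Z_inv_frame) (simp_all add: walk_frame_def)
  then have "shear_of f w = t" "bending_of f w = y"
    using ty by (simp_all add: shear_of_def bending_of_def norm_divide)
  then show "shear_of f w > 0" "cmod (bending_of f w) = 1"
    "walk_frame f (w @ [Opp]) (F ** bend (shear_of f w) (bending_of f w))"
    "Z_walk f w = bending_of f w / of_real (shear_of f w)"
    using ty fr Z frame_opp_iff by simp_all
qed

lemma shear_shear_of: "shear (shear_of f)"
  unfolding shear_def
proof (intro conjI allI impI)
  fix u show "0 < shear_of f u" using frame_ex walk_frame_opp(1) by blast
next
  fix u v assume h: "walk_homotopic u v"
  have "f (u @ w) = f (v @ w)" for w using f_homotopic homotopic_right[OF h] by blast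
  moreover have "f u = f v" using f_homotopic h by blast
  ultimately show "shear_of f u = shear_of f v" by (simp add: shear_of_def Z_walk_def)
next
  fix u
  obtain F where F: "walk_frame f u F" using frame_ex by blast
  let ?t = "shear_of f u" and ?t' = "shear_of f (u @ [Opp])"
  let ?y = "bending_of f u" and ?y' = "bending_of f (u @ [Opp])"
  \<comment> \<open>Crossing back and forth returns to the same dart, so the product of the two
    matrices is a unit scalar. Its upper left entry is \<open>?t / ?t'\<close>, which is therefore
    1.\<close>
  have "walk_frame f ((u @ [Opp]) @ [Opp]) (F ** bend ?t ?y ** bend ?t' ?y')"
    by (intro walk_frame_opp(3) F)
  then have "walk_frame f u (F ** (bend ?t ?y ** bend ?t' ?y'))"
    using walk_frame_homotopic[OF homotopic_OO[of u "[]"]] by (simp add: matrix_mul_assoc)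
  then obtain c where c: "cmod c = 1" "F ** (bend ?t ?y ** bend ?t' ?y') = mat c ** F"
    using walk_frame_unique F by blast
  have FU: "F \<in> carrier U21" using F walk_frame_U21 by blast
  have "bend ?t ?y ** bend ?t' ?y' = (matrix_inv F ** F) ** (bend ?t ?y ** bend ?t' ?y')"
    using FU by (simp add: U21_matrix_inv)
  also have "\<dots> = matrix_inv F ** (F ** mat c)"
    using c(2) by (simp add: mat_commute matrix_mul_assoc[symmetric])
  also have "\<dots> = mat c" using FU by (simp add: matrix_mul_assoc U21_matrix_inv)
  finally have "(bend ?t ?y ** bend ?t' ?y') $ 1 $ 1 = c" by (simp add: mat_def)
  moreover have pos: "?t > 0" "?t' > 0" using frame_ex walk_frame_opp(1) by blast+
  ultimately have "of_real ?t / of_real ?t' = c" by (simp add: matrix_mult_nth_3 bend_nth)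
  then have "?t / ?t' = 1" using c(1) pos
    by (metis abs_of_pos divide_pos_pos norm_of_real of_real_divide)
  then show "?t' = ?t" using pos by simp
qed

end

section \<open>Sign patterns\<close>

text \<open>After conjugation by \<open>diag(1, 1, -1)\<close> and up to a common phase, the entries are
  non-negative.\<close>

definition sgn3 :: "3 \<Rightarrow> complex" where
  "sgn3 i = (if i = 3 then -1 else 1)"

definition nonneg_matrix :: "complex^3^3 \<Rightarrow> bool" where
  "nonneg_matrix A \<longleftrightarrow> (\<exists>e. cmod e = 1 \<and> (\<forall>i j. A$i$j = e * sgn3 i * sgn3 j * of_real (cmod (A$i$j))))"

definition nonneg_vector :: "complex^3 \<Rightarrow> bool" where
  "nonneg_vector z \<longleftrightarrow> (\<exists>e. cmod e = 1 \<and> (\<forall>i. z$i = e * sgn3 i * of_real (cmod (z$i))))"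

lemma sgn3_simps [simp]: "sgn3 1 = 1" "sgn3 2 = 1" "sgn3 3 = -1" "cmod (sgn3 i) = 1"
    "sgn3 i * sgn3 i = 1"
  by (simp_all add: sgn3_def)

lemma nonneg_matrixI:
  assumes "cmod e = 1" "\<And>i j. A$i$j = e * sgn3 i * sgn3 j * of_real (r i j)" "\<And>i j. r i j \<ge> 0"
  shows "nonneg_matrix A"
  unfolding nonneg_matrix_def
proof (intro exI[of _ e] conjI allI)
  fix i j
  have "cmod (A$i$j) = r i j" using assms(1,3) by (simp add: assms(2) norm_mult)
  then show "A$i$j = e * sgn3 i * sgn3 j * of_real (cmod (A$i$j))" using assms(2)[of i j] by simp
qed fact

lemma nonneg_vectorI:
  assumes "cmod e = 1" "\<And>i. z$i = e * sgn3 i * of_real (r i)" "\<And>i. r i \<ge> 0"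
  shows "nonneg_vector z"
  unfolding nonneg_vector_def
proof (intro exI[of _ e] conjI allI)
  fix i
  have "cmod (z$i) = r i" using assms(1,3) by (simp add: assms(2) norm_mult)
  then show "z$i = e * sgn3 i * of_real (cmod (z$i))" using assms(2)[of i] by simp
qed fact

lemma sgn3_cancel: "(x * sgn3 i * sgn3 k * r) * (y * sgn3 k * sgn3 j * s)
    = x * y * sgn3 i * sgn3 j * (r * s)"
  "(x * sgn3 i * sgn3 k * r) * (y * sgn3 k * s) = x * y * sgn3 i * (r * s)"
  by (simp_all add: sgn3_def)

text \<open>The three products summed in an entry have the same phase, hence no cancellation: the
  moduli multiply like non-negative real matrices.\<close>

lemma nonneg_matrix_mult:
  assumes "nonneg_matrix A" "nonneg_matrix B"
  shows "nonneg_matrix (A ** B)"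
    and "cmod ((A ** B) $ i $ j) = cmod (A$i$1) * cmod (B$1$j) + cmod (A$i$2) * cmod (B$2$j) + cmod
        (A$i$3) * cmod (B$3$j)"
proof -
  obtain e where e: "cmod e = 1" "\<And>i j. A$i$j = e * sgn3 i * sgn3 j * of_real (cmod (A$i$j))"
    using assms(1) by (auto simp: nonneg_matrix_def)
  obtain d where d: "cmod d = 1" "\<And>i j. B$i$j = d * sgn3 i * sgn3 j * of_real (cmod (B$i$j))"
    using assms(2) by (auto simp: nonneg_matrix_def)
  define r where "r i j = cmod (A$i$1) * cmod (B$1$j) + cmod (A$i$2) * cmod (B$2$j) + cmod (A$i$3) *
      cmod (B$3$j)" for i j
  have ed: "cmod (e * d) = 1" using e d by (simp add: norm_mult)
  have r: "r i j \<ge> 0" for i j by (simp add: r_def)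
  have AB: "A$i$k * B$k$j = e * d * sgn3 i * sgn3 j * (of_real (cmod (A$i$k)) * of_real (cmod
      (B$k$j)))" for i j k
    using e(2)[of i k] d(2)[of k j] sgn3_cancel(1) by metis
  have *: "(A ** B) $ i $ j = e * d * sgn3 i * sgn3 j * of_real (r i j)" for i j
    unfolding matrix_mult_nth_3 AB r_def of_real_add of_real_mult by (simp only: ring_distribs)
  show "nonneg_matrix (A ** B)" by (rule nonneg_matrixI[OF ed * r])
  show "cmod ((A ** B) $ i $ j) = cmod (A$i$1) * cmod (B$1$j) + cmod (A$i$2) * cmod (B$2$j) + cmod
      (A$i$3) * cmod (B$3$j)"
    unfolding * r_def[symmetric] using ed r[of i j] by (simp add: norm_mult)
qed

lemma nonneg_matrix_vector:
  assumes "nonneg_matrix A" "nonneg_vector z"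
  shows "nonneg_vector (A *v z)"
proof -
  obtain e where e: "cmod e = 1" "\<And>i j. A$i$j = e * sgn3 i * sgn3 j * of_real (cmod (A$i$j))"
    using assms(1) by (auto simp: nonneg_matrix_def)
  obtain d where d: "cmod d = 1" "\<And>i. z$i = d * sgn3 i * of_real (cmod (z$i))"
    using assms(2) by (auto simp: nonneg_vector_def)
  define r where "r i = cmod (A$i$1) * cmod (z$1) + cmod (A$i$2) * cmod (z$2) + cmod (A$i$3) * cmod
      (z$3)" for i
  have ed: "cmod (e * d) = 1" using e d by (simp add: norm_mult)
  have r: "r i \<ge> 0" for i by (simp add: r_def)
  have AB: "A$i$k * z$k = e * d * sgn3 i * (of_real (cmod (A$i$k)) * of_real (cmod (z$k)))" for i k
    using e(2)[of i k] d(2)[of k] sgn3_cancel(2) by metis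
  have *: "(A *v z) $ i = e * d * sgn3 i * of_real (r i)" for i
    unfolding matrix_vector_nth_3 AB r_def of_real_add of_real_mult by (simp only: ring_distribs)
  show ?thesis by (rule nonneg_vectorI[OF ed * r])
qed

lemma nonneg_matrix_one: "nonneg_matrix (mat 1)"
  by (rule nonneg_matrixI[of 1 _ "\<lambda>i j. if i = j then 1 else 0"]) (auto simp: mat_def)

lemma bend_rot_nth:
  "(bend t y ** rot) $ 1 = vec3 (- of_real t) (- (rt2 * of_real t)) (of_real t)"
  "(bend t y ** rot) $ 2 = vec3 0 (- y) (rt2 * y)"
  "(bend t y ** rot) $ 3 = vec3 0 0 (- 1 / of_real t)"
  by (simp_all add: vec_eq_iff_3 matrix_mult_nth_3 bend_nth sym2_nth)

lemma bend_rot_rot_nth: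
  "(bend t y ** (rot ** rot)) $ 1 = vec3 (- of_real t) 0 0"
  "(bend t y ** (rot ** rot)) $ 2 = vec3 (- (rt2 * y)) (- y) 0"
  "(bend t y ** (rot ** rot)) $ 3 = vec3 (1 / of_real t) (rt2 / of_real t) (- 1 / of_real t)"
  by (simp_all add: vec_eq_iff_3 rot_square matrix_mult_nth_3 bend_nth sym2_nth)

definition fun3 :: "'a \<Rightarrow> 'a \<Rightarrow> 'a \<Rightarrow> 3 \<Rightarrow> 'a" where
  "fun3 a b c i = (if i = 1 then a else if i = 2 then b else c)"

lemma fun3_simps [simp]: "fun3 a b c 1 = a" "fun3 a b c 2 = b" "fun3 a b c 3 = c"
  by (simp_all add: fun3_def)

text \<open>The two ways of passing to a further triangle. With t = s^2 they come from the two by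
  two matrices with rows (s, s), (0, 1/s) and (s, 0), (1/s, 1/s), both non-negative.\<close>

lemma nonneg_bend_rot:
  assumes "t > 0"
  shows "nonneg_matrix (bend t 1 ** rot)" "nonneg_matrix (bend t 1 ** (rot ** rot))"
proof -
  have "\<forall>i j. (bend t 1 ** rot) $ i $ j = (-1) * sgn3 i * sgn3 j *
      of_real (fun3 (fun3 t (sqrt 2 * t) t) (fun3 0 1 (sqrt 2)) (fun3 0 0 (1 / t)) i j)"
    by (simp add: forall_3 bend_rot_nth)
  moreover have "\<forall>i j. fun3 (fun3 t (sqrt 2 * t) t) (fun3 0 1 (sqrt 2)) (fun3 0 0 (1 / t)) i j \<ge> 0"
    using assms by (simp add: forall_3)
  ultimately show "nonneg_matrix (bend t 1 ** rot)" by (intro nonneg_matrixI[of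
      "-1"]) (simp, blast, blast)
  have "\<forall>i j. (bend t 1 ** (rot ** rot)) $ i $ j = (-1) * sgn3 i * sgn3 j *
      of_real (fun3 (fun3 t 0 0) (fun3 (sqrt 2) 1 0) (fun3 (1 / t) (sqrt 2 / t) (1 / t)) i j)"
    by (simp add: forall_3 bend_rot_rot_nth)
  moreover have "\<forall>i j. fun3 (fun3 t 0 0) (fun3 (sqrt 2) 1 0) (fun3 (1 / t) (sqrt 2 / t) (1 / t)) i j
      \<ge> 0"
    using assms by (simp add: forall_3)
  ultimately show "nonneg_matrix (bend t 1 ** (rot ** rot))" by (intro nonneg_matrixI[of
      "-1"]) (simp, blast, blast)
qed

lemma holonomy_block:
  "holonomy t u (block_word [b]) = bend (t u) 1 ** (if b then rot else rot ** rot)"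
  by (simp add: block_word_def)

lemma nonneg_holonomy_block:
  assumes "shear t"
  shows "nonneg_matrix (holonomy t u (block_word bs))"
proof (induction bs arbitrary: u)
  case (Cons b bs)
  have "t u > 0" using assms by (simp add: shear_def)
  then have "nonneg_matrix (holonomy t u (block_word [b]))"
    unfolding holonomy_block using nonneg_bend_rot by auto
  then have "nonneg_matrix (holonomy t u (block_word [b]) ** holonomy t (u @ block_word [b])
      (block_word bs))"
    using Cons by (intro nonneg_matrix_mult)
  then show ?case unfolding holonomy_append[symmetric] block_word_simps(3)[symmetric] by simp
qed (simp add: nonneg_matrix_one)

text \<open>A lift of an interior point of the standard triangle, see
  \<open>triangle_point_eq\<close>. Its first two coordinates have opposite signs for positive
  weights, which separates it from the vectors of \<open>nonneg_vector\<close>.\<close>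

definition triangle_point :: "real \<Rightarrow> real \<Rightarrow> real \<Rightarrow> complex^3" where
  "triangle_point a b c = vec3 (a + c) (- (rt2 * c)) (- b - c)"

lemma triangle_point_eq:
  "triangle_point a b c = of_real a *s pvec 1 0 + of_real b *s pvec 0 1 + of_real c *s pvec (-1) 1"
  by (simp add: triangle_point_def vec_eq_iff_3)

text \<open>The cone of \<open>nonneg_vector\<close> contains \<open>pvec x y\<close> for x, y \<ge>
  0 and represents the far side of the edge from 0 to \<infinity>. The last block carries the
  triangle into the cone, and the blocks before it preserve the cone; with no block at all the claim
  would fail.\<close>

lemma holonomy_block_triangle_point:
  assumes "shear t" "bs \<noteq> []" "a > 0" "b > 0" "c > 0"
  shows "nonneg_vector (holonomy t u (block_word bs) *v triangle_point a b c)"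
proof -
  obtain cs d where bs: "bs = cs @ [d]" using assms(2) by (cases bs rule: rev_cases) auto
  define v where "v = u @ block_word cs"
  have t: "t v > 0" using assms by (simp add: shear_def)
  have "nonneg_vector (holonomy t v (block_word [d]) *v triangle_point a b c)"
  proof (cases d)
    case True
    have "\<forall>i. (holonomy t v (block_word [d]) *v triangle_point a b c) $ i =
        (-1) * sgn3 i * of_real (fun3 (t v * (a + b)) (sqrt 2 * b) ((b + c) / t v) i)"
      using True t by (simp add: holonomy_block forall_3 matrix_vector_nth_3 bend_rot_nth
          triangle_point_def
          field_simps)
    moreover have "\<forall>i. fun3 (t v * (a + b)) (sqrt 2 * b) ((b + c) / t v) i \<ge> 0"
      using t assms by (simp add: forall_3)
    ultimately show ?thesis by (intro nonneg_vectorI[of "-1"]) (simp, blast, blast)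
  next
    case False
    have "\<forall>i. (holonomy t v (block_word [d]) *v triangle_point a b c) $ i =
        (-1) * sgn3 i * of_real (fun3 (t v * (a + c)) (sqrt 2 * a) ((a + b) / t v) i)"
      using False t by (simp add: holonomy_block forall_3 matrix_vector_nth_3 bend_rot_rot_nth
          triangle_point_def
          field_simps)
    moreover have "\<forall>i. fun3 (t v * (a + c)) (sqrt 2 * a) ((a + b) / t v) i \<ge> 0"
      using t assms by (simp add: forall_3)
    ultimately show ?thesis by (intro nonneg_vectorI[of "-1"]) (simp, blast, blast)
  qed
  then show ?thesis
    unfolding bs block_word_simps(3) holonomy_append v_def[symmetric] matrix_vector_mul_assoc[symmetric]
    by (rule nonneg_matrix_vector[OF nonneg_holonomy_block[OF assms(1)]])
qed

text \<open>In the cone the first two coordinates have a common phase, whereas here they are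
  opposite multiples of \<open>k\<close>.\<close>

lemma nonneg_vector_not_triangle_point:
  assumes "nonneg_vector (k *s triangle_point a b c)" "a > 0" "c > 0" shows "k = 0"
proof -
  let ?z = "k *s triangle_point a b c"
  obtain e where e: "cmod e = 1" "\<And>i. ?z $ i = e * sgn3 i * of_real (cmod (?z $ i))"
    using assms(1) by (auto simp: nonneg_vector_def)
  define r s where "r = cmod (?z $ 1)" and "s = cmod (?z $ 2)"
  have 1: "k * of_real (a + c) = e * of_real r"
  proof -
    have "?z $ 1 = e * of_real r" using e(2)[of 1] unfolding r_def sgn3_simps mult_1_right .
    then show ?thesis by (simp add: triangle_point_def)
  qed
  have 2: "k * - of_real (sqrt 2 * c) = e * of_real s"
  proof -
    have "?z $ 2 = e * of_real s" using e(2)[of 2] unfolding s_def sgn3_simps mult_1_right .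
    then show ?thesis by (simp add: triangle_point_def)
  qed
  have "e \<noteq> 0" using e by auto
  have "e * (of_real r * - of_real (sqrt 2 * c)) = (k * of_real (a + c)) * - of_real (sqrt 2 * c)"
    unfolding 1 by simp
  also have "\<dots> = e * (of_real s * of_real (a + c))" using 2
      by (metis (no_types, lifting) mult.assoc mult.commute)
  finally have "of_real r * - of_real (sqrt 2 * c) = of_real s * (of_real (a + c) :: complex)"
    using \<open>e \<noteq> 0\<close> mult_left_cancel by blast
  then have rs: "- (r * (sqrt 2 * c)) = s * (a + c)"
    by (metis mult_minus_right of_real_eq_iff of_real_minus of_real_mult)
  have "s \<ge> 0" "r \<ge> 0" by (simp_all add: r_def s_def)
  then have "s * (a + c) \<ge> 0" "r * (sqrt 2 * c) \<ge> 0" using assms by simp_all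
  then have "r * (sqrt 2 * c) = 0" using rs by linarith
  then have "r = 0" using assms by simp
  then have "k * of_real (a + c) = 0" using 1 by simp
  then show "k = 0" using assms by (metis add_pos_pos mult_eq_0_iff of_real_eq_0_iff order_less_irrefl)
qed

section \<open>Ideal triangles\<close>

lemma triangle_point_nonzero: "a > 0 \<Longrightarrow> c > 0 \<Longrightarrow> triangle_point a b c \<noteq> 0"
  by (simp add: triangle_point_def vec_eq_iff_3)

lemma neg_real_ratio:
  assumes "x * cnj y * - 1 \<in> \<real>" "Re (x * cnj y * - 1) < 0"
  shows "\<exists>r>0. y = of_real r * x"
proof -
  obtain r where r: "x * cnj y = of_real r" using assms(1) by (auto elim: Reals_cases)
  then have "r > 0" using assms(2) by simp
  then have nz: "x \<noteq> 0" "y \<noteq> 0" using r by auto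
  have "y * cnj x = of_real r" using arg_cong[OF r, of cnj] by (simp add: mult.commute)
  then have "y = of_real r / cnj x" using nz by (simp add: field_simps)
  also have "\<dots> = of_real (r / (cmod x)^2) * x"
    using nz complex_norm_square[of x] by (simp add: field_simps)
  finally show ?thesis using \<open>r > 0\<close> nz by (intro exI[of _ "r / (cmod x)^2"]) simp
qed

text \<open>Negativity of the products forces the complex coefficients of the three vertices to have
  a common phase, which disappears in the line spanned.\<close>

lemma open_ideal_triangle_frame:
  assumes F: "frame p q r F"
  shows "open_ideal_triangle p q r = {cline (F *v triangle_point a b c) | a b c. a > 0 \<and> b > 0 \<and> c > 0}"
proof (intro equalityI subsetI)
  fix l assume "l \<in> open_ideal_triangle p q r"
  then obtain x y z where l: "l = cline (x + y + z)" and xyz: "x \<in> p" "y \<in> q" "z \<in> r"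
    and h: "\<forall>c \<in> {herm x y, herm y z, herm z x}. c \<in> \<real> \<and> Re c < 0"
    by (auto simp: open_ideal_triangle_def)
  obtain a b c where abc: "x = a *s (F *v pvec 1 0)" "y = b *s (F *v pvec 0 1)"
      "z = c *s (F *v pvec (-1) 1)"
    using xyz F by (auto simp: frame_def cline_def)
  note U = U21_herm[OF frame_U21[OF F]]
  have hh: "herm x y = a * cnj b * -1" "herm y z = b * cnj c * -1"
    by (simp_all add: abc herm_smult_left herm_smult_right U herm_pvec)
  obtain s where s: "s > 0" "b = of_real s * a" using neg_real_ratio[of a b] h hh by auto
  obtain s' where s': "s' > 0" "c = of_real s' * b" using neg_real_ratio[of b c] h hh by auto
  have "a \<noteq> 0" using h hh by auto
  have "x + y + z = a *s (F *v triangle_point 1 s (s' * s))"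
    by (simp add: abc triangle_point_eq s s' matrix_vector_right_distrib matrix_vector_mult_smult
        vector_add_ldistrib vector_smult_assoc algebra_simps)
  then have "l = cline (F *v triangle_point 1 s (s' * s))" using l \<open>a \<noteq> 0\<close> by (simp add: cline_smult)
  then show "l \<in> {cline (F *v triangle_point a b c) | a b c. a > 0 \<and> b > 0 \<and> c > 0}"
    using s s' by fastforce
next
  fix l assume "l \<in> {cline (F *v triangle_point a b c) | a b c. a > 0 \<and> b > 0 \<and> c > 0}"
  then obtain a b c where l: "l = cline (F *v triangle_point a b c)" and abc: "a > 0" "b > 0"
      "c > 0" by blast
  let ?x = "of_real a *s (F *v pvec 1 0)" and ?y = "of_real b *s (F *v pvec 0 1)"
    and ?z = "of_real c *s (F *v pvec (-1) 1)"
  note U = U21_herm[OF frame_U21[OF F]]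
  have "\<forall>d \<in> {herm ?x ?y, herm ?y ?z, herm ?z ?x}. d \<in> \<real> \<and> Re d < 0"
    using abc by (simp add: herm_smult_left herm_smult_right U herm_pvec)
  moreover have "?x \<in> p" "?y \<in> q" "?z \<in> r" using F by (auto simp: frame_def cline_def)
  moreover have "l = cline (?x + ?y + ?z)"
    by (simp add: l triangle_point_eq matrix_vector_right_distrib matrix_vector_mult_smult)
  ultimately show "l \<in> open_ideal_triangle p q r"
    unfolding open_ideal_triangle_def by blast
qed

lemma open_ideal_triangle_rotate: "open_ideal_triangle q r p = open_ideal_triangle p q r"
proof -
  have sub: "open_ideal_triangle p q r \<subseteq> open_ideal_triangle q r p" for p q r
  proof
    fix l assume "l \<in> open_ideal_triangle p q r"
    then obtain x y z where l: "l = cline (x + y + z)" and xyz: "x \<in> p" "y \<in> q" "z \<in> r"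
      and h: "\<forall>c \<in> {herm x y, herm y z, herm z x}. c \<in> \<real> \<and> Re c < 0"
      by (auto simp: open_ideal_triangle_def)
    have "l = cline (y + z + x)" using l by (simp add: algebra_simps)
    moreover have "\<forall>c \<in> {herm y z, herm z x, herm x y}. c \<in> \<real> \<and> Re c < 0" using h by blast
    ultimately show "l \<in> open_ideal_triangle q r p"
      unfolding open_ideal_triangle_def using xyz by blast
  qed
  show ?thesis using sub[of p q r] sub[of q r p] sub[of r p q] by blast
qed

definition walk_triangle :: "(walk \<Rightarrow> (complex^3) set) \<Rightarrow> walk \<Rightarrow> (complex^3) set set" where
  "walk_triangle f w = open_ideal_triangle (f w) (f (w @ [Nxt])) (f (w @ [Nxt, Nxt]))"

lemma lift_triangle_nxt: "lift_triangle (walk_class (w @ [Nxt])) = lift_triangle (walk_class w)"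
  using homotopic_NNN[of w "[]"] by (auto simp: lift_triangle_walk_class walk_class_eq_iff[THEN iffD2])

lemma lift_triangle_nxt_power: "lift_triangle (walk_class (w @ replicate i Nxt))
    = lift_triangle (walk_class w)"
  by (induction i arbitrary: w) (simp_all, metis append.assoc append_Cons append_Nil lift_triangle_nxt)

context framing
begin

lemma walk_triangle_nxt: "walk_triangle f (w @ [Nxt]) = walk_triangle f w"
  using f_homotopic[OF homotopic_NNN[of w "[]"]]
  by (simp add: walk_triangle_def open_ideal_triangle_rotate[of "f (w @ [Nxt])"])

lemma walk_triangle_nxt_power: "walk_triangle f (w @ replicate i Nxt) = walk_triangle f w"
  by (induction i arbitrary: w) (simp_all, metis append.assoc append_Cons append_Nil walk_triangle_nxt)

lemma walk_triangle_homotopic: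
  assumes "walk_homotopic u v" shows "walk_triangle f u = walk_triangle f v"
  by (simp add: walk_triangle_def f_homotopic[OF assms] f_homotopic[OF homotopic_right[OF assms]])

lemma walk_triangle_frame:
  "walk_frame f w F \<Longrightarrow> walk_triangle f w = {cline (F *v triangle_point a b c) | a b c. a > 0 \<and> b > 0
      \<and> c > 0}"
  unfolding walk_triangle_def walk_frame_def by (rule open_ideal_triangle_frame)

end

locale unbent_framing = framing +
  assumes unbent: "bending_of f w = 1"
begin

lemma walk_frame_holonomy:
  "walk_frame f u F \<Longrightarrow> walk_frame f (u @ w) (F ** holonomy (shear_of f) u w)"
proof (induction w arbitrary: u F)
  case (Cons m w)
  have "walk_frame f (u @ [m]) (F ** (case m of Nxt \<Rightarrow> rot | Opp \<Rightarrow> bend (shear_of f u) 1))"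
    using walk_frame_opp(3)[OF Cons.prems] walk_frame_nxt[OF Cons.prems] unbent by (cases m) simp_all
  from Cons.IH[OF this] show ?case by (cases m) (simp_all add: matrix_mul_assoc)
qed simp

text \<open>The turns at both ends of the normal form do not move the triangles, so one triangle is
  reached from the other by a block word, which is non-empty because the lifted triangles differ.
  Its points are then in the cone, and those of the other triangle are not.\<close>

theorem walk_triangles_disjoint:
  assumes "lift_triangle (walk_class u) \<noteq> lift_triangle (walk_class v)"
  shows "walk_triangle f u \<inter> walk_triangle f v = {}"
proof (rule ccontr)
  assume "walk_triangle f u \<inter> walk_triangle f v \<noteq> {}"
  then obtain l where l: "l \<in> walk_triangle f u" "l \<in> walk_triangle f v" by blast
  obtain i bs k where n: "walk_homotopic (walk_inverse u @ v) (replicate i Nxt @ block_word bs @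
      replicate k Nxt)"
    using walk_normal_form by blast
  have "walk_homotopic (u @ walk_inverse u @ v) v"
    using homotopic_right[OF append_walk_inverse, of u v] by simp
  then have v: "walk_homotopic v (u @ replicate i Nxt @ block_word bs @ replicate k Nxt)"
    using homotopic_left[OF n, of u] homotopic_sym homotopic_trans by blast
  define u' where "u' = u @ replicate i Nxt"
  have vt: "walk_triangle f v = walk_triangle f (u' @ block_word bs)"
    using walk_triangle_homotopic[OF v] walk_triangle_nxt_power[of "u' @ block_word bs" k]
        by (simp add: u'_def)
  have vl: "lift_triangle (walk_class v) = lift_triangle (walk_class (u' @ block_word bs))"
    using lift_triangle_nxt_power[of "u' @ block_word bs" k]
    by (simp add: u'_def walk_class_eq_iff[THEN iffD2, OF v])
  have bs: "bs \<noteq> []"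
  proof
    assume "bs = []"
    then have "lift_triangle (walk_class v) = lift_triangle (walk_class u)"
      using vl lift_triangle_nxt_power[of u i] by (simp add: u'_def)
    then show False using assms by simp
  qed
  have "l \<in> walk_triangle f u'" using l walk_triangle_nxt_power[of u i] by (simp add: u'_def)
  moreover obtain F where F: "walk_frame f u' F" using frame_ex by blast
  ultimately obtain a b c where abc: "l = cline (F *v triangle_point a b c)" "a > 0" "b > 0" "c > 0"
    using walk_triangle_frame by blast
  let ?H = "holonomy (shear_of f) u' (block_word bs)"
  have "walk_frame f (u' @ block_word bs) (F ** ?H)" by (rule walk_frame_holonomy[OF F])
  then obtain a' b' c' where abc': "l = cline ((F ** ?H) *v triangle_point a' b' c')" "a' > 0"
      "b' > 0" "c' > 0"
    using l vt walk_triangle_frame by blast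
  have FU: "F \<in> carrier U21" using F walk_frame_U21 by blast
  have "cline (F *v (?H *v triangle_point a' b' c')) = cline (F *v triangle_point a b c)"
    using abc abc' by (simp add: matrix_vector_mul_assoc)
  then have eq: "cline (?H *v triangle_point a' b' c') = cline (triangle_point a b c)"
    by (rule cline_U21_cancel[OF FU])
  have "?H *v triangle_point a' b' c' \<noteq> 0"
    using U21_nonzero[OF holonomy_U21[OF shear_shear_of] triangle_point_nonzero] abc' by blast
  then obtain k where k: "k \<noteq> 0" "?H *v triangle_point a' b' c' = k *s triangle_point a b c"
    using cline_eq_nonzero[OF eq] by blast
  have "nonneg_vector (k *s triangle_point a b c)"
    using holonomy_block_triangle_point[OF shear_shear_of bs abc'(2-4), of u'] k by simp
  then show False using nonneg_vector_not_triangle_point k abc by blast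
qed

end

definition fuchsian_framing :: "(walk \<Rightarrow> real) \<Rightarrow> walk \<Rightarrow> (complex^3) set" where
  "fuchsian_framing t w = cline (holonomy t [] w *v pvec 1 0)"

lemma holonomy_snoc: "holonomy t [] (w @ [Nxt]) = holonomy t [] w ** rot"
  "holonomy t [] (w @ [Opp]) = holonomy t [] w ** bend (t w) 1"
  by (simp_all add: holonomy_append)

lemma walk_frame_fuchsian:
  assumes "shear t" shows "walk_frame (fuchsian_framing t) w (holonomy t [] w)"
proof -
  have "holonomy t [] (w @ [Nxt, Nxt]) = holonomy t [] w ** (rot ** rot)" by (simp add: holonomy_append)
  moreover have "rot *v pvec 1 0 = pvec 0 1" "(rot ** rot) *v pvec 1 0 = pvec (-1) 1"
    by (simp_all add: rot_square sym2_pvec)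
  ultimately show ?thesis
    by (simp add: walk_frame_def frame_def fuchsian_framing_def holonomy_U21 assms holonomy_snoc
        matrix_vector_mul_assoc[symmetric])
qed

text \<open>For \<open>y = 1\<close> a turn about the origin of a dart is the map z -> t (z + 1),
  which fixes the origin \<infinity> of the dart.\<close>

lemma bend_rot_pvec: "(bend t y ** rot) *v pvec 1 0 = (- of_real t) *s pvec 1 0"
  by (simp add: vec_eq_iff_3 matrix_vector_nth_3 bend_rot_nth)

lemma framing_fuchsian:
  assumes t: "shear t" shows "framing (fuchsian_framing t)"
proof
  show "fuchsian_framing t u = fuchsian_framing t v" if "walk_homotopic u v" for u v
    using holonomy_homotopic[OF t that] by (simp add: fuchsian_framing_def)
  show "fuchsian_framing t (w @ [Opp, Nxt]) = fuchsian_framing t w" for w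
  proof -
    have "t w \<noteq> 0" using t by (metis order_less_irrefl shear_def)
    have "holonomy t [] (w @ [Opp, Nxt]) = holonomy t [] w ** (bend (t w) 1 ** rot)"
      by (simp add: holonomy_append)
    then have "holonomy t [] (w @ [Opp, Nxt]) *v pvec 1 0
        = holonomy t [] w *v ((bend (t w) 1 ** rot) *v pvec 1 0)"
      by (simp only: matrix_vector_mul_assoc)
    also have "\<dots> = (- of_real (t w)) *s (holonomy t [] w *v pvec 1 0)"
      by (simp only: bend_rot_pvec matrix_vector_mult_smult)
    finally have "holonomy t [] (w @ [Opp, Nxt]) *v pvec 1 0 = \<dots>" .
    then show ?thesis using cline_smult[of "- of_real (t w)"] \<open>t w \<noteq> 0\<close>
        by (simp add: fuchsian_framing_def)
  qed
  show "\<exists>F. walk_frame (fuchsian_framing t) w F" for w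
    using walk_frame_fuchsian[OF t] by blast
qed

lemma fuchsian_Z:
  assumes t: "shear t" shows "Z_walk (fuchsian_framing t) w = 1 / of_real (t w)"
proof -
  interpret framing "fuchsian_framing t" by (rule framing_fuchsian[OF t])
  have "walk_frame (fuchsian_framing t) (w @ [Opp]) (holonomy t [] w ** bend (t w) 1)"
    using walk_frame_fuchsian[OF t, of "w @ [Opp]"] by (simp add: holonomy_snoc)
  then show ?thesis
    unfolding Z_walk_def frame_opp_iff
    using walk_frame_fuchsian[OF t, of w] t unfolding walk_frame_def shear_def
    by (intro Z_inv_frame[where F = "holonomy t [] w"]) auto
qed

lemma unbent_fuchsian:
  assumes t: "shear t"
  shows "unbent_framing (fuchsian_framing t)" "shear_of (fuchsian_framing t) = t"
proof -
  have pos: "t w > 0" for w using t by (simp add: shear_def)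
  interpret framing "fuchsian_framing t" by (rule framing_fuchsian[OF t])
  have "t w \<noteq> 0" "\<bar>t w\<bar> = t w" for w using pos[of w] by simp_all
  then show "unbent_framing (fuchsian_framing t)"
    by unfold_locales (simp add: bending_of_def fuchsian_Z[OF t] norm_divide)
  show "shear_of (fuchsian_framing t) = t"
  proof
    fix w
    show "shear_of (fuchsian_framing t) w = t w"
      using pos[of w] by (simp add: shear_of_def fuchsian_Z[OF t] norm_divide)
  qed
qed

section \<open>Vertices of the lifted triangulation\<close>

definition turn :: "nat \<Rightarrow> walk" where
  "turn n = concat (replicate n [Opp, Nxt])"

lemma turn_simps [simp]: "turn 0 = []" "turn (Suc n) = Opp # Nxt # turn n"
  by (simp_all add: turn_def)

lemma turn_add: "turn (m + n) = turn m @ turn n"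
  by (induction m) simp_all

lemma turning_walks_eq: "turning_walks = range turn \<union> range (\<lambda>n. walk_inverse (turn n))"
  by (simp add: turning_walks_def turn_def)

lemma turning_walksI: "turn n \<in> turning_walks" "walk_inverse (turn n) \<in> turning_walks"
  by (auto simp: turning_walks_eq)

lemma walk_inverse_turn_Suc: "walk_inverse (turn (Suc n)) = [Nxt, Nxt, Opp] @ walk_inverse (turn n)"
  using turn_add[of n 1] by (simp add: walk_inverse_append walk_inverse_Cons)

text \<open>Up to homotopy the turning walks form the cyclic group generated by
  \<open>[Opp, Nxt]\<close>, with inverse generator \<open>[Nxt, Nxt, Opp]\<close>. This lemma and
  the next one are the closure under both.\<close>

lemma turning_walks_turn:
  assumes "c \<in> turning_walks" shows "\<exists>c'\<in>turning_walks. walk_homotopic ([Opp, Nxt] @ c) c'"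
  using assms[unfolded turning_walks_eq]
proof (elim UnE rangeE)
  fix n assume "c = turn n"
  then have "[Opp, Nxt] @ c = turn (Suc n)" by simp
  then show ?thesis using homotopic_refl turning_walksI(1) by metis
next
  fix n assume c: "c = walk_inverse (turn n)"
  show ?thesis
  proof (cases n)
    case 0
    then show ?thesis using c homotopic_refl[of "turn 1"] turning_walksI(1)[of 1]
        by (intro bexI[of _ "turn 1"]) auto
  next
    case (Suc k)
    have "walk_homotopic ([Opp] @ Nxt # Nxt # Nxt # Opp # walk_inverse (turn k)) ([Opp] @ Opp #
        walk_inverse (turn k))"
      by (rule homotopic_NNN)
    moreover have "walk_homotopic ([] @ Opp # Opp # walk_inverse (turn k)) ([] @ walk_inverse (turn k))"
      by (rule homotopic_OO)
    ultimately have "walk_homotopic ([Opp, Nxt] @ c) (walk_inverse (turn k))"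
      unfolding c Suc walk_inverse_turn_Suc by (auto intro: homotopic_trans)
    then show ?thesis using turning_walksI by blast
  qed
qed

lemma turning_walks_turn_back:
  assumes "c \<in> turning_walks" shows "\<exists>c'\<in>turning_walks. walk_homotopic ([Nxt, Nxt, Opp] @ c) c'"
  using assms[unfolded turning_walks_eq]
proof (elim UnE rangeE)
  fix n assume "c = walk_inverse (turn n)"
  then have "[Nxt, Nxt, Opp] @ c = walk_inverse (turn (Suc n))" by (simp only: walk_inverse_turn_Suc)
  then show ?thesis using homotopic_refl turning_walksI(2) by metis
next
  fix n assume c: "c = turn n"
  show ?thesis
  proof (cases n)
    case 0
    have "[Nxt, Nxt, Opp] @ c = walk_inverse (turn (Suc 0))"
      by (simp only: walk_inverse_turn_Suc c 0) simp
    then show ?thesis using homotopic_refl turning_walksI(2) by metis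
  next
    case (Suc k)
    have "walk_homotopic ([Nxt, Nxt] @ Opp # Opp # Nxt # turn k) ([Nxt, Nxt] @ Nxt # turn k)"
      by (rule homotopic_OO)
    moreover have "walk_homotopic ([] @ Nxt # Nxt # Nxt # turn k) ([] @ turn k)"
      by (rule homotopic_NNN)
    ultimately have "walk_homotopic ([Nxt, Nxt, Opp] @ c) (turn k)"
      unfolding c Suc by (auto intro: homotopic_trans)
    then show ?thesis using turning_walksI by blast
  qed
qed

lemma origin_walk_class: "origin (walk_class w) = {walk_class (w @ c) | c. c \<in> turning_walks}"
proof -
  have "walk_class (w' @ c) = walk_class (w @ c)" if "walk_class w' = walk_class w" for w' c
    using that homotopic_right unfolding walk_class_eq_iff by blast
  then show ?thesis unfolding origin_def by blast
qed

text \<open>A vertex is a left coset of the cyclic group of turns, and the two darts lie in the same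
  coset.\<close>

lemma origin_turn: "origin (walk_class (w @ [Opp, Nxt])) = origin (walk_class w)"
proof (intro equalityI subsetI)
  fix X assume "X \<in> origin (walk_class (w @ [Opp, Nxt]))"
  then obtain c where c: "X = walk_class (w @ [Opp, Nxt] @ c)" "c \<in> turning_walks"
    by (auto simp: origin_walk_class)
  obtain c' where c': "c' \<in> turning_walks" "walk_homotopic ([Opp, Nxt] @ c) c'"
    using turning_walks_turn c by blast
  then have "X = walk_class (w @ c')" using c homotopic_left walk_class_eq_iff by blast
  then show "X \<in> origin (walk_class w)" using c' by (auto simp: origin_walk_class)
next
  fix X assume "X \<in> origin (walk_class w)"
  then obtain c where c: "X = walk_class (w @ c)" "c \<in> turning_walks"
    by (auto simp: origin_walk_class)
  obtain c' where c': "c' \<in> turning_walks" "walk_homotopic ([Nxt, Nxt, Opp] @ c) c'"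
    using turning_walks_turn_back c by blast
  have "walk_homotopic ((w @ [Opp]) @ Nxt # Nxt # Nxt # Opp # c) ((w @ [Opp]) @ Opp # c)"
    by (rule homotopic_NNN)
  moreover have "walk_homotopic (w @ Opp # Opp # c) (w @ c)"
    by (rule homotopic_OO)
  moreover have "walk_homotopic ((w @ [Opp, Nxt]) @ [Nxt, Nxt, Opp] @ c) ((w @ [Opp, Nxt]) @ c')"
    using c' by (intro homotopic_left)
  ultimately have "walk_homotopic (w @ c) ((w @ [Opp, Nxt]) @ c')"
    using homotopic_trans homotopic_sym by (metis append.assoc append_Cons append_Nil)
  then have "X = walk_class ((w @ [Opp, Nxt]) @ c')" using c walk_class_eq_iff by blast
  then show "X \<in> origin (walk_class (w @ [Opp, Nxt]))" using c' unfolding origin_walk_class by blast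
qed

lemma vertex_act_origin: "vertex_act (walk_class g) (origin (walk_class w))
    = origin (walk_class (g @ w))"
proof -
  have "vertex_act (walk_class g) (origin (walk_class w))
      = {class_append (walk_class g) (walk_class (w @ c)) | c. c \<in> turning_walks}"
    unfolding vertex_act_def origin_walk_class by blast
  then show ?thesis by (simp add: origin_walk_class class_append_walk_class)
qed

lemma (in framing) f_turn_power: "f (w @ turn n) = f w"
  by (induction n arbitrary: w) (simp_all, metis append.assoc append_Cons append_Nil f_turn)

lemma (in framing) f_origin:
  assumes "origin (walk_class v) = origin (walk_class w)" shows "f v = f w"
proof -
  have "walk_class (v @ []) \<in> origin (walk_class v)"
    unfolding origin_walk_class using turning_walksI(1)[of 0] unfolding turn_simps by blast
  then have "walk_class v \<in> origin (walk_class w)" using assms by simp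
  then obtain c where c: "walk_homotopic v (w @ c)" "c \<in> turning_walks"
    by (auto simp: origin_walk_class walk_class_eq_iff)
  have "f (w @ c) = f w" using c(2) unfolding turning_walks_eq
  proof (elim UnE rangeE)
    fix n assume n: "c = walk_inverse (turn n)"
    have "f (w @ c) = f ((w @ c) @ turn n)" by (rule f_turn_power[symmetric])
    also have "\<dots> = f w"
      using f_homotopic[OF homotopic_left[OF walk_inverse_append_self, of w]] n by simp
    finally show ?thesis .
  qed (simp add: f_turn_power)
  then show ?thesis using f_homotopic c(1) by simp
qed

definition walk_framing :: "(walk set set \<Rightarrow> (complex^3) set) \<Rightarrow> walk \<Rightarrow> (complex^3) set" where
  "walk_framing \<phi> w = \<phi> (origin (walk_class w))"

lemma Z_edge_walk_class: "Z_edge \<phi> (walk_class w) = Z_walk (walk_framing \<phi>) w"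
  by (simp add: Z_edge_def Z_walk_def walk_framing_def lift_nxt_walk_class lift_opp_walk_class Let_def)

lemma lifted_vertices_eq: "lifted_vertices = range (\<lambda>w. origin (walk_class w))"
  by (auto simp: lifted_vertices_def lifted_darts_def)

lemma walk_class_all: "(\<forall>X\<in>lifted_darts. P X) \<longleftrightarrow> (\<forall>w. P (walk_class w))"
  by (auto simp: lifted_darts_def)

lemma carrier_fund_group: "carrier (fund_group T d0) = {walk_class g | g. walk_end T g d0 = d0}"
  by (simp add: fund_group_def)

lemma framing_T_bent:
  assumes "T_bent T d0 \<rho> \<phi>" shows "framing (walk_framing \<phi>)"
proof
  fix u v :: walk assume "walk_homotopic u v"
  then show "walk_framing \<phi> u = walk_framing \<phi> v"
      by (simp add: walk_framing_def walk_class_eq_iff[THEN iffD2])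
next
  fix w
  show "walk_framing \<phi> (w @ [Opp, Nxt]) = walk_framing \<phi> w" by (simp add: walk_framing_def origin_turn)
  have "real_ideal_triangle (walk_framing \<phi> w) (walk_framing \<phi> (w @ [Nxt])) (walk_framing \<phi> (w @
      [Nxt, Nxt]))"
    using assms by (simp add: T_bent_def walk_class_all lift_nxt_walk_class walk_framing_def)
  then show "\<exists>F. walk_frame (walk_framing \<phi>) w F"
    using real_ideal_triangle_frame by (simp add: walk_frame_def)
qed

lemma (in framing) f_cline: "\<exists>v. f w = cline v"
  using frame_ex[of w] by (auto simp: walk_frame_def frame_def)

lemma T_bent_PU21:
  assumes "T_bent T d0 \<rho> \<phi>" "walk_end T g d0 = d0"
  shows "\<rho> (walk_class g) \<in> carrier PU21"
  using assms by (auto simp: T_bent_def hom_def carrier_fund_group)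

text \<open>Equivariance in terms of an arbitrary lift \<open>P\<close>. The last claim makes the
  shear parameters invariant under closed walks, so that they live on the edges of
  \<open>T\<close>.\<close>

lemma T_bent_equivariant:
  assumes b: "T_bent T d0 \<rho> \<phi>" and g: "walk_end T g d0 = d0" and P: "P \<in> \<rho> (walk_class g)"
  shows "P \<in> carrier U21" "\<rho> (walk_class g) = proj_class P"
    "walk_framing \<phi> (g @ w) = ((*v) P) ` walk_framing \<phi> w"
    "walk_frame (walk_framing \<phi>) w F \<Longrightarrow> walk_frame (walk_framing \<phi>) (g @ w) (P ** F)"
    "Z_walk (walk_framing \<phi>) (g @ w) = Z_walk (walk_framing \<phi>) w"
proof -
  interpret framing "walk_framing \<phi>" by (rule framing_T_bent[OF b])
  show P1: "P \<in> carrier U21" "\<rho> (walk_class g) = proj_class P"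
    using PU21_mem_U21[OF T_bent_PU21[OF b g] P] by auto
  show eq: "walk_framing \<phi> (g @ w) = ((*v) P) ` walk_framing \<phi> w" for w
  proof -
    have "walk_framing \<phi> (g @ w) = proj_act (proj_class P) (walk_framing \<phi> w)"
      using b g unfolding T_bent_def walk_framing_def vertex_act_origin[symmetric] P1(2)[symmetric]
        carrier_fund_group lifted_vertices_eq by blast
    moreover obtain v where "walk_framing \<phi> w = cline v" using f_cline by blast
    ultimately show ?thesis by (simp add: proj_act_proj_class cline_image)
  qed
  show "walk_frame (walk_framing \<phi>) w F \<Longrightarrow> walk_frame (walk_framing \<phi>) (g @ w) (P ** F)"
    unfolding walk_frame_def using frame_left_mult[OF _ P1(1)] eq[of w] eq[of "w @ [Nxt]"] eq[of
        "w @ [Nxt, Nxt]"]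
    by simp
  obtain F where F: "walk_frame (walk_framing \<phi>) w F" using frame_ex by blast
  obtain G where G: "walk_frame (walk_framing \<phi>) (w @ [Opp]) G" using frame_ex by blast
  show "Z_walk (walk_framing \<phi>) (g @ w) = Z_walk (walk_framing \<phi>) w"
    using Z_inv_isometry[OF F[unfolded walk_frame_def] G[unfolded frame_opp_iff] P1(1)]
      eq[of w] eq[of "w @ [Nxt]"] eq[of "w @ [Nxt, Nxt]"] eq[of "w @ [Opp, Nxt, Nxt]"]
    by (simp add: Z_walk_def)
qed

section \<open>Closed walks\<close>

locale triangulated =
  fixes T :: "'d triangulation" and d0 :: 'd
  assumes finite_darts: "finite (darts T)" and base: "d0 \<in> darts T"
    and nxt: "d \<in> darts T \<Longrightarrow> nxt T d \<in> darts T" "d \<in> darts T \<Longrightarrow> nxt T d \<noteq> d"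
      "d \<in> darts T \<Longrightarrow> nxt T (nxt T (nxt T d)) = d"
    and opp: "d \<in> darts T \<Longrightarrow> opp T d \<in> darts T" "d \<in> darts T \<Longrightarrow> opp T (opp T d) = d"
begin

abbreviation closed_walk :: "walk \<Rightarrow> bool" where
  "closed_walk g \<equiv> walk_end T g d0 = d0"

lemma walk_end_darts: "d \<in> darts T \<Longrightarrow> walk_end T w d \<in> darts T"
proof (induction w arbitrary: d)
  case (Cons m w)
  then show ?case using nxt opp by (cases m) simp_all
qed simp

lemma walk_end_homotopic:
  "walk_homotopic u v \<Longrightarrow> d \<in> darts T \<Longrightarrow> walk_end T u d = walk_end T v d"
proof (induction rule: walk_homotopic.induct)
  case (triangle u v)
  then show ?case using walk_end_darts[of d u] nxt by (simp add: walk_end_append)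
next
  case (edge u v)
  then show ?case using walk_end_darts[of d u] opp by (simp add: walk_end_append)
qed simp_all

lemma walk_end_inverse: "d \<in> darts T \<Longrightarrow> walk_end T (walk_inverse w) (walk_end T w d) = d"
  using walk_end_homotopic[OF append_walk_inverse, of d w] by (simp add: walk_end_append)

text \<open>The fundamental group acts freely on lifted triangles: an element that preserves a
  triangle without being trivial would rotate it, but then its walk would end at another side, as
  \<open>nxt\<close> fixes no dart.\<close>

lemma closed_lift_triangle:
  assumes g: "closed_walk g" and h: "closed_walk h"
    and eq: "lift_triangle (walk_class g) = lift_triangle (walk_class h)"
  shows "walk_class g = walk_class h"
proof -
  have "walk_class h \<in> lift_triangle (walk_class g)" unfolding eq
      by (simp add: lift_triangle_walk_class)
  then consider "walk_class h = walk_class g" | "walk_homotopic h (g @ [Nxt])" |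
      "walk_homotopic h (g @ [Nxt, Nxt])"
    by (auto simp: lift_triangle_walk_class walk_class_eq_iff)
  then show ?thesis
  proof cases
    case 2
    then have "nxt T d0 = d0" using walk_end_homotopic[OF _ base] g h
        by (fastforce simp: walk_end_append)
    then show ?thesis using nxt base by blast
  next
    case 3
    then have "nxt T (nxt T d0) = d0" using walk_end_homotopic[OF _ base] g h
        by (fastforce simp: walk_end_append)
    then have "nxt T d0 = d0" using nxt(3)[OF base] by simp
    then show ?thesis using nxt base by blast
  qed simp
qed

text \<open>Turning permutes a finite set of darts. A period is doubled to reach 2, the number of
  turns from which \<open>holonomy_turn\<close> gives its strongest bound.\<close>

lemma turn_period:
  assumes d: "d \<in> darts T" shows "\<exists>m\<ge>2. walk_end T (turn m) d = d"
proof -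
  have "\<not> inj (\<lambda>n. walk_end T (turn n) d)"
    using finite_subset[OF _ finite_darts, of "range (\<lambda>n. walk_end T (turn n) d)"] walk_end_darts d
      finite_imageD[of "\<lambda>n. walk_end T (turn n) d" UNIV] by auto
  then obtain i j where ij: "i < j" "walk_end T (turn i) d = walk_end T (turn j) d"
    unfolding inj_def by (metis linorder_neqE_nat)
  define m where "m = j - i"
  have m: "m > 0" "turn j = turn m @ turn i" using ij turn_add[of m i] by (simp_all add: m_def)
  have md: "walk_end T (turn m) d \<in> darts T" using walk_end_darts d by blast
  have "d = walk_end T (walk_inverse (turn i)) (walk_end T (turn j) d)"
    using walk_end_inverse[OF d] ij by metis
  also have "\<dots> = walk_end T (turn m) d" using walk_end_inverse[OF md] m by (simp add: walk_end_append)
  finally have "walk_end T (turn m) d = d" ..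
  then have "walk_end T (turn (m + m)) d = d" by (simp add: turn_add walk_end_append)
  then show ?thesis using m(1) by (intro exI[of _ "m + m"]) auto
qed

end

lemma triangulated_ideal:
  assumes "ideal_triangulation g k T" "d0 \<in> darts T" shows "triangulated T d0"
  using assms unfolding ideal_triangulation_def triangulated_def by blast

section \<open>The Fuchsian representation with given shear parameters\<close>

lemma frame_distinct:
  assumes "frame p q r F" shows "p \<noteq> q" "q \<noteq> r" "p \<noteq> r"
proof -
  have *: "cline (F *v x) \<noteq> cline (F *v y)" if "herm x y \<noteq> 0" "herm y y = 0" for x y
  proof
    assume "cline (F *v x) = cline (F *v y)"
    then obtain k where "F *v x = k *s (F *v y)" using cline_eqD by blast
    then have "herm (F *v x) (F *v y) = 0" using that
        by (simp add: herm_smult_left U21_herm[OF frame_U21[OF assms]])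
    then show False using that by (simp add: U21_herm[OF frame_U21[OF assms]])
  qed
  show "p \<noteq> q" "q \<noteq> r" "p \<noteq> r"
    using assms by (auto simp: frame_def herm_pvec dest!: *[THEN notE, rotated 2])
qed

section \<open>Real frames and the standard totally real subspace\<close>

lemma sym2_real: "sym2 a b c d $ i $ j \<in> \<real>"
proof -
  have "\<forall>i j. sym2 a b c d $ i $ j \<in> \<real>" by (simp add: forall_3 sym2_nth)
  then show ?thesis by blast
qed

lemma real_O21_sym2: "a * d - b * c = 1 \<Longrightarrow> sym2 a b c d \<in> real_O21"
  by (simp add: real_O21_def sym2_U21 sym2_real)

lemma holonomy_real_O21:
  assumes "shear t" shows "holonomy t u w \<in> real_O21"
proof -
  obtain e a b c d where "e = 1 \<or> e = -1" "holonomy t u w = mat e ** sym2 a b c d"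
    using holonomy_sym2[OF assms] by blast
  then have "\<forall>i j. holonomy t u w $ i $ j \<in> \<real>"
    using sym2_real by (auto simp: mat_mult_nth)
  then show ?thesis using holonomy_U21[OF assms] by (simp add: real_O21_def)
qed

definition real_vectors :: "(complex^3) set" where
  "real_vectors = {x. \<forall>i. x $ i \<in> \<real>}"

lemma real_vectors_iff: "x \<in> real_vectors \<longleftrightarrow> x$1 \<in> \<real> \<and> x$2 \<in> \<real> \<and> x$3 \<in> \<real>"
  by (simp add: real_vectors_def forall_3)

lemma totally_real_real_vectors: "totally_real real_vectors"
  unfolding totally_real_def
proof (intro conjI ballI impI)
  show "subspace real_vectors"
  proof (rule subspaceI)
    fix c x assume "x \<in> real_vectors"
    then show "c *\<^sub>R x \<in> real_vectors"
      unfolding real_vectors_def complex_is_Real_iff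
          by (simp only: mem_Collect_eq vector_scaleR_component) simp
  qed (simp_all add: real_vectors_def)
  define h :: "real^3 \<Rightarrow> complex^3" where "h x = (\<chi> i. of_real (x $ i))" for x
  have "linear h" by (rule linearI) (simp_all add: h_def vec_eq_iff scaleR_conv_of_real[where 'a
      = complex])
  moreover have "inj h" by (rule injI) (simp add: h_def vec_eq_iff)
  ultimately have "dim (range h) = dim (UNIV :: (real^3) set)"
    by (intro dim_image_eq) (auto intro: inj_on_subset)
  moreover have "range h = real_vectors"
  proof (intro equalityI subsetI)
    fix x assume "x \<in> real_vectors"
    then have "x = h (\<chi> i. Re (x $ i))" by (simp add: h_def vec_eq_iff real_vectors_def)
    then show "x \<in> range h" by blast
  qed (auto simp: h_def real_vectors_def)
  ultimately show "dim real_vectors = 3" by simp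
next
  fix x assume "x \<in> real_vectors" "\<i> *s x \<in> real_vectors"
  then show "x = 0"
    by (auto simp: real_vectors_def vec_eq_iff complex_is_Real_iff complex_eq_iff)
next
  fix x y assume "x \<in> real_vectors" "y \<in> real_vectors"
  then show "herm x y \<in> \<real>"
    by (auto simp: herm_def real_vectors_def Reals_cnj_iff[THEN iffD1])
qed

lemma pvec_real: "pvec (of_real x) (of_real y) \<in> real_vectors"
  by (simp add: real_vectors_iff)

lemma real_matrix_vector: "A \<in> real_O21 \<Longrightarrow> x \<in> real_vectors \<Longrightarrow> A *v x \<in> real_vectors"
  by (simp add: real_O21_def real_vectors_def matrix_vector_nth_3)

lemma real_frame_real_ideal_triangle:
  assumes F: "frame p q r F" and R: "F \<in> real_O21"
  shows "real_ideal_triangle p q r"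
proof -
  have U: "F \<in> carrier U21" using F frame_U21 by blast
  have b: "cline (F *v pvec (of_real x) (of_real y)) \<in> real_plane_boundary real_vectors" if
      "(x, y) \<noteq> (0, 0)" for x y
  proof -
    have "F *v pvec (of_real x) (of_real y) \<noteq> 0" using that U by (simp add: U21_eq_0_iff pvec_eq_0_iff)
    moreover have "herm (F *v pvec (of_real x) (of_real y)) (F *v pvec (of_real x) (of_real y)) = 0"
      unfolding U21_herm[OF U] by (simp add: herm_pvec)
    ultimately show ?thesis
      unfolding real_plane_boundary_def using real_matrix_vector[OF R pvec_real] by blast
  qed
  have "{p, q, r} \<subseteq> real_plane_boundary real_vectors"
    using b[of 1 0] b[of 0 1] b[of "-1" 1] F by (simp add: frame_def)
  moreover have "cline (vec3 1 0 (-1)) \<in> real_plane real_vectors"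
    unfolding real_plane_def by (rule CollectI, rule exI[of _
        "vec3 1 0 (-1)"]) (simp add: real_vectors_iff herm_def)
  ultimately show ?thesis
    unfolding real_ideal_triangle_def using frame_distinct[OF F] totally_real_real_vectors by blast
qed

section \<open>The identity component of the real orthogonal group\<close>

lemma continuous_on_matrix_3:
  fixes f :: "'a::topological_space \<Rightarrow> complex^3^3"
  assumes "\<And>i j. continuous_on S (\<lambda>x. f x $ i $ j)" shows "continuous_on S f"
proof -
  have "continuous_on S (\<lambda>x. \<chi> i. \<chi> j. f x $ i $ j)" by (intro continuous_on_vec_lambda assms)
  then show ?thesis by (simp add: vec_lambda_eta)
qed

abbreviation SO_comp :: "(complex^3^3) set" where
  "SO_comp \<equiv> connected_component_set real_O21 (mat 1)"

lemma real_O21_mult: "A \<in> real_O21 \<Longrightarrow> B \<in> real_O21 \<Longrightarrow> A ** B \<in> real_O21"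
  by (simp add: real_O21_def U21_mult matrix_mult_nth_3)

lemma continuous_on_matrix_mult: "continuous_on S (\<lambda>B. (A :: complex^3^3) ** (B :: complex^3^3))"
proof (rule continuous_on_matrix_3)
  show "continuous_on S (\<lambda>B. (A ** B) $ i $ j)" for i j
    unfolding matrix_mult_nth_3 by (intro continuous_intros)
qed

lemma SO_comp_mult:
  assumes A: "A \<in> SO_comp" and B: "B \<in> SO_comp" shows "A ** B \<in> SO_comp"
proof -
  have A': "connected_component real_O21 (mat 1) A" using A by simp
  then have AR: "A \<in> real_O21" using connected_component_in by blast
  obtain C where C: "connected C" "C \<subseteq> real_O21" "mat 1 \<in> C" "B \<in> C"
    using B by (auto simp: connected_component_def)
  have "connected ((\<lambda>B. A ** B) ` C)" by (intro connected_continuous_image continuous_on_matrix_mult C)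
  moreover have "(\<lambda>B. A ** B) ` C \<subseteq> real_O21" using C AR real_O21_mult by blast
  moreover have "A \<in> (\<lambda>B. A ** B) ` C" using C(3) by (intro image_eqI[of _ _ "mat 1"]) simp_all
  moreover have "A ** B \<in> (\<lambda>B. A ** B) ` C" using C(4) by blast
  ultimately have "connected_component real_O21 A (A ** B)" unfolding connected_component_def by blast
  then show ?thesis using A' connected_component_trans by blast
qed

lemma SO_comp_shears: "sym2 1 x 0 1 \<in> SO_comp" "sym2 1 0 x 1 \<in> SO_comp"
proof -
  have *: "g x \<in> SO_comp" if g: "g 0 = mat 1" "\<And>s. g s \<in> real_O21"
      "\<And>i j. continuous_on UNIV (\<lambda>s. g s $ i $ j)"
    for g :: "real \<Rightarrow> complex^3^3"
  proof -
    have "connected (range g)" by (intro connected_continuous_image continuous_on_matrix_3 g) simp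
    moreover have "range g \<subseteq> real_O21" "g x \<in> range g" using g by auto
    moreover have "mat 1 \<in> range g" unfolding g(1)[symmetric] by (rule rangeI)
    ultimately show ?thesis by (auto simp: connected_component_def)
  qed
  have "\<forall>i j. continuous_on UNIV (\<lambda>s. sym2 1 s 0 1 $ i $ j)"
      "\<forall>i j. continuous_on UNIV (\<lambda>s. sym2 1 0 s 1 $ i $ j)"
    by (simp_all add: forall_3 sym2_nth continuous_intros)
  then show "sym2 1 x 0 1 \<in> SO_comp" "sym2 1 0 x 1 \<in> SO_comp"
    using *[of "\<lambda>s. sym2 1 s 0 1"] *[of "\<lambda>s. sym2 1 0 s 1"] by (simp_all add: sym2_one real_O21_sym2)
qed

text \<open>Unipotent triangular matrices generate SL(2,R), and each of them is joined to the
  identity by a line. A matrix with c \<noteq> 0 is a product of three of them.\<close>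

lemma sym2_SO_comp:
  assumes "a * d - b * c = 1" shows "sym2 a b c d \<in> SO_comp"
proof -
  have *: "sym2 a b c d \<in> SO_comp" if "a * d - b * c = 1" "c \<noteq> 0" for a b c d
  proof -
    define x y where "x = (a - 1) / c" and "y = (d - 1) / c"
    have xy: "1 + x * c = a" "c * y + 1 = d" using that(2) by (simp_all add: x_def y_def)
    have "c * b = c * (x * (c * y + 1) + y)" using that(1) unfolding xy(1)[symmetric] xy(2)[symmetric]
      by (simp add: algebra_simps)
    then have "b = x * (c * y + 1) + y" using that(2) mult_left_cancel by blast
    then have "sym2 a b c d = sym2 1 x 0 1 ** sym2 1 0 c 1 ** sym2 1 y 0 1"
      by (simp add: sym2_mult algebra_simps flip: xy)
    then show ?thesis using SO_comp_mult SO_comp_shears by simp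
  qed
  show ?thesis
  proof (cases "c = 0")
    case True
    \<comment> \<open>A shear on the right moves \<open>d\<close> into the lower left corner, and d
      \<noteq> 0 because a * d = 1.\<close>
    then have "sym2 (a + b) b d d \<in> SO_comp" using assms by (intro *) (auto simp: algebra_simps)
    moreover have "sym2 a b c d = sym2 (a + b) b d d ** sym2 1 0 (-1) 1" using True
        by (simp add: sym2_mult)
    ultimately show ?thesis using SO_comp_mult SO_comp_shears by simp
  qed (use * assms in blast)
qed

lemma holonomy_PO21:
  assumes "shear t" shows "proj_class (holonomy t u w) \<in> PO21"
proof -
  obtain e a b c d where h: "e = 1 \<or> e = -1" "a * d - b * c = 1" "holonomy t u w
      = mat e ** sym2 a b c d"
    using holonomy_sym2[OF assms] by blast
  then have "proj_class (holonomy t u w) = proj_class (sym2 a b c d)" using proj_class_unit[of e]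
      by auto
  then show ?thesis
    unfolding PO21_def proj_class_coset using sym2_SO_comp[OF h(2)] by blast
qed

section \<open>The representation and the framing given by shear parameters\<close>

definition fuchsian_rep :: "(walk \<Rightarrow> real) \<Rightarrow> walk set \<Rightarrow> (complex^3^3) set" where
  "fuchsian_rep t \<gamma> = proj_class (holonomy t [] (SOME g. walk_class g = \<gamma>))"

definition fuchsian_map :: "(walk \<Rightarrow> real) \<Rightarrow> walk set set \<Rightarrow> (complex^3) set" where
  "fuchsian_map t V = fuchsian_framing t (SOME w. origin (walk_class w) = V)"

lemma fuchsian_rep_walk_class:
  assumes "shear t" shows "fuchsian_rep t (walk_class g) = proj_class (holonomy t [] g)"
proof -
  have "walk_class (SOME g'. walk_class g' = walk_class g) = walk_class g" by (rule someI) simp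
  then show ?thesis
    unfolding fuchsian_rep_def walk_class_eq_iff using holonomy_homotopic[OF assms] by metis
qed

lemma walk_framing_fuchsian_map:
  assumes "shear t" shows "walk_framing (fuchsian_map t) = fuchsian_framing t"
proof
  fix w
  interpret framing "fuchsian_framing t" by (rule framing_fuchsian[OF assms])
  have "origin (walk_class (SOME w'. origin (walk_class w') = origin (walk_class w)))
      = origin (walk_class w)"
    by (rule someI[where P = "\<lambda>w'. origin (walk_class w') = origin (walk_class w)"]) simp
  then show "walk_framing (fuchsian_map t) w = fuchsian_framing t w"
    unfolding fuchsian_map_def walk_framing_def by (rule f_origin)
qed

locale fuchsian = triangulated +
  fixes t :: "walk \<Rightarrow> real"
  assumes shear: "shear t"
    and equivariant: "closed_walk g \<Longrightarrow> t (g @ w) = t w"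
begin

sublocale unbent_framing "fuchsian_framing t"
  by (rule unbent_fuchsian(1)[OF shear])

text \<open>Invariance of the parameters under closed walks turns the cocycle into a
  homomorphism.\<close>

lemma holonomy_closed_append:
  assumes "closed_walk g" shows "holonomy t [] (g @ w) = holonomy t [] g ** holonomy t [] w"
  using holonomy_equivariant[of t g "[]" w] equivariant[OF assms] by (simp add: holonomy_append)

lemma fuchsian_equivariant:
  assumes "closed_walk g"
  shows "fuchsian_framing t (g @ w) = ((*v) (holonomy t [] g)) ` fuchsian_framing t w"
  by (simp add: fuchsian_framing_def holonomy_closed_append[OF assms] cline_image
      matrix_vector_mul_assoc)

lemma T_bent_fuchsian: "T_bent T d0 (fuchsian_rep t) (fuchsian_map t)"
proof -
  note wf = walk_framing_fuchsian_map[OF shear, THEN fun_cong, unfolded walk_framing_def]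
  note rep = fuchsian_rep_walk_class[OF shear]
  have "fuchsian_rep t \<in> hom (fund_group T d0) PU21"
  proof (rule homI)
    fix x assume "x \<in> carrier (fund_group T d0)"
    then show "fuchsian_rep t x \<in> carrier PU21"
      by (auto simp: carrier_fund_group rep carrier_PU21 holonomy_U21 shear)
  next
    fix x y assume "x \<in> carrier (fund_group T d0)" "y \<in> carrier (fund_group T d0)"
    then obtain g h where gh: "x = walk_class g" "y = walk_class h" "closed_walk g" "closed_walk h"
      by (auto simp: carrier_fund_group)
    have "x \<otimes>\<^bsub>fund_group T d0\<^esub> y = walk_class (g @ h)"
        by (simp add: fund_group_def gh class_append_walk_class)
    then show "fuchsian_rep t (x \<otimes>\<^bsub>fund_group T d0\<^esub> y) = fuchsian_rep t x \<otimes>\<^bsub>PU21\<^esub> fuchsian_rep t y"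
      using gh by (simp add: rep proj_class_mult holonomy_closed_append)
  qed
  moreover have "fuchsian_map t ` lifted_vertices \<subseteq> hyp_boundary"
  proof -
    have "fuchsian_framing t w \<in> hyp_boundary" for w
    proof -
      have U: "holonomy t [] w \<in> carrier U21" by (rule holonomy_U21[OF shear])
      show ?thesis unfolding hyp_boundary_def fuchsian_framing_def
        by (rule CollectI, rule exI[of _ "holonomy t [] w *v pvec 1 0"])
          (simp add: U21_eq_0_iff[OF U] pvec_eq_0_iff U21_herm[OF U] herm_pvec)
    qed
    then show ?thesis by (auto simp: lifted_vertices_eq wf)
  qed
  moreover have "fuchsian_map t (vertex_act \<gamma> V) = proj_act (fuchsian_rep t \<gamma>) (fuchsian_map t V)"
    if \<gamma>: "\<gamma> \<in> carrier (fund_group T d0)" and V: "V \<in> lifted_vertices" for \<gamma> V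
  proof -
    obtain g w where gw: "\<gamma> = walk_class g" "closed_walk g" "V = origin (walk_class w)"
      using \<gamma> V by (auto simp: carrier_fund_group lifted_vertices_eq)
    show ?thesis unfolding gw vertex_act_origin wf rep fuchsian_equivariant[OF gw(2)]
      by (simp add: fuchsian_framing_def proj_act_proj_class cline_image)
  qed
  moreover have "real_ideal_triangle (fuchsian_map t (origin X)) (fuchsian_map t (origin (lift_nxt X)))
      (fuchsian_map t (origin (lift_nxt (lift_nxt X))))" if X: "X \<in> lifted_darts" for X
  proof -
    obtain w where "X = walk_class w" using X by (auto simp: lifted_darts_def)
    then show ?thesis
      using real_frame_real_ideal_triangle[OF walk_frame_fuchsian[OF shear, of w, unfolded
          walk_frame_def]
          holonomy_real_O21[OF shear]]
      by (simp add: lift_nxt_walk_class wf)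
  qed
  ultimately show ?thesis unfolding T_bent_def by blast
qed

lemma triangles_disjoint_closed:
  assumes "closed_walk g" "closed_walk h"
      "walk_triangle (fuchsian_framing t) g \<inter> walk_triangle (fuchsian_framing t) h \<noteq> {}"
  shows "walk_class g = walk_class h"
  using walk_triangles_disjoint closed_lift_triangle assms by blast

lemma walk_triangle_fuchsian:
  "walk_triangle (fuchsian_framing t) w = {cline (holonomy t [] w *v triangle_point a b c) | a b c.
      a > 0 \<and> b > 0 \<and> c > 0}"
  by (rule walk_triangle_frame[OF walk_frame_fuchsian[OF shear]])

text \<open>The centre of the base triangle is \<open>triangle_point 1 1 1\<close>. An element is recognised by the
  translate of the base triangle that contains the image of the centre.\<close>

lemma holonomy_determines:
  assumes g: "closed_walk g" and h: "closed_walk h" and abc: "a > 0" "b > 0" "c > 0" "k \<noteq> 0"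
    and eq: "holonomy t [] h *v triangle_point 1 1 1 = k *s (holonomy t [] g *v triangle_point a b c)"
  shows "walk_class g = walk_class h"
proof -
  have "cline (holonomy t [] h *v triangle_point 1 1 1) = cline (holonomy t [] g *v triangle_point a
      b c)"
    unfolding eq using abc by (simp add: cline_smult)
  moreover have "cline (holonomy t [] h *v triangle_point 1 1 1) \<in> walk_triangle (fuchsian_framing t) h"
    unfolding walk_triangle_fuchsian using zero_less_one by blast
  moreover have "cline (holonomy t [] g *v triangle_point a b c) \<in> walk_triangle (fuchsian_framing t) g"
    unfolding walk_triangle_fuchsian using abc by blast
  ultimately show ?thesis using triangles_disjoint_closed[OF g h] by auto
qed

lemma fuchsian_injective: "inj_on (fuchsian_rep t) (carrier (fund_group T d0))"
proof (rule inj_onI)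
  fix x y assume x: "x \<in> carrier (fund_group T d0)" and y: "y \<in> carrier (fund_group T d0)"
    and eq: "fuchsian_rep t x = fuchsian_rep t y"
  obtain g h where gh: "x = walk_class g" "y = walk_class h" "closed_walk g" "closed_walk h"
    using x y by (auto simp: carrier_fund_group)
  have "holonomy t [] h \<in> proj_class (holonomy t [] g)"
    using eq proj_class_self unfolding gh fuchsian_rep_walk_class[OF shear] by metis
  then obtain k where k: "holonomy t [] h = mat k ** holonomy t [] g" "cmod k = 1"
      by (auto simp: proj_class_def)
  have "holonomy t [] h *v triangle_point 1 1 1 = k *s (holonomy t [] g *v triangle_point 1 1 1)"
    unfolding k by (simp add: matrix_vector_mul_assoc[symmetric] mat_mult_vector)
  moreover have "k \<noteq> 0" using k by auto
  ultimately show "x = y" using holonomy_determines[OF gh(3,4), of 1 1 1 k] gh by simp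
qed

lemma fuchsian_discrete: "discrete_in_PU21 (fuchsian_rep t ` carrier (fund_group T d0))"
  unfolding discrete_in_PU21_def
proof
  let ?G = "fuchsian_rep t ` carrier (fund_group T d0)"
  fix A assume A: "A \<in> ?G"
  then obtain g where g: "closed_walk g" "A = proj_class (holonomy t [] g)"
    by (auto simp: carrier_fund_group fuchsian_rep_walk_class[OF shear])
  define Q where "Q = matrix_inv (holonomy t [] g)"
  have HU: "holonomy t [] g \<in> carrier U21" by (rule holonomy_U21[OF shear])
  \<comment> \<open>The image of the centre under \<open>M\<close>, brought back to the standard
    triangle; \<alpha>, \<beta>, \<gamma> are its coefficients with respect to the three standard
    null vectors.\<close>
  define z where "z M = Q *v (M *v triangle_point 1 1 1)" for M
  define \<alpha> where "\<alpha> M = z M $ 1 + z M $ 2 / rt2" for M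
  define \<beta> where "\<beta> M = z M $ 2 / rt2 - z M $ 3" for M
  define \<gamma> where "\<gamma> M = - (z M $ 2 / rt2)" for M
  \<comment> \<open>Products with a conjugate do not see a common phase. On real vectors times a
    phase the condition says that the coefficients have the same sign, i.e. that the point is in the
    open triangle.\<close>
  define N where "N = {M. Re (\<alpha> M * cnj (\<gamma> M)) > 0 \<and> Re (\<beta> M * cnj (\<gamma> M)) > 0}"
  have cont: "continuous_on UNIV (\<lambda>M. z M $ i)" for i
    unfolding z_def matrix_vector_nth_3 by (intro continuous_intros)
  have "open N"
    unfolding N_def \<alpha>_def \<beta>_def \<gamma>_def
    by (intro open_Collect_conj open_Collect_less continuous_intros cont) simp_all
  moreover have "A = \<Union> ?G \<inter> N"
  proof (intro equalityI subsetI)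
    fix M assume M: "M \<in> A"
    then obtain k where k: "M = mat k ** holonomy t [] g" "cmod k = 1" using g
        by (auto simp: proj_class_def)
    have "M *v triangle_point 1 1 1 = holonomy t [] g *v (k *s triangle_point 1 1 1)"
      unfolding k by (simp add: matrix_vector_mul_assoc[symmetric] mat_mult_vector
          matrix_vector_mult_smult)
    then have "z M = k *s triangle_point 1 1 1"
      unfolding z_def Q_def by (simp add: matrix_vector_mul_assoc U21_matrix_inv[OF HU])
    then have eqs: "\<alpha> M = k" "\<beta> M = k" "\<gamma> M = k"
      by (simp_all add: \<alpha>_def \<beta>_def \<gamma>_def triangle_point_def algebra_simps)
    have "k * cnj k = 1" using k(2) complex_norm_square[of k] by simp
    then have "M \<in> N" by (simp only: N_def eqs mem_Collect_eq) simp
    then show "M \<in> \<Union> ?G \<inter> N" using A M by blast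
  next
    fix M assume M: "M \<in> \<Union> ?G \<inter> N"
    then obtain h where h: "closed_walk h" "M \<in> proj_class (holonomy t [] h)"
      by (auto simp: carrier_fund_group fuchsian_rep_walk_class[OF shear])
    then obtain k where k: "M = mat k ** holonomy t [] h" "cmod k = 1" by (auto simp: proj_class_def)
    then have "k \<noteq> 0" by auto
    \<comment> \<open>The holonomy of \<open>h\<close> seen from \<open>g\<close> is a real matrix,
      so the three coefficients have the common phase \<open>k\<close>.\<close>
    define R where "R = holonomy t [] (walk_inverse g @ h)"
    have Rh: "holonomy t [] h = holonomy t [] g ** R"
      using holonomy_homotopic[OF shear homotopic_right[OF append_walk_inverse, of g h], of "[]"]
        holonomy_closed_append[OF g(1), of "walk_inverse g @ h"] by (simp add: R_def)
    have "triangle_point 1 1 1 \<in> real_vectors" by (simp add: real_vectors_iff triangle_point_def)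
    then have u: "R *v triangle_point 1 1 1 \<in> real_vectors"
      unfolding R_def by (intro real_matrix_vector holonomy_real_O21 shear)
    define u where "u = R *v triangle_point 1 1 1"
    obtain u1 u2 u3 where u': "u $ 1 = of_real u1" "u $ 2 = of_real u2" "u $ 3 = of_real u3"
      using u unfolding u_def[symmetric] real_vectors_iff by (metis Reals_cases)
    have "M *v triangle_point 1 1 1 = holonomy t [] g *v (k *s u)"
      unfolding k Rh u_def
      by (simp add: matrix_vector_mul_assoc[symmetric] mat_mult_vector matrix_vector_mult_smult)
    then have zM: "z M = k *s u"
      unfolding z_def Q_def by (simp add: matrix_vector_mul_assoc U21_matrix_inv[OF HU])
    define a b c where "a = u1 + u2 / sqrt 2" and "b = u2 / sqrt 2 - u3" and "c = - (u2 / sqrt 2)"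
    have abc: "\<alpha> M = k * of_real a" "\<beta> M = k * of_real b" "\<gamma> M = k * of_real c"
      by (simp_all add: \<alpha>_def \<beta>_def \<gamma>_def zM u' a_def b_def c_def algebra_simps)
    have kk: "k * cnj k = 1" using k(2) complex_norm_square[of k] by simp
    have r: "k * of_real x * cnj (k * of_real y) = of_real (x * y)" for x y
    proof -
      have "k * of_real x * cnj (k * of_real y) = (k * cnj k) * of_real (x * y)" by simp
      then show ?thesis unfolding kk by simp
    qed
    have "Re (\<alpha> M * cnj (\<gamma> M)) > 0" "Re (\<beta> M * cnj (\<gamma> M)) > 0"
      using M unfolding N_def by blast+
    then have "a * c > 0" "b * c > 0" unfolding abc r Re_complex_of_real .
    then have pos: "a / c > 0" "b / c > 0" "c \<noteq> 0"
        by (auto simp: zero_less_mult_iff zero_less_divide_iff)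
    have "u = of_real c *s triangle_point (a / c) (b / c) 1"
      using pos(3) by (simp add: vec_eq_iff_3 u' triangle_point_def distrib_left right_diff_distrib
          flip: of_real_mult of_real_add of_real_diff of_real_minus)
        (simp add: a_def b_def c_def)
    then have "holonomy t [] h *v triangle_point 1 1 1
        = of_real c *s (holonomy t [] g *v triangle_point (a / c) (b / c) 1)"
      unfolding Rh by (simp add: matrix_vector_mul_assoc[symmetric] matrix_vector_mult_smult flip:
          u_def)
    then have "walk_class g = walk_class h"
      using holonomy_determines[OF g(1) h(1), of "a / c" "b / c" 1 "of_real c"] pos by simp
    then have "A = proj_class (holonomy t [] h)"
      unfolding g(2) using fuchsian_rep_walk_class[OF shear] by metis
    then show "M \<in> A" using h by simp
  qed
  ultimately show "openin (top_of_set (\<Union> ?G)) A" unfolding openin_open by blast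
qed

lemma discrete_faithful_fuchsian: "discrete_faithful_PO21 T d0 (fuchsian_rep t)"
  unfolding discrete_faithful_PO21_def
  using fuchsian_discrete fuchsian_injective holonomy_PO21[OF shear]
  by (auto simp: carrier_fund_group fuchsian_rep_walk_class[OF shear])

lemma hyperbolic_holonomy_fuchsian: "hyperbolic_holonomy T d0 (fuchsian_rep t)"
  unfolding hyperbolic_holonomy_def
proof (intro exI conjI ballI impI)
  show "T_bent T d0 (fuchsian_rep t) (fuchsian_map t)" by (rule T_bent_fuchsian)
  note wf = walk_framing_fuchsian_map[OF shear, THEN fun_cong, unfolded walk_framing_def]
  fix X Y assume "X \<in> lifted_darts" "Y \<in> lifted_darts" and ne: "lift_triangle X \<noteq> lift_triangle Y"
  then obtain u v where uv: "X = walk_class u" "Y = walk_class v" by (auto simp: lifted_darts_def)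
  show "open_ideal_triangle (fuchsian_map t (origin X)) (fuchsian_map t (origin (lift_nxt X)))
            (fuchsian_map t (origin (lift_nxt (lift_nxt X)))) \<inter>
        open_ideal_triangle (fuchsian_map t (origin Y)) (fuchsian_map t (origin (lift_nxt Y)))
            (fuchsian_map t (origin (lift_nxt (lift_nxt Y)))) = {}"
    using walk_triangles_disjoint[of u v] ne by (simp add: uv lift_nxt_walk_class wf walk_triangle_def)
qed

end

section \<open>Spectral radius\<close>

definition eigenvalues :: "complex^3^3 \<Rightarrow> complex set" where
  "eigenvalues M = {c. \<exists>v. v \<noteq> 0 \<and> M *v v = c *s v}"

lemma spectral_radius_eq: "spectral_radius M = Max (cmod ` eigenvalues M)"
  unfolding spectral_radius_def eigenvalues_def by (rule arg_cong[where f = Max]) auto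

text \<open>The characteristic polynomial, expanded by the rule of Sarrus so that its leading
  coefficient can be read off.\<close>

definition det_poly :: "complex^3^3 \<Rightarrow> complex poly" where
  "det_poly M = (let p = (\<lambda>i j. [:M$i$j, if i = j then -1 else 0:]) in
     p 1 1 * p 2 2 * p 3 3 + p 1 2 * p 2 3 * p 3 1 + p 1 3 * p 2 1 * p 3 2
     - p 1 1 * p 2 3 * p 3 2 - p 1 2 * p 2 1 * p 3 3 - p 1 3 * p 2 2 * p 3 1)"

lemma poly_det_poly: "poly (det_poly M) c = det (M - mat c)"
proof -
  have e: "poly [:M$i$j, if i = j then -1 else 0:] c = (M - mat c)$i$j" for i j
    by (simp add: mat_def)
  show ?thesis unfolding det_3 det_poly_def Let_def poly_add poly_diff poly_mult e ..
qed

lemma eigenvalue_iff_det: "c \<in> eigenvalues M \<longleftrightarrow> det (M - mat c) = 0"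
proof -
  have "(M - mat c) *v v = M *v v - c *s v" for v
    by (simp add: matrix_vector_mult_diff_rdistrib mat_mult_vector)
  then have "c \<in> eigenvalues M \<longleftrightarrow> (\<exists>v. v \<noteq> 0 \<and> (M - mat c) *v v = 0)"
    by (simp add: eigenvalues_def)
  also have "\<dots> \<longleftrightarrow> \<not> invertible (M - mat c)"
    by (metis invertible_left_inverse matrix_left_invertible_ker)
  finally show ?thesis by (simp add: invertible_det_nz)
qed

lemma coeff_det_poly: "coeff (det_poly M) 3 = -1"
  by (simp add: det_poly_def Let_def numeral_3_eq_3)

lemma finite_eigenvalues: "finite (eigenvalues M)"
proof -
  have "det_poly M \<noteq> 0" using coeff_det_poly[of M] by auto
  then have "finite {c. poly (det_poly M) c = 0}" by (rule poly_roots_finite)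
  then show ?thesis by (simp add: poly_det_poly eigenvalue_iff_det[symmetric])
qed

lemma eigenvalues_nonempty: "eigenvalues M \<noteq> {}"
proof -
  have "degree (det_poly M) \<ge> 3" using coeff_det_poly[of M] by (intro le_degree) simp
  then have "\<not> constant (poly (det_poly M))" by (simp add: constant_degree)
  then obtain c where "poly (det_poly M) c = 0" using fundamental_theorem_of_algebra by blast
  then have "c \<in> eigenvalues M" by (simp add: poly_det_poly eigenvalue_iff_det)
  then show ?thesis by blast
qed

lemma spectral_radius_leI:
  assumes "\<And>c. c \<in> eigenvalues M \<Longrightarrow> cmod c \<le> r" shows "spectral_radius M \<le> r"
  unfolding spectral_radius_eq using assms finite_eigenvalues eigenvalues_nonempty
      by (subst Max_le_iff) auto

lemma spectral_radius_geI: "c \<in> eigenvalues M \<Longrightarrow> cmod c \<le> spectral_radius M"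
  unfolding spectral_radius_eq using finite_eigenvalues by (intro Max_ge) auto

lemma spectral_radius_pos:
  assumes "M \<in> carrier U21" shows "spectral_radius M > 0"
proof -
  obtain c where c: "c \<in> eigenvalues M" using eigenvalues_nonempty by blast
  then obtain v where v: "v \<noteq> 0" "M *v v = c *s v" by (auto simp: eigenvalues_def)
  then have "c \<noteq> 0" using U21_nonzero[OF assms v(1)] by auto
  then show ?thesis using spectral_radius_geI[OF c] by (meson less_le_trans zero_less_norm_iff)
qed

text \<open>The lift chosen in \<open>translation_length\<close> is arbitrary; another one
  multiplies all eigenvalues by a unit scalar.\<close>

lemma translation_length_proj_class:
  assumes "P \<in> carrier U21"
  shows "translation_length (proj_class P) = 2 * ln (spectral_radius P)"
proof -
  have "spectral_radius (mat k ** P) = spectral_radius P" if k: "cmod k = 1" for k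
  proof -
    have sub: "cmod ` eigenvalues M \<subseteq> cmod ` eigenvalues (mat k ** M)" if "cmod k = 1" for k M
    proof
      fix x assume "x \<in> cmod ` eigenvalues M"
      then obtain c v where c: "x = cmod c" "v \<noteq> 0" "M *v v = c *s v" by (auto simp: eigenvalues_def)
      then have "(mat k ** M) *v v = (k * c) *s v"
        by (simp add: matrix_vector_mul_assoc[symmetric] mat_mult_vector vector_smult_assoc)
      then have "k * c \<in> eigenvalues (mat k ** M)" using c by (auto simp: eigenvalues_def)
      moreover have "x = cmod (k * c)" using c that by (simp add: norm_mult)
      ultimately show "x \<in> cmod ` eigenvalues (mat k ** M)" by blast
    qed
    have "k \<noteq> 0" using k by auto
    then have "mat (1 / k) ** (mat k ** P) = P" by (simp add: matrix_mul_assoc mat_mult_mat)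
    then have "cmod ` eigenvalues (mat k ** P) = cmod ` eigenvalues P"
      using sub[of k P] sub[of "1 / k" "mat k ** P"] k by (simp add: norm_divide)
    then show ?thesis by (simp add: spectral_radius_eq)
  qed
  moreover have "(SOME M. M \<in> proj_class P) \<in> proj_class P" using proj_class_self by (rule someI)
  ultimately show ?thesis by (auto simp: translation_length_def proj_class_def)
qed

lemma eigenvalues_conjugate:
  assumes F: "F \<in> carrier U21" and eq: "P ** F = mat k ** (F ** U)" and k: "cmod k = 1"
  shows "cmod ` eigenvalues P = cmod ` eigenvalues U"
proof (intro equalityI subsetI)
  fix x assume "x \<in> cmod ` eigenvalues U"
  then obtain c v where c: "x = cmod c" "v \<noteq> 0" "U *v v = c *s v" by (auto simp: eigenvalues_def)
  have "P *v (F *v v) = k *s (F *v (U *v v))"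
    by (simp add: matrix_vector_mul_assoc eq) (simp add: matrix_vector_mul_assoc[symmetric]
        mat_mult_vector)
  then have "P *v (F *v v) = (k * c) *s (F *v v)"
      by (simp add: c matrix_vector_mult_smult vector_smult_assoc)
  then have "k * c \<in> eigenvalues P" using U21_nonzero[OF F c(2)] by (auto simp: eigenvalues_def)
  moreover have "x = cmod (k * c)" using c k by (simp add: norm_mult)
  ultimately show "x \<in> cmod ` eigenvalues P" by blast
next
  fix x assume "x \<in> cmod ` eigenvalues P"
  then obtain c v where c: "x = cmod c" "v \<noteq> 0" "P *v v = c *s v" by (auto simp: eigenvalues_def)
  define w where "w = matrix_inv F *v v"
  have v: "v = F *v w" using F by (simp add: w_def matrix_vector_mul_assoc U21_matrix_inv)
  have "w \<noteq> 0" using c v by auto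
  have k0: "k \<noteq> 0" using k by auto
  have "k *s (F *v (U *v w)) = (P ** F) *v w"
    by (simp add: eq) (simp add: matrix_vector_mul_assoc[symmetric] mat_mult_vector)
  also have "\<dots> = c *s (F *v w)" using c v by (simp add: matrix_vector_mul_assoc[symmetric])
  finally have "(1 / k) *s (k *s (F *v (U *v w))) = (1 / k) *s (c *s (F *v w))" by simp
  then have "F *v (U *v w) = F *v ((c / k) *s w)"
    using k0 by (simp add: vector_smult_assoc matrix_vector_mult_smult)
  then have "U *v w = (c / k) *s w" by (rule U21_inj[OF F])
  then have "c / k \<in> eigenvalues U" using \<open>w \<noteq> 0\<close> by (auto simp: eigenvalues_def)
  moreover have "x = cmod (c / k)" using c k by (simp add: norm_divide)
  ultimately show "x \<in> cmod ` eigenvalues U" by blast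
qed

section \<open>Growth of powers\<close>

definition entry_sum :: "complex^3^3 \<Rightarrow> real" where
  "entry_sum A = (\<Sum>i\<in>UNIV. \<Sum>j\<in>UNIV. cmod (A$i$j))"

lemma entry_le_sum: "cmod (A$i$j) \<le> entry_sum A"
proof -
  have "cmod (A$i$j) \<le> (\<Sum>j\<in>UNIV. cmod (A$i$j))" by (intro member_le_sum) auto
  also have "\<dots> \<le> entry_sum A"
    unfolding entry_sum_def by (intro member_le_sum[where f =
        "\<lambda>i. \<Sum>j\<in>UNIV. cmod (A$i$j)"]) (auto intro: sum_nonneg)
  finally show ?thesis .
qed

lemma entry_sum_nonneg: "entry_sum A \<ge> 0"
  unfolding entry_sum_def by (intro sum_nonneg) auto

lemma entry_sum_mono:
  assumes "\<And>i j. cmod (A$i$j) \<le> cmod (B$i$j)" shows "entry_sum A \<le> entry_sum B"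
  unfolding entry_sum_def by (intro sum_mono assms)

lemma entry_sum_mult: "entry_sum (A ** B) \<le> entry_sum A * entry_sum B"
proof -
  have row: "(\<Sum>j\<in>UNIV. cmod (B$k$j)) \<le> entry_sum B" for k
    unfolding entry_sum_def by (intro member_le_sum[where f =
        "\<lambda>i. \<Sum>j\<in>UNIV. cmod (B$i$j)"]) (auto intro: sum_nonneg)
  have "entry_sum (A ** B) \<le> (\<Sum>i\<in>UNIV. \<Sum>j\<in>UNIV. \<Sum>k\<in>UNIV. cmod (A$i$k) * cmod (B$k$j))"
    unfolding entry_sum_def matrix_matrix_mult_def
    by (intro sum_mono) (simp, rule order_trans[OF norm_sum], simp add: norm_mult)
  also have "\<dots> = (\<Sum>i\<in>UNIV. \<Sum>k\<in>UNIV. cmod (A$i$k) * (\<Sum>j\<in>UNIV. cmod (B$k$j)))"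
    unfolding sum_distrib_left by (rule sum.cong[OF HOL.refl]) (rule sum.swap)
  also have "\<dots> \<le> (\<Sum>i\<in>UNIV. \<Sum>k\<in>UNIV. cmod (A$i$k) * entry_sum B)"
    by (intro sum_mono mult_left_mono row) auto
  also have "\<dots> = entry_sum A * entry_sum B"
    by (simp add: entry_sum_def sum_distrib_right)
  finally show ?thesis .
qed

fun mpow :: "complex^3^3 \<Rightarrow> nat \<Rightarrow> complex^3^3" where
  "mpow A 0 = mat 1"
| "mpow A (Suc n) = A ** mpow A n"

lemma mpow_eigenvector: "A *v v = c *s v \<Longrightarrow> mpow A n *v v = (c^n) *s v"
  by (induction n) (simp_all add: matrix_vector_mul_assoc[symmetric] matrix_vector_mult_smult
      vector_smult_assoc
      mult.commute)

text \<open>The eigenvector equation is read in a coordinate where the eigenvector has maximal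
  modulus; the factor 3 is the number of summands.\<close>

lemma eigenvalue_power_le:
  assumes "c \<in> eigenvalues A"
  shows "cmod c ^ n \<le> 3 * entry_sum (mpow A n)"
proof -
  obtain v where v: "v \<noteq> 0" "A *v v = c *s v" using assms by (auto simp: eigenvalues_def)
  define m where "m = Max (range (\<lambda>i. cmod (v$i)))"
  have le: "cmod (v$i) \<le> m" for i unfolding m_def by (intro Max_ge) auto
  have "m \<in> range (\<lambda>i. cmod (v$i))" unfolding m_def by (intro Max_in) auto
  then obtain i where i: "m = cmod (v$i)" by blast
  have "m > 0"
  proof (rule ccontr)
    assume "\<not> m > 0"
    then have "cmod (v$i) \<le> 0" for i using le[of i] by linarith
    then show False using v by (simp add: vec_eq_iff)
  qed
  have "cmod c ^ n * m = cmod ((mpow A n *v v) $ i)"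
    by (simp add: mpow_eigenvector[OF v(2)] i norm_mult norm_power)
  also have "\<dots> \<le> (\<Sum>j\<in>UNIV. cmod (mpow A n $ i $ j * v $ j))"
    unfolding matrix_vector_mult_def by (simp, rule norm_sum)
  also have "\<dots> \<le> (\<Sum>j\<in>(UNIV :: 3 set). entry_sum (mpow A n) * m)"
    by (intro sum_mono) (auto simp: norm_mult intro!: mult_mono entry_le_sum le entry_sum_nonneg)
  also have "\<dots> = 3 * entry_sum (mpow A n) * m" by simp
  finally show ?thesis using \<open>m > 0\<close> by simp
qed

text \<open>Otherwise the ratio x/r > 1 would have powers growing exponentially under a quadratic
  bound.\<close>

lemma quadratic_growth:
  fixes x r C :: real
  assumes "r > 0" "x \<ge> 0" "\<And>n. x ^ n \<le> C * (real n + 1)^2 * r ^ n"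
  shows "x \<le> r"
proof (rule ccontr)
  assume "\<not> x \<le> r"
  define q where "q = x / r"
  have q: "q > 1" using \<open>\<not> x \<le> r\<close> assms(1) by (simp add: q_def field_simps)
  have le: "q ^ n \<le> C * (real n + 1)^2" for n
    using assms(3)[of n] assms(1) by (simp add: q_def power_divide field_simps)
  have "((\<lambda>n. C * (real n + 1)^2 / q ^ n) \<longlongrightarrow> 0) sequentially"
    using q by real_asymp
  then have "\<forall>\<^sub>F n in sequentially. C * (real n + 1)^2 / q ^ n < 1"
    by (rule order_tendstoD) simp
  then obtain n where "C * (real n + 1)^2 / q ^ n < 1" using eventually_sequentially by auto
  moreover have "q ^ n > 0" using q by simp
  ultimately show False using le[of n] by (simp add: field_simps)
qed

text \<open>By Cayley-Hamilton, the entries of the powers of a two by two matrix with determinant \<open>1\<close> and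
  eigenvalues \<open>l, m\<close> satisfy this recurrence; \<open>s (n + 1) - m * s n\<close> is then geometric.\<close>

lemma linear_recurrence_bound:
  fixes s :: "nat \<Rightarrow> complex"
  assumes l: "l * m = 1" "cmod l \<ge> 1" and s: "\<And>n. s (Suc (Suc n)) = (l + m) * s (Suc n) - s n"
  shows "cmod (s n) \<le> (cmod (s 0) + cmod (s 1 - m * s 0)) * (real n + 1) * cmod l ^ n"
proof -
  define K where "K = cmod (s 1 - m * s 0)"
  have geo: "s (Suc n) - m * s n = l ^ n * (s 1 - m * s 0)" for n
  proof (induction n)
    case (Suc n)
    have "s (Suc (Suc n)) - m * s (Suc n) = l * (s (Suc n) - m * s n) + (l * m - 1) * s n"
      unfolding s by (simp add: algebra_simps)
    then show ?case using Suc l by simp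
  qed simp
  have "cmod l * cmod m = 1" using l(1) by (metis norm_mult norm_one)
  then have m: "cmod m \<le> 1" using l(2)
    by (metis mult_right_mono mult_1 norm_ge_zero)
  show ?thesis unfolding K_def[symmetric]
  proof (induction n)
    case (Suc n)
    have pow: "cmod l ^ n \<le> cmod l ^ Suc n" by (rule power_increasing) (use l(2) in simp_all)
    have "s (Suc n) = m * s n + l ^ n * (s 1 - m * s 0)" using geo[of n] by (simp add: algebra_simps)
    then have "cmod (s (Suc n)) \<le> cmod m * cmod (s n) + cmod l ^ n * K"
      by (metis K_def norm_mult norm_power norm_triangle_ineq)
    also have "\<dots> \<le> cmod (s n) + cmod l ^ n * K"
      using m mult_right_mono[OF m, of "cmod (s n)"] by simp
    also have "\<dots> \<le> (cmod (s 0) + K) * (real n + 1) * cmod l ^ n + (cmod (s 0) + K) * cmod l ^ n"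
    proof (intro add_mono Suc)
      have "K \<le> cmod (s 0) + K" by simp
      then have "K * cmod l ^ n \<le> (cmod (s 0) + K) * cmod l ^ n" by (rule mult_right_mono) simp
      then show "cmod l ^ n * K \<le> (cmod (s 0) + K) * cmod l ^ n" by (simp only: mult.commute)
    qed
    also have "\<dots> = (cmod (s 0) + K) * (real (Suc n) + 1) * cmod l ^ n" by (simp add: algebra_simps)
    also have "\<dots> \<le> (cmod (s 0) + K) * (real (Suc n) + 1) * cmod l ^ Suc n"
      by (rule mult_left_mono[OF pow]) (simp add: K_def)
    finally show ?case .
  qed (simp add: K_def)
qed

fun sl2_pow :: "real \<times> real \<times> real \<times> real \<Rightarrow> nat \<Rightarrow> real \<times> real \<times> real \<times> real" where
  "sl2_pow B 0 = (1, 0, 0, 1)"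
| "sl2_pow (a, b, c, d) (Suc n) = (let (a', b', c', d') = sl2_pow (a, b, c, d) n in
     (a*a' + b*c', a*b' + b*d', c*a' + d*c', c*b' + d*d'))"

text \<open>Nine entries, each of modulus at most 2 * M^2.\<close>

lemma sym2_norm_le:
  assumes "\<bar>a\<bar> \<le> M" "\<bar>b\<bar> \<le> M" "\<bar>c\<bar> \<le> M" "\<bar>d\<bar> \<le> M"
  shows "entry_sum (sym2 a b c d) \<le> 18 * M^2"
proof -
  have M: "M \<ge> 0" using assms(1) by linarith
  have p: "\<bar>x\<bar> * \<bar>y\<bar> \<le> M * M" if "\<bar>x\<bar> \<le> M" "\<bar>y\<bar> \<le> M" for x y :: real
    using that by (intro mult_mono) auto
  have r2: "sqrt 2 \<le> 2" by (rule real_le_lsqrt) simp_all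
  have q: "sqrt 2 * \<bar>x\<bar> * \<bar>y\<bar> \<le> 2 * (M * M)" if "\<bar>x\<bar> \<le> M" "\<bar>y\<bar> \<le> M" for x y :: real
    using mult_mono[OF r2 p[OF that]] by (simp add: mult.assoc)
  have s: "x^2 \<le> 2 * (M * M)" if "\<bar>x\<bar> \<le> M" for x :: real
  proof -
    have "x^2 = \<bar>x\<bar> * \<bar>x\<bar>" by (simp add: power2_eq_square)
    then show ?thesis using p[OF that that] mult_nonneg_nonneg[OF M M] by linarith
  qed
  have e: "cmod (of_real a * of_real d + of_real b * of_real c) \<le> 2 * (M * M)"
  proof -
    have "cmod (of_real a * of_real d + of_real b * of_real c) \<le> \<bar>a\<bar> * \<bar>d\<bar> + \<bar>b\<bar> * \<bar>c\<bar>"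
      using norm_triangle_ineq[of "complex_of_real a * of_real d" "of_real b * of_real c"]
      by (simp add: norm_mult)
    then show ?thesis using p[of a d] p[of b c] assms by linarith
  qed
  have "\<forall>i j. cmod (sym2 a b c d $ i $ j) \<le> 2 * (M * M)"
    using assms e by (simp add: forall_3 sym2_nth norm_mult norm_power q s abs_mult power2_abs)
  then have "entry_sum (sym2 a b c d) \<le> (\<Sum>i\<in>(UNIV :: 3 set). \<Sum>j\<in>(UNIV :: 3 set). 2 * (M * M))"
    unfolding entry_sum_def by (intro sum_mono) auto
  then show ?thesis by (simp add: power2_eq_square)
qed

text \<open>If l is an eigenvalue of the two by two matrix with cmod l \<ge> 1, then r = (cmod l)^2
  works: it is the modulus of an eigenvalue of the symmetric square, whose powers are bounded by the
  square of (n + 1) * (cmod l)^n. The linear factor covers a double eigenvalue.\<close>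

lemma sym2_growth:
  assumes det: "a * d - b * c = 1" and e: "cmod e = 1"
  shows "\<exists>C r. r > 0 \<and> r \<le> spectral_radius (mat e ** sym2 a b c d) \<and>
    (\<forall>n. entry_sum (mpow (mat e ** sym2 a b c d) n) \<le> C * (real n + 1)^2 * r ^ n)"
proof -
  define p where "p = [:1, - complex_of_real (a + d), 1:]"
  have "\<not> constant (poly p)" by (simp add: p_def constant_degree)
  then obtain l0 where "poly p l0 = 0" using fundamental_theorem_of_algebra by blast
  then have l0: "l0 * (of_real (a + d) - l0) = 1" by (simp add: p_def algebra_simps)
  define m0 where "m0 = of_real (a + d) - l0"
  have lm: "l0 * m0 = 1" "l0 + m0 = of_real (a + d)" using l0 by (simp_all add: m0_def)
  have "cmod l0 * cmod m0 = 1" using lm(1) by (metis norm_mult norm_one)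
  then have "cmod l0 \<ge> 1 \<or> cmod m0 \<ge> 1"
    by (metis linorder_not_le mult_strict_mono norm_ge_zero mult_1 less_irrefl zero_less_one)
  then obtain l m where l: "l * m = 1" "l + m = of_real (a + d)" "cmod l \<ge> 1"
    using lm by (metis add.commute mult.commute)
  define B where "B n = sl2_pow (a, b, c, d) n" for n
  define A where "A = mat e ** sym2 a b c d"
  have A: "mpow A n = mat (e^n) ** (case B n of (a', b', c', d') \<Rightarrow> sym2 a' b' c' d')" for n
  proof (induction n)
    case 0
    show ?case by (simp add: B_def sym2_one)
  next
    case (Suc n)
    obtain a' b' c' d' where B': "B n = (a', b', c', d')" by (metis surj_pair)
    have "mpow A (Suc n) = (mat e ** sym2 a b c d) ** (mat (e^n) ** sym2 a' b' c' d')"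
      using Suc by (simp add: A_def B')
    then show ?case using B' unfolding mat_mult_mult sym2_mult B_def by simp
  qed
  define sa sb sc sd where "sa n = complex_of_real (fst (B n))" and
      "sb n = complex_of_real (fst (snd (B n)))"
    and "sc n = complex_of_real (fst (snd (snd (B n))))" and
        "sd n = complex_of_real (snd (snd (snd (B n))))" for n
  have det': "complex_of_real a * of_real d - of_real b * of_real c = 1"
    using det by (metis of_real_1 of_real_diff of_real_mult)
  have step: "sa (Suc n) = a * sa n + b * sc n" "sb (Suc n) = a * sb n + b * sd n"
    "sc (Suc n) = c * sa n + d * sc n" "sd (Suc n) = c * sb n + d * sd n" for n
    by (simp_all add: sa_def sb_def sc_def sd_def B_def split: prod.split)
  have ch: "a * (a * x + b * y) + b * (c * x + d * y) = (of_real a + of_real d) * (a * x + b * y) - x"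
    "c * (a * x + b * y) + d * (c * x + d * y) = (of_real a + of_real d) * (c * x + d * y) - y" for
        x y :: complex
  proof -
    have "a * (a * x + b * y) + b * (c * x + d * y) = (of_real a + of_real d) * (a * x + b * y) -
        (of_real a * of_real d - of_real b * of_real c) * x"
      by (simp add: algebra_simps)
    then show "a * (a * x + b * y) + b * (c * x + d * y)
        = (of_real a + of_real d) * (a * x + b * y) - x"
      unfolding det' by simp
    have "c * (a * x + b * y) + d * (c * x + d * y) = (of_real a + of_real d) * (c * x + d * y) -
        (of_real a * of_real d - of_real b * of_real c) * y"
      by (simp add: algebra_simps)
    then show "c * (a * x + b * y) + d * (c * x + d * y)
        = (of_real a + of_real d) * (c * x + d * y) - y"
      unfolding det' by simp
  qed
  have rec: "sa (Suc (Suc n)) = (l + m) * sa (Suc n) - sa n" "sb (Suc (Suc n))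
      = (l + m) * sb (Suc n) - sb n"
    "sc (Suc (Suc n)) = (l + m) * sc (Suc n) - sc n" "sd (Suc (Suc n))
        = (l + m) * sd (Suc n) - sd n" for n
    unfolding step l(2) of_real_add by (rule ch)+
  define Q where "Q s = cmod (s 0) + cmod (s 1 - m * s 0)" for s :: "nat \<Rightarrow> complex"
  define K where "K = Q sa + Q sb + Q sc + Q sd"
  have Q: "Q s \<ge> 0" for s by (simp add: Q_def)
  have K: "Q sa \<le> K" "Q sb \<le> K" "Q sc \<le> K" "Q sd \<le> K" unfolding K_def
      using Q[of sa] Q[of sb] Q[of sc] Q[of sd] by linarith+
  have bound: "cmod (s n) \<le> K * (real n + 1) * cmod l ^ n"
    if "\<And>n. s (Suc (Suc n)) = (l + m) * s (Suc n) - s n" "Q s \<le> K" for s n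
  proof -
    have "cmod (s n) \<le> Q s * (real n + 1) * cmod l ^ n"
      unfolding Q_def by (rule linear_recurrence_bound[where s = s, OF l(1,3) that(1)])
    also have "\<dots> \<le> K * (real n + 1) * cmod l ^ n" using that(2) by (intro mult_right_mono) auto
    finally show ?thesis .
  qed
  have growth: "entry_sum (mpow A n) \<le> (18 * K^2) * (real n + 1)^2 * (cmod l ^ 2) ^ n" for n
  proof -
    obtain a' b' c' d' where B': "B n = (a', b', c', d')" by (metis surj_pair)
    have "\<bar>a'\<bar> \<le> K * (real n + 1) * cmod l ^ n" "\<bar>b'\<bar> \<le> K * (real n + 1) * cmod l ^ n"
      "\<bar>c'\<bar> \<le> K * (real n + 1) * cmod l ^ n" "\<bar>d'\<bar> \<le> K * (real n + 1) * cmod l ^ n"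
      using bound[of sa n] bound[of sb n] bound[of sc n] bound[of sd n] rec K
      by (simp_all add: sa_def sb_def sc_def sd_def B')
    then have "entry_sum (sym2 a' b' c' d') \<le> 18 * (K * (real n + 1) * cmod l ^ n)^2"
        by (rule sym2_norm_le)
    moreover have "entry_sum (mpow A n) = entry_sum (sym2 a' b' c' d')"
      by (simp add: A B' entry_sum_def mat_mult_nth norm_mult norm_power e)
    ultimately show ?thesis by (simp add: power_mult_distrib power_mult[symmetric] mult.commute
        mult.left_commute)
  qed
  \<comment> \<open>An eigenvector for \<open>l\<close> is (b, l - a) or (l - d, c), unless both
    vanish and the matrix is scalar.\<close>
  have "\<exists>(x::complex) (y::complex). (x, y) \<noteq> (0, 0) \<and> a * x + b * y = l * x \<and> c * x + d * y = l * y"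
  proof -
    have ll: "(of_real a - l) * (of_real d - l) = of_real b * of_real c"
    proof -
      have "(of_real a - l) * (of_real d - l) = of_real a * of_real d - l * (of_real (a + d)) + l * l"
        by (simp add: algebra_simps)
      also have "\<dots> = of_real a * of_real d - l * m" unfolding l(2)[symmetric]
          by (simp add: algebra_simps)
      finally show ?thesis using l(1) det' by (simp add: algebra_simps)
    qed
    show ?thesis
    proof (cases "of_real b = (0 :: complex) \<and> of_real a = l")
      case False
      then show ?thesis using ll
        by (rule_tac exI[of _ "of_real b"], rule_tac exI[of _
            "l - of_real a"]) (auto simp: algebra_simps)
    next
      case True
      show ?thesis
      proof (cases "of_real c = (0 :: complex) \<and> of_real d = l")
        case False
        then show ?thesis using ll True
          by (rule_tac exI[of _ "l - of_real d"], rule_tac exI[of _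
              "of_real c"]) (auto simp: algebra_simps)
      next
        case True
        then show ?thesis using \<open>of_real b = (0 :: complex) \<and> of_real a = l\<close>
          by (rule_tac exI[of _ 1], rule_tac exI[of _ 0]) auto
      qed
    qed
  qed
  then obtain x :: complex and y :: complex where xy: "(x, y) \<noteq> (0, 0)" "a * x + b * y = l * x"
      "c * x + d * y = l * y" by blast
  have "A *v pvec x y = (e * l^2) *s pvec x y"
    unfolding A_def matrix_vector_mul_assoc[symmetric] sym2_pvec xy pvec_smult mat_mult_vector
        vector_smult_assoc ..
  moreover have "pvec x y \<noteq> 0" using xy(1) by (simp add: pvec_eq_0_iff)
  ultimately have "e * l^2 \<in> eigenvalues A" by (auto simp: eigenvalues_def)
  then have "cmod l ^ 2 \<le> spectral_radius A" using spectral_radius_geI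
      by (fastforce simp: norm_mult norm_power e)
  moreover have "cmod l ^ 2 > 0" using l(3) by (metis less_le_trans zero_less_one zero_less_power)
  ultimately show ?thesis using growth unfolding A_def by blast
qed

lemma mpow_add: "mpow A (m + n) = mpow A m ** mpow A n"
  by (induction m) (simp_all add: matrix_mul_assoc)

section \<open>Domination\<close>

locale bent = triangulated +
  fixes \<rho> :: "walk set \<Rightarrow> (complex^3^3) set" and \<phi> :: "walk set set \<Rightarrow> (complex^3) set"
  assumes bent: "T_bent T d0 \<rho> \<phi>"
begin

abbreviation "f \<equiv> walk_framing \<phi>"
abbreviation "t \<equiv> shear_of f"

sublocale framing f
  by (rule framing_T_bent[OF bent])

lemma lift_ex: "closed_walk g \<Longrightarrow> \<exists>P. P \<in> \<rho> (walk_class g)"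
  using T_bent_PU21[OF bent] PU21_nonempty by blast

lemma Z_equivariant: "closed_walk g \<Longrightarrow> Z_walk f (g @ w) = Z_walk f w"
  using lift_ex T_bent_equivariant(5)[OF bent] by blast

sublocale fuchs: fuchsian T d0 t
  by unfold_locales (simp_all add: shear_shear_of shear_of_def Z_equivariant)

text \<open>The phase occurs in the middle row only, so it multiplies the second row of the product
  by a unit.\<close>

lemma bend_norm: "cmod y = 1 \<Longrightarrow> cmod ((bend s y ** X) $ i $ j) = cmod ((bend s 1 ** X) $ i $ j)"
proof -
  assume "cmod y = 1"
  then have "\<forall>i. cmod ((bend s y ** X) $ i $ j) = cmod ((bend s 1 ** X) $ i $ j)"
    by (simp add: forall_3 matrix_mult_nth_3 bend_nth norm_mult)
  then show ?thesis by blast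
qed

text \<open>Along a path without backtracking the signs of the unbent holonomy matrices are coherent,
  so that no cancellation occurs in their product.\<close>

lemma block_dominated:
  assumes "walk_frame f u F"
  shows "\<exists>M. walk_frame f (u @ block_word bs) (F ** M) \<and>
    (\<forall>i j. cmod (M$i$j) \<le> cmod (holonomy t u (block_word bs) $ i $ j))"
  using assms
proof (induction bs arbitrary: u F)
  case Nil
  then show ?case by (intro exI[of _ "mat 1"]) simp
next
  case (Cons b bs)
  define X where "X = (if b then rot else rot ** rot)"
  define M1 where "M1 = bend (t u) (bending_of f u) ** X"
  define H1 where "H1 = holonomy t u (block_word [b])"
  define u' where "u' = u @ block_word [b]"
  define H2 where "H2 = holonomy t u' (block_word bs)"
  have fr: "walk_frame f u' (F ** M1)"
    using walk_frame_nxt[OF walk_frame_opp(3)[OF Cons.prems]]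
      walk_frame_nxt[OF walk_frame_nxt[OF walk_frame_opp(3)[OF Cons.prems]]]
    by (auto simp: u'_def M1_def X_def matrix_mul_assoc)
  have M1: "cmod (M1$i$j) = cmod (H1$i$j)" for i j
    unfolding M1_def H1_def holonomy_block X_def[symmetric]
        by (rule bend_norm[OF walk_frame_opp(2)[OF Cons.prems]])
  obtain M2 where M2: "walk_frame f (u' @ block_word bs) (F ** M1 ** M2)"
    "\<And>i j. cmod (M2$i$j) \<le> cmod (H2 $ i $ j)"
    using Cons.IH[OF fr] unfolding H2_def by blast
  have nn: "nonneg_matrix H1" "nonneg_matrix H2"
    unfolding H1_def H2_def by (rule nonneg_holonomy_block[OF shear_shear_of])+
  have "holonomy t u (block_word (b # bs)) = H1 ** H2"
    unfolding H1_def H2_def u'_def holonomy_append[symmetric] block_word_simps(3)[symmetric] by simp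
  moreover have "cmod ((M1 ** M2) $ i $ j) \<le> cmod ((H1 ** H2) $ i $ j)" for i j
  proof -
    have "cmod ((M1 ** M2) $ i $ j) \<le> cmod (M1$i$1 * M2$1$j) + cmod (M1$i$2 * M2$2$j) + cmod (M1$i$3
        * M2$3$j)"
      unfolding matrix_mult_nth_3 by (meson add_right_mono norm_triangle_ineq order_trans)
    also have "\<dots> \<le> cmod (H1$i$1) * cmod (H2$1$j) + cmod (H1$i$2) * cmod (H2$2$j) + cmod (H1$i$3) *
        cmod (H2$3$j)"
      unfolding norm_mult M1 by (intro add_mono mult_left_mono M2) auto
    also have "\<dots> = cmod ((H1 ** H2) $ i $ j)" by (rule nonneg_matrix_mult(2)[OF nn, symmetric])
    finally show ?thesis .
  qed
  moreover have "walk_frame f (u @ block_word (b # bs)) (F ** (M1 ** M2))"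
    using M2(1) by (simp add: u'_def matrix_mul_assoc)
  ultimately show ?case by auto
qed

lemma walk_frame_nxt_power: "walk_frame f w F \<Longrightarrow> walk_frame f (w @ replicate i Nxt) (F ** mpow rot i)"
proof (induction i arbitrary: w F)
  case (Suc i)
  show ?case using Suc.IH[OF walk_frame_nxt[OF Suc.prems]] by (simp add: matrix_mul_assoc)
qed simp

lemma holonomy_nxt_power: "holonomy s u (replicate i Nxt) = mpow rot i"
  by (induction i arbitrary: u) simp_all

lemma rot_power_inverse:
  assumes "i < 3" shows "mpow rot i ** mpow rot (3 - i) = mat 1" "mpow rot (3 - i) ** mpow rot i
      = mat 1"
proof -
  have "mpow rot 3 = mat 1" using rot_cube by (simp add: numeral_3_eq_3 matrix_mul_assoc)
  then show "mpow rot i ** mpow rot (3 - i) = mat 1" "mpow rot (3 - i) ** mpow rot i = mat 1"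
    using assms mpow_add[of rot i "3 - i"] mpow_add[of rot "3 - i" i] by simp_all
qed

text \<open>Only block words are dominated entrywise. The normal form of each power of
  \<open>g\<close> is a block word between at most two turns on either side, and these finitely many
  rotations, together with the base frame, give a constant independent of the exponent.\<close>

lemma power_dominated:
  assumes g: "closed_walk g" and P: "P \<in> \<rho> (walk_class g)"
  shows "\<exists>K\<ge>0. \<forall>n. entry_sum (mpow P n) \<le> K * entry_sum (mpow (holonomy t [] g) n)"
proof -
  define Q where "Q = holonomy t [] g"
  define gn where "gn n = concat (replicate n g)" for n
  obtain F where F: "walk_frame f [] F" using frame_ex by blast
  have FU: "F \<in> carrier U21" using F walk_frame_U21 by blast
  have frP: "walk_frame f (gn n) (mpow P n ** F)" for n
  proof (induction n)
    case (Suc n)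
    from T_bent_equivariant(4)[OF bent g P this] show ?case by (simp add: gn_def matrix_mul_assoc)
  qed (simp add: gn_def F)
  have Qn: "holonomy t [] (gn n) = mpow Q n" for n
    by (induction n) (simp_all add: gn_def fuchs.holonomy_closed_append[OF g] Q_def)
  \<comment> \<open>The index 3 is included because the inverse of \<open>mpow rot i\<close> is
    taken as \<open>mpow rot (3 - i)\<close>, also for i = 0.\<close>
  define R where "R = (\<Sum>i\<le>3. entry_sum (mpow rot i))"
  have R: "entry_sum (mpow rot i) \<le> R" if "i \<le> 3" for i
    unfolding R_def using that by (intro member_le_sum) (auto simp: entry_sum_nonneg)
  have R0: "R \<ge> 0" unfolding R_def by (intro sum_nonneg entry_sum_nonneg)
  define K where "K = entry_sum F * (R * (R * R * R) * entry_sum (matrix_inv F))"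
  have K: "K \<ge> 0" using R0 by (simp add: K_def entry_sum_nonneg)
  have "entry_sum (mpow P n) \<le> K * entry_sum (mpow Q n)" for n
  proof -
    obtain i bs k where ik: "i < 3" "k < 3"
      and h: "walk_homotopic (gn n) (replicate i Nxt @ block_word bs @ replicate k Nxt)"
      using walk_normal_form by blast
    define u where "u = replicate i Nxt"
    have "walk_frame f u (F ** mpow rot i)" using walk_frame_nxt_power[OF F, of i] by (simp add: u_def)
    then obtain M where M: "walk_frame f (u @ block_word bs) (F ** mpow rot i ** M)"
      "\<And>i j. cmod (M$i$j) \<le> cmod (holonomy t u (block_word bs) $ i $ j)"
      using block_dominated by blast
    define H where "H = holonomy t u (block_word bs)"
    have "walk_frame f (gn n) (F ** mpow rot i ** M ** mpow rot k)"
      using walk_frame_nxt_power[OF M(1), of k] walk_frame_homotopic[OF h] by (simp add: u_def)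
    then obtain c where c: "cmod c = 1" "mpow P n ** F = mat c ** (F ** mpow rot i ** M ** mpow rot k)"
      using walk_frame_unique frP by blast
    have "mpow P n = (mpow P n ** F) ** matrix_inv F"
      by (simp add: matrix_mul_assoc[symmetric] U21_matrix_inv[OF FU])
    also have "\<dots> = mat c ** (F ** (mpow rot i ** (M ** (mpow rot k ** matrix_inv F))))"
      unfolding c(2) by (simp add: matrix_mul_assoc)
    finally have "entry_sum (mpow P n) = entry_sum (F ** (mpow rot i ** (M ** (mpow rot k **
        matrix_inv F))))"
      using c(1) by (simp add: entry_sum_def mat_mult_nth norm_mult)
    also have "\<dots> \<le> entry_sum F * (entry_sum (mpow rot i) * (entry_sum M * (entry_sum (mpow rot k) *
        entry_sum (matrix_inv F))))"
      by (intro order_trans[OF entry_sum_mult] mult_left_mono entry_sum_nonneg order_refl)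
    also have "\<dots> \<le> entry_sum F * (R * (entry_sum H * (R * entry_sum (matrix_inv F))))"
      using ik by (intro mult_mono R order_refl entry_sum_mono mult_nonneg_nonneg entry_sum_nonneg
          R0) (auto simp: H_def M(2))
    finally have 1: "entry_sum (mpow P n) \<le> entry_sum F * (R * (entry_sum H * (R * entry_sum
        (matrix_inv F))))" .
    have "mpow Q n = mpow rot i ** (H ** mpow rot k)"
      using holonomy_homotopic[OF shear_shear_of h, of "[]"]
      by (simp add: Qn holonomy_append holonomy_nxt_power H_def u_def)
    then have "mpow rot (3 - i) ** (mpow Q n ** mpow rot (3 - k))
        = (mpow rot (3 - i) ** mpow rot i) ** H ** (mpow rot k ** mpow rot (3 - k))"
      by (simp add: matrix_mul_assoc)
    then have Heq: "mpow rot (3 - i) ** (mpow Q n ** mpow rot (3 - k)) = H"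
      using rot_power_inverse ik by simp
    have "entry_sum H \<le> entry_sum (mpow rot (3 - i)) * (entry_sum (mpow Q n) * entry_sum (mpow rot
        (3 - k)))"
      unfolding Heq[symmetric]
      by (intro order_trans[OF entry_sum_mult] mult_left_mono entry_sum_nonneg entry_sum_mult)
    also have "\<dots> \<le> R * (entry_sum (mpow Q n) * R)"
      by (intro mult_mono R order_refl mult_nonneg_nonneg entry_sum_nonneg R0) auto
    finally have "entry_sum F * (R * (entry_sum H * (R * entry_sum (matrix_inv F))))
        \<le> entry_sum F * (R * ((R * (entry_sum (mpow Q n) * R)) * (R * entry_sum (matrix_inv F))))"
      by (intro mult_left_mono mult_right_mono mult_nonneg_nonneg entry_sum_nonneg R0)
    also have "\<dots> = K * entry_sum (mpow Q n)" by (simp add: K_def mult.assoc mult.left_commute)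
    finally show ?thesis using 1 by linarith
  qed
  then show ?thesis using K unfolding Q_def by blast
qed

text \<open>The powers of an eigenvalue of \<open>P\<close> are bounded by the size of the powers of
  \<open>P\<close>, hence of \<open>Q\<close>, hence by a quadratic polynomial times r^n with r at
  most the spectral radius of \<open>Q\<close>.\<close>

theorem dominated:
  assumes g: "closed_walk g"
  shows "translation_length (\<rho> (walk_class g)) \<le> translation_length (proj_class (holonomy t [] g))"
proof -
  define Q where "Q = holonomy t [] g"
  have QU: "Q \<in> carrier U21" unfolding Q_def by (rule holonomy_U21[OF shear_shear_of])
  obtain P where P: "P \<in> \<rho> (walk_class g)" using lift_ex g by blast
  note P' = T_bent_equivariant(1,2)[OF bent g P]
  obtain e a b c d where s: "e = 1 \<or> e = -1" "a * d - b * c = 1" "Q = mat e ** sym2 a b c d"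
    unfolding Q_def using holonomy_sym2[OF shear_shear_of] by blast
  have "cmod e = 1" using s(1) by auto
  then obtain C r where r: "r > 0" "r \<le> spectral_radius Q"
      "\<And>n. entry_sum (mpow Q n) \<le> C * (real n + 1)^2 * r ^ n"
    using sym2_growth[OF s(2)] unfolding s(3) by blast
  obtain K where K: "K \<ge> 0" "\<And>n. entry_sum (mpow P n) \<le> K * entry_sum (mpow Q n)"
    using power_dominated[OF g P] unfolding Q_def by blast
  have "spectral_radius P \<le> r"
  proof (rule spectral_radius_leI)
    fix z assume z: "z \<in> eigenvalues P"
    have "cmod z ^ n \<le> (3 * K * C) * (real n + 1)^2 * r ^ n" for n
    proof -
      have "cmod z ^ n \<le> 3 * entry_sum (mpow P n)" by (rule eigenvalue_power_le[OF z])
      also have "\<dots> \<le> 3 * (K * (C * (real n + 1)^2 * r ^ n))"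
        using K(2)[of n] mult_left_mono[OF r(3) K(1), of n] by linarith
      finally show ?thesis by (simp add: mult.assoc)
    qed
    then show "cmod z \<le> r" by (rule quadratic_growth[OF r(1) norm_ge_zero])
  qed
  then have "ln (spectral_radius P) \<le> ln (spectral_radius Q)"
    using r(2) spectral_radius_pos[OF P'(1)] by simp
  then show ?thesis
    unfolding P'(2) Q_def[symmetric] translation_length_proj_class[OF P'(1)]
        translation_length_proj_class[OF QU] by simp
qed

section \<open>Peripheral loops\<close>

definition upper_triangular :: "complex^3^3 \<Rightarrow> bool" where
  "upper_triangular U \<longleftrightarrow> U$2$1 = 0 \<and> U$3$1 = 0 \<and> U$3$2 = 0"

lemma upper_triangular_mult:
  assumes "upper_triangular U" "upper_triangular V"
  shows "upper_triangular (U ** V)" "(U ** V)$i$i = U$i$i * V$i$i"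
proof -
  show "upper_triangular (U ** V)" using assms by (simp add: upper_triangular_def matrix_mult_nth_3)
  have "\<forall>i. (U ** V)$i$i = U$i$i * V$i$i" using assms
      by (simp add: forall_3 upper_triangular_def matrix_mult_nth_3)
  then show "(U ** V)$i$i = U$i$i * V$i$i" by blast
qed

lemma eigenvalues_upper_triangular:
  assumes "upper_triangular U" shows "eigenvalues U = range (\<lambda>i. U$i$i)"
proof -
  have "det (U - mat c) = (U$1$1 - c) * (U$2$2 - c) * (U$3$3 - c)" for c
    using assms by (simp add: det_3 upper_triangular_def mat_def)
  then have "eigenvalues U = {U$1$1, U$2$2, U$3$3}" by (auto simp: eigenvalue_iff_det)
  then show ?thesis by (auto simp: UNIV_3)
qed

lemma step_upper_triangular:
  assumes "cmod y = 1" "s > 0"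
  shows "upper_triangular (bend s y ** rot)" "upper_triangular (rot ** rot ** bend s y)"
    "cmod ((bend s y ** rot)$i$i) = cmod ((bend s 1 ** rot)$i$i)"
    "cmod ((rot ** rot ** bend s y)$i$i) = cmod ((rot ** rot ** bend s 1)$i$i)"
proof -
  show "upper_triangular (bend s y ** rot)" "upper_triangular (rot ** rot ** bend s y)"
    by (simp_all add: upper_triangular_def bend_rot_nth rot_square matrix_mult_nth_3 bend_nth sym2_nth)
  have "\<forall>i. cmod ((bend s y ** rot)$i$i) = cmod ((bend s 1 ** rot)$i$i)"
    "\<forall>i. cmod ((rot ** rot ** bend s y)$i$i) = cmod ((rot ** rot ** bend s 1)$i$i)"
    using assms by (simp_all add: forall_3 bend_rot_nth rot_square matrix_mult_nth_3 bend_nth sym2_nth)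
  then show "cmod ((bend s y ** rot)$i$i) = cmod ((bend s 1 ** rot)$i$i)"
    "cmod ((rot ** rot ** bend s y)$i$i) = cmod ((rot ** rot ** bend s 1)$i$i)" by blast+
qed

text \<open>For a walk \<open>c\<close> around a vertex, the bent and the unbent change of frame
  both fix \<infinity> and are triangular; the phases only affect the arguments of the diagonal
  entries.\<close>

definition same_diagonal :: "walk \<Rightarrow> complex^3^3 \<Rightarrow> walk \<Rightarrow> complex^3^3 \<Rightarrow> bool" where
  "same_diagonal w F c U \<longleftrightarrow> walk_frame f (w @ c) (F ** U) \<and> upper_triangular U \<and>
     upper_triangular (holonomy t w c) \<and> (\<forall>i. cmod (U$i$i) = cmod (holonomy t w c $i$i))"

lemma same_diagonal_append:
  assumes "same_diagonal w F c U" "same_diagonal (w @ c) (F ** U) c' U'"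
  shows "same_diagonal w F (c @ c') (U ** U')"
  using assms by (simp add: same_diagonal_def holonomy_append upper_triangular_mult norm_mult
      matrix_mul_assoc)

lemma turning_same_diagonal:
  assumes "c \<in> turning_walks" "walk_frame f w F"
  shows "\<exists>U. same_diagonal w F c U"
proof -
  have base: "same_diagonal w F [] (mat 1)" if "walk_frame f w F" for w F
  proof -
    have "upper_triangular (mat 1)" by (simp add: upper_triangular_def mat_def)
    then show ?thesis using that by (simp add: same_diagonal_def)
  qed
  have fwd: "\<exists>U. same_diagonal w F (turn n) U" if "walk_frame f w F" for n w F
    using that
  proof (induction n arbitrary: w F)
    case (Suc n)
    note o = walk_frame_opp[OF Suc.prems]
    define U where "U = bend (t w) (bending_of f w) ** rot"
    have "same_diagonal w F [Opp, Nxt] U"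
      using walk_frame_nxt[OF o(3)] step_upper_triangular[OF o(2,1)] step_upper_triangular[of 1
          "t w"] o(1)
      by (simp add: same_diagonal_def U_def matrix_mul_assoc)
    moreover from this obtain U' where "same_diagonal (w @ [Opp, Nxt]) (F ** U) (turn n) U'"
      using Suc.IH unfolding same_diagonal_def by blast
    ultimately have "same_diagonal w F ([Opp, Nxt] @ turn n) (U ** U')" by (rule same_diagonal_append)
    then show ?case by auto
  qed (use base in auto)
  have bwd: "\<exists>U. same_diagonal w F (walk_inverse (turn n)) U" if "walk_frame f w F" for n w F
    using that
  proof (induction n arbitrary: w F)
    case (Suc n)
    define v where "v = w @ [Nxt, Nxt]"
    have frv: "walk_frame f v (F ** rot ** rot)"
      using walk_frame_nxt[OF walk_frame_nxt[OF Suc.prems]] by (simp add: v_def)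
    note o = walk_frame_opp[OF frv]
    define U where "U = rot ** rot ** bend (t v) (bending_of f v)"
    have "same_diagonal w F [Nxt, Nxt, Opp] U"
      using o(3) step_upper_triangular[OF o(2,1)] step_upper_triangular[of 1 "t v"] o(1)
      by (simp add: same_diagonal_def U_def v_def matrix_mul_assoc)
    moreover from this obtain U' where "same_diagonal (w @ [Nxt, Nxt, Opp]) (F ** U) (walk_inverse
        (turn n)) U'"
      using Suc.IH unfolding same_diagonal_def by blast
    ultimately show ?case unfolding walk_inverse_turn_Suc using same_diagonal_append by blast
  qed (use base in auto)
  show ?thesis using assms fwd bwd unfolding turning_walks_eq by blast
qed

text \<open>Conjugation along \<open>u\<close> reduces the loop to a turning walk. Both changes of
  frame are then triangular, so their eigenvalues are the diagonal entries, with equal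
  moduli.\<close>

theorem peripheral_equal:
  assumes g: "closed_walk g" and p: "peripheral T d0 (walk_class g)"
  shows "translation_length (\<rho> (walk_class g)) = translation_length (proj_class (holonomy t [] g))"
proof -
  define Q where "Q = holonomy t [] g"
  have QU: "Q \<in> carrier U21" unfolding Q_def by (rule holonomy_U21[OF shear_shear_of])
  obtain P where P: "P \<in> \<rho> (walk_class g)" using lift_ex g by blast
  note P' = T_bent_equivariant(1,2)[OF bent g P]
  obtain u c where c: "c \<in> turning_walks" "walk_homotopic g (u @ c @ walk_inverse u)"
    using p by (auto simp: peripheral_def walk_class_eq_iff)
  have h: "walk_homotopic (g @ u) (u @ c)"
    using homotopic_right[OF c(2), of u] homotopic_left[OF walk_inverse_append_self, of
        "u @ c" u] homotopic_trans
    by fastforce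
  obtain F where F: "walk_frame f u F" using frame_ex by blast
  obtain U where U: "same_diagonal u F c U" using turning_same_diagonal c F by blast
  have "walk_frame f (u @ c) (P ** F)"
    using T_bent_equivariant(4)[OF bent g P F] walk_frame_homotopic[OF h] by blast
  then obtain k where k: "cmod k = 1" "P ** F = mat k ** (F ** U)"
    using U[unfolded same_diagonal_def] walk_frame_unique by blast
  have "cmod ` eigenvalues P = cmod ` eigenvalues U"
    using eigenvalues_conjugate[OF walk_frame_U21[OF F] k(2,1)] .
  also have "\<dots> = cmod ` eigenvalues (holonomy t u c)"
    using U by (simp add: same_diagonal_def eigenvalues_upper_triangular image_image)
  also have "\<dots> = cmod ` eigenvalues Q"
  proof (rule eigenvalues_conjugate[symmetric])
    show "holonomy t [] u \<in> carrier U21" by (rule holonomy_U21[OF shear_shear_of])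
    show "Q ** holonomy t [] u = mat 1 ** (holonomy t [] u ** holonomy t u c)"
      using holonomy_homotopic[OF shear_shear_of h, of "[]"] fuchs.holonomy_closed_append[OF g, of u]
      by (simp add: Q_def holonomy_append[of t "[]" u c])
  qed simp
  finally have "spectral_radius P = spectral_radius Q" by (simp add: spectral_radius_eq)
  then show ?thesis
    unfolding P'(2) Q_def[symmetric] translation_length_proj_class[OF P'(1)]
        translation_length_proj_class[OF QU] by simp
qed

end

section \<open>Fixed points of real isometries\<close>

text \<open>Otherwise there would be a negative definite plane. It would contain a vector with third
  coordinate 0, on which the form is a squared modulus.\<close>

lemma negative_not_orthogonal:
  assumes u: "Re (herm u u) < 0" and v: "Re (herm v v) < 0" shows "herm u v \<noteq> 0"
proof
  assume uv: "herm u v = 0"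
  then have vu: "herm v u = 0" using herm_commute[of v u] by simp
  have "u $ 3 \<noteq> 0"
  proof
    assume "u $ 3 = 0"
    then have "Re (herm u u) \<ge> 0" by (simp add: herm_def)
    then show False using u by simp
  qed
  define c where "c = v$3 / u$3"
  define w where "w = v - c *s u"
  have "w $ 3 = 0" using \<open>u $ 3 \<noteq> 0\<close> by (simp add: w_def c_def)
  then have "Re (herm w w) \<ge> 0" by (simp add: herm_def)
  moreover have "herm w w = herm v v + (c * cnj c) * herm u u"
    by (simp add: w_def herm_diff_left herm_diff_right herm_smult_left herm_smult_right uv vu)
  then have "Re (herm w w) = Re (herm v v) + (cmod c)^2 * Re (herm u u)"
    by (simp add: complex_norm_square[symmetric] flip: of_real_power)
  moreover have "(cmod c)^2 * Re (herm u u) \<le> 0" using u by (simp add: mult_nonneg_nonpos)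
  ultimately show False using v by linarith
qed

lemma connected_positive:
  fixes h :: "'a::topological_space \<Rightarrow> real"
  assumes "connected C" "continuous_on C h" "\<And>x. x \<in> C \<Longrightarrow> h x \<noteq> 0" "x \<in> C" "h x > 0" "y \<in> C"
  shows "h y > 0"
proof (rule ccontr)
  assume "\<not> h y > 0"
  then have "h y < 0" using assms(3,6) by (meson linorder_cases)
  have "connected (h ` C)" using assms by (intro connected_continuous_image)
  then have "{h y..h x} \<subseteq> h ` C" using assms by (intro connected_contains_Icc) auto
  then have "0 \<in> h ` C" using \<open>h y < 0\<close> assms(5) by auto
  then show False using assms(3) by auto
qed

text \<open>On a connected set of real isometries, the determinant and the product of
  \<open>u\<close> with its image are real, continuous and never zero, so they keep the sign they
  have at the identity. The second one expresses preservation of the time orientation.\<close>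

lemma SO_compD:
  assumes "A \<in> SO_comp"
  shows "A \<in> real_O21" "det A = 1" "u \<in> real_vectors \<Longrightarrow> Re (herm u u) < 0 \<Longrightarrow> Re (herm (A *v u) u) < 0"
proof -
  obtain C where C: "connected C" "C \<subseteq> real_O21" "mat 1 \<in> C" "A \<in> C"
    using assms by (auto simp: connected_component_def)
  then show R: "A \<in> real_O21" by blast
  have detR: "det M \<in> \<real>" if "M \<in> real_O21" for M
    using that by (simp add: real_O21_def det_3)
  have detU: "cmod (det M) = 1" if "M \<in> carrier U21" for M
  proof -
    have "conj_transpose M ** herm_matrix ** M = herm_matrix" using that by (simp add: U21_def)
    then have "det (conj_transpose M) * det herm_matrix * det M = det herm_matrix" by (metis det_mul)
    moreover have "det herm_matrix = -1" by (simp add: det_3 herm_matrix_eq)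
    moreover have "det (conj_transpose M) = cnj (det M)"
        by (simp add: det_3 conj_transpose_def algebra_simps)
    ultimately have "det M * cnj (det M) = 1" by (simp add: mult.commute)
    then have "of_real ((cmod (det M))^2) = (1 :: complex)" using complex_norm_square[of "det M"]
        by simp
    then have "(cmod (det M))^2 = 1" by (metis of_real_eq_1_iff)
    then show ?thesis using norm_ge_zero[of "det M"] by (simp add: power2_eq_1_iff)
  qed
  have "Re (det A) > 0"
  proof (rule connected_positive[OF C(1) _ _ C(3) _ C(4)])
    show "continuous_on C (\<lambda>M. Re (det M))" unfolding det_3 by (intro continuous_intros)
    fix M assume "M \<in> C"
    then have "det M \<in> \<real>" "cmod (det M) = 1" using C(2) detR detU by (auto simp: real_O21_def)
    then show "Re (det M) \<noteq> 0" by (auto elim!: Reals_cases)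
  qed simp
  moreover have "cmod (det A) = 1" using detU R by (simp add: real_O21_def)
  moreover obtain r where "det A = of_real r" using detR[OF R] by (auto elim: Reals_cases)
  ultimately show "det A = 1" by simp
  assume u: "u \<in> real_vectors" "Re (herm u u) < 0"
  have "- Re (herm (A *v u) u) > 0"
  proof (rule connected_positive[OF C(1) _ _ C(3) _ C(4)])
    show "continuous_on C (\<lambda>M. - Re (herm (M *v u) u))"
      unfolding herm_def matrix_vector_nth_3 by (intro continuous_intros)
    fix M assume "M \<in> C"
    then have M: "M \<in> real_O21" using C(2) by blast
    then have "M *v u \<in> real_vectors" using real_matrix_vector u by blast
    then have "herm (M *v u) u \<in> \<real>" using u totally_real_real_vectors by (auto simp: totally_real_def)
    moreover have "herm (M *v u) u \<noteq> 0"
      using M u by (intro negative_not_orthogonal) (simp_all add: real_O21_def U21_herm)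
    ultimately show "- Re (herm (M *v u) u) \<noteq> 0" by (auto elim!: Reals_cases)
  qed (use u in simp)
  then show "Re (herm (A *v u) u) < 0" by simp
qed

text \<open>Products with \<open>v\<close>, \<open>w\<close>, \<open>x\<close> recover the
  coefficients of a combination; \<open>x\<close> is not null, since it would otherwise be a
  multiple of \<open>v\<close>.\<close>

lemma null_pair_basis:
  assumes n: "herm v v = 0" "herm w w = 0" "herm v w \<noteq> 0" "herm x v = 0" "herm x w = 0" "x \<noteq> 0"
  shows "det (transpose (vector [v, w, x]) :: complex^3^3) \<noteq> 0" "\<exists>a b c. y = a *s v + b *s w + c *s x"
proof -
  define A :: "complex^3^3" where "A = transpose (vector [v, w, x])"
  have A: "A *v z = z$1 *s v + z$2 *s w + z$3 *s x" for z
    by (simp add: A_def vec_eq_iff_3 matrix_vector_nth_3 transpose_def mult.commute)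
  have wv: "herm w v \<noteq> 0" using n(3) herm_commute[of w v] by simp
  have vx: "herm v x = 0" "herm w x = 0" using n herm_commute[of v x] herm_commute[of w x] by simp_all
  have xx: "herm x x \<noteq> 0"
  proof
    assume "herm x x = 0"
    moreover have "v \<noteq> 0" using n(3) by auto
    ultimately obtain k where k: "x = k *s v" using null_orthogonal_imp_parallel[OF n(1), of x] vx
        by blast
    then have "k * herm v w = 0" using n(5) by (simp add: herm_smult_left)
    then show False using n(3,6) k by simp
  qed
  have inj: "z = 0" if "A *v z = 0" for z
  proof -
    have "herm (A *v z) v = 0" "herm (A *v z) w = 0" "herm (A *v z) x = 0" using that by simp_all
    then have "z$1 = 0" "z$2 = 0" "z$3 = 0"
      using wv xx n vx unfolding A by (simp_all add: herm_add_left herm_smult_left)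
    then show ?thesis by (simp add: vec_eq_iff_3)
  qed
  then have inv: "invertible A" by (simp add: invertible_left_inverse matrix_left_invertible_ker)
  then show "det (transpose (vector [v, w, x]) :: complex^3^3) \<noteq> 0"
      by (simp add: invertible_det_nz A_def)
  obtain B where "A ** B = mat 1" using inv by (auto simp: invertible_def)
  then have "y = A *v (B *v y)" by (simp add: matrix_vector_mul_assoc)
  then show "\<exists>a b c. y = a *s v + b *s w + c *s x" unfolding A by blast
qed

definition cnj_vec :: "complex^3 \<Rightarrow> complex^3" where
  "cnj_vec x = vec3 (cnj (x$1)) (cnj (x$2)) (cnj (x$3))"

lemma herm_cnj_vec: "herm (cnj_vec x) (cnj_vec y) = cnj (herm x y)"
  by (simp add: herm_def cnj_vec_def)

lemma cnj_vec_smult: "cnj_vec (c *s x) = cnj c *s cnj_vec x"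
  by (simp add: vec_eq_iff_3 cnj_vec_def)

lemma cnj_vec_real: "x \<in> real_vectors \<Longrightarrow> cnj_vec x = x"
  by (simp add: vec_eq_iff_3 cnj_vec_def real_vectors_iff Reals_cnj_iff)

lemma cnj_vec_matrix: "A \<in> real_O21 \<Longrightarrow> A *v cnj_vec x = cnj_vec (A *v x)"
  by (simp add: vec_eq_iff_3 cnj_vec_def matrix_vector_nth_3 real_O21_def Reals_cnj_iff[THEN iffD1])

text \<open>On a line equal to its conjugate, scaling one coordinate to 1 makes the others
  real.\<close>

lemma parallel_cnj_vec_real:
  assumes "v \<noteq> 0" "cnj_vec v = c *s v"
  shows "\<exists>w\<in>real_vectors. w \<noteq> 0 \<and> cline v = cline w"
proof -
  have e: "cnj (v$i) = c * v$i" for i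
    using assms(2) exhaust_3[of i] by (auto simp: vec_eq_iff_3 cnj_vec_def)
  obtain i where i: "v $ i \<noteq> 0" using assms(1) by (auto simp: vec_eq_iff)
  have c: "c \<noteq> 0" using e[of i] i by auto
  define w where "w = (1 / v$i) *s v"
  have "cnj (w $ j) = w $ j" for j using i c by (simp add: w_def e)
  then have "w \<in> real_vectors" by (simp add: real_vectors_def Reals_cnj_iff)
  moreover have "cline w = cline v" unfolding w_def using i by (intro cline_smult) simp
  moreover have "w \<noteq> 0" using i assms(1) by (simp add: w_def)
  ultimately show ?thesis by metis
qed

text \<open>A non-real fixed point comes with its complex conjugate. Both eigenvalues are then equal to \<open>1\<close>
  or to \<open>-1\<close>; the first is excluded by the determinant, the second one by the time orientation.\<close>

lemma SO_comp_fixed_point_real: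
  assumes A: "A \<in> SO_comp" "A \<noteq> mat 1" and v: "v \<noteq> 0" "herm v v = 0" "A *v v = m *s v"
  shows "\<exists>w\<in>real_vectors. w \<noteq> 0 \<and> cline v = cline w"
proof (cases "herm v (cnj_vec v) = 0")
  case True
  have "herm (cnj_vec v) (cnj_vec v) = 0" using v by (simp add: herm_cnj_vec)
  then show ?thesis using null_orthogonal_imp_parallel[OF v(2,1) _ True] parallel_cnj_vec_real v
      by blast
next
  case h: False
  note D = SO_compD[OF A(1)]
  have U: "A \<in> carrier U21" using D by (simp add: real_O21_def)
  define v' where "v' = cnj_vec v"
  have v': "herm v' v' = 0" "A *v v' = cnj m *s v'"
    using v cnj_vec_matrix[OF D(1), of v] by (simp_all add: v'_def herm_cnj_vec cnj_vec_smult)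
  \<comment> \<open>The conjugate vector has the eigenvalue \<open>cnj m\<close>, which is
    conjugated again in the second argument of the form.\<close>
  have "herm v v' = m * m * herm v v'"
    using U21_herm[OF U, of v v'] by (simp add: v v' herm_smult_left herm_smult_right)
  then have "m * m = 1" using h by (simp add: v'_def)
  then consider "m = 1" | "m = -1" by (metis power2_eq_1_iff power2_eq_square)
  then show ?thesis
  proof cases
    case 2
    define h' where "h' = herm v v'"
    \<comment> \<open>With this square root, \<open>u\<close> is a real vector with herm u u = -2 *
      (cmod h')^2. Being reversed by \<open>A\<close>, it contradicts the time orientation.\<close>
    define a where "a = csqrt (- cnj h')"
    define u where "u = a *s v + cnj a *s v'"
    have aa: "a * a = - cnj h'" using power2_csqrt[of "- cnj h'"] by (simp add: a_def power2_eq_square)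
    have "herm v' v = cnj h'" using herm_commute[of v' v] by (simp add: h'_def)
    then have "herm u u = (a * a) * h' + cnj ((a * a) * h')"
      by (simp add: u_def herm_add_left herm_add_right herm_smult_left herm_smult_right v v' h'_def)
    then have "Re (herm u u) = 2 * Re (- (h' * cnj h'))" unfolding aa by (simp add: mult.commute)
    also have "\<dots> < 0" using h by (simp add: h'_def v'_def complex_mult_cnj complex_neq_0)
    finally have neg: "Re (herm u u) < 0" .
    have "u \<in> real_vectors"
      by (simp add: real_vectors_iff u_def v'_def cnj_vec_def Reals_cnj_iff add.commute)
    then have "Re (herm (A *v u) u) < 0" using D(3) neg by blast
    moreover have "A *v u = (-1) *s u"
      by (simp add: u_def matrix_vector_right_distrib matrix_vector_mult_smult v v' 2 vector_smult_assoc
          vec_eq_iff_3)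
    then have "herm (A *v u) u = - herm u u" by (simp only: herm_smult_left) simp
    ultimately show ?thesis using neg by simp
  next
    case 1
    obtain x where x: "A *v x \<noteq> x" using A(2) by (metis matrix_eq matrix_vector_mul_lid)
    \<comment> \<open>The displacement of a moved vector is orthogonal to the fixed vectors
      \<open>v\<close> and \<open>v'\<close>. It is then an eigenvector, its eigenvalue is the
      determinant 1, and \<open>A\<close> fixes a basis.\<close>
    define n where "n = A *v x - x"
    have n0: "n \<noteq> 0" using x by (simp add: n_def)
    have Av: "A *v v = v" "A *v v' = v'" using v v' 1 by simp_all
    have n: "herm n v = 0" "herm n v' = 0"
      using U21_herm[OF U, of x v] U21_herm[OF U, of x v'] by (simp_all add: n_def herm_diff_left Av)
    have hv: "herm v v' \<noteq> 0" using h by (simp add: v'_def)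
    have hv': "herm v' v \<noteq> 0" using hv herm_commute[of v' v] by simp
    note basis = null_pair_basis[OF v(2) v'(1) hv n n0]
    obtain a b c where An: "A *v n = a *s v + b *s v' + c *s n" using basis(2) by blast
    have "herm (A *v n) v = 0" "herm (A *v n) v' = 0"
      using U21_herm[OF U, of n v] U21_herm[OF U, of n v'] n by (simp_all add: Av)
    then have "a = 0" "b = 0"
      unfolding An using hv hv' v v' n by (simp_all add: herm_add_left herm_smult_left)
    then have An': "A *v n = c *s n" using An by simp
    define P :: "complex^3^3" where "P = transpose (vector [v, v', n])"
    have "A ** P = transpose (vector [v, v', c *s n])"
      using Av An' by (simp add: mat_eq_iff_3 vec_eq_iff_3 matrix_mult_nth_3 matrix_vector_nth_3
          P_def transpose_def)
    then have "det A * det P = det (transpose (vector [v, v', c *s n]) :: complex^3^3)"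
        by (metis det_mul)
    also have "\<dots> = c * det P" by (simp add: P_def det_3 transpose_def algebra_simps)
    finally have "c = 1" using D(2) basis(1) by (simp add: P_def)
    obtain a' b' c' where "x = a' *s v + b' *s v' + c' *s n" using basis(2) by blast
    then have "A *v x = x"
      by (simp add: matrix_vector_right_distrib matrix_vector_mult_smult Av An' \<open>c = 1\<close>)
    then show ?thesis using x by blast
  qed
qed

section \<open>Uniqueness\<close>

text \<open>The turn acts as z -> \<sigma>^2 * z + \<sigma> * \<tau>, so \<sigma> * (\<tau> -
  \<sigma>) is the image of the vertex -1. One turn moves it to 0, a second one to
  \<open>t u\<close>, and further turns never bring it below that.\<close>

lemma holonomy_turn:
  assumes "shear t"
  shows "\<exists>\<sigma> \<tau>. \<sigma> > 0 \<and> \<tau> \<ge> 0 \<and> (n \<ge> 1 \<longrightarrow> \<tau> > 0 \<and> \<sigma> * (\<tau> - \<sigma>) \<ge> 0) \<and> (n \<ge> 2 \<longrightarrow> \<sigma> * (\<tau> - \<sigma>) \<ge> t u) \<and>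
    \<sigma> * (\<tau> - \<sigma>) \<ge> -1 \<and> holonomy t u (turn n) = mat ((-1)^n) ** sym2 \<sigma> \<tau> 0 (1 / \<sigma>)"
proof (induction n arbitrary: u)
  case 0
  show ?case by (rule exI[of _ 1], rule exI[of _ 0]) (simp add: sym2_one)
next
  case (Suc n)
  obtain \<sigma> \<tau> where st: "\<sigma> > 0" "\<tau> \<ge> 0" "n \<ge> 1 \<longrightarrow> \<tau> > 0 \<and> \<sigma> * (\<tau> - \<sigma>) \<ge> 0" "\<sigma> * (\<tau> - \<sigma>) \<ge> -1"
    "holonomy t (u @ [Opp, Nxt]) (turn n) = mat ((-1)^n) ** sym2 \<sigma> \<tau> 0 (1 / \<sigma>)"
    using Suc.IH by blast
  define s where "s = sqrt (t u)"
  have t: "t u > 0" using assms by (simp add: shear_def)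
  then have s: "s > 0" "t u = s^2" by (simp_all add: s_def)
  have "holonomy t u (turn (Suc n)) = (bend (s^2) 1 ** rot) ** holonomy t (u @ [Opp, Nxt]) (turn n)"
    by (simp add: s(2)[symmetric] matrix_mul_assoc)
  also have "\<dots> = mat ((-1)^Suc n) ** sym2 (s * \<sigma>) (s * \<tau> + s / \<sigma>) 0 (1 / (s * \<sigma>))"
    unfolding st(5) bend_rot[OF s(1)] mat_mult_mult sym2_mult by simp
  finally have hol: "holonomy t u (turn (Suc n)) = \<dots>" .
  \<comment> \<open>The new image of -1 is the previous one transformed by z -> t u * (z +
    1).\<close>
  have key: "(s * \<sigma>) * ((s * \<tau> + s / \<sigma>) - s * \<sigma>) = t u * (\<sigma> * (\<tau> - \<sigma>) + 1)"
    using st(1) by (simp add: s(2) power2_eq_square field_simps)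
  have "s * \<tau> + s / \<sigma> > 0" using st s by (simp add: add_nonneg_pos)
  moreover have "t u * (\<sigma> * (\<tau> - \<sigma>) + 1) \<ge> 0" using st(4) t by simp
  moreover have "t u * (\<sigma> * (\<tau> - \<sigma>) + 1) \<ge> t u" if "Suc n \<ge> 2"
    using st(3) that t by simp
  ultimately show ?case unfolding hol
    by (intro exI[of _ "s * \<sigma>"] exI[of _ "s * \<tau> + s / \<sigma>"]) (use st(1) s key in auto)
qed

text \<open>Detected by the holonomy with all parameters 1, whose upper right entry is non-zero
  after at least one turn.\<close>

lemma turn_not_trivial:
  assumes "n \<ge> 1" shows "\<not> walk_homotopic (turn n) []"
proof
  assume h: "walk_homotopic (turn n) []"
  have sh: "shear (\<lambda>_. 1)" by (simp add: shear_def)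
  obtain \<sigma> \<tau> where st: "\<sigma> > 0" "\<tau> > 0" "holonomy (\<lambda>_. 1) [] (turn n)
      = mat ((-1)^n) ** sym2 \<sigma> \<tau> 0 (1 / \<sigma>)"
    using holonomy_turn[OF sh, of n "[]"] assms by blast
  have "mat ((-1)^n) ** sym2 \<sigma> \<tau> 0 (1 / \<sigma>) = mat 1"
    using holonomy_homotopic[OF sh h, of "[]"] st(3) by simp
  then have "(mat ((-1)^n) ** sym2 \<sigma> \<tau> 0 (1 / \<sigma>)) $ 1 $ 2 = (mat 1 :: complex^3^3) $ 1 $ 2" by simp
  moreover have "(mat 1 :: complex^3^3) $ 1 $ 2 = 0" by (simp add: mat_def)
  ultimately show False using st(1,2) by (simp add: mat_mult_nth sym2_nth)
qed

text \<open>The fixed points of the holonomy of a turn, in the frame in which the turn fixes \<open>\<infinity>\<close> and the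
  two neighbouring vertices are \<open>-1\<close> and \<open>t\<close>: the other fixed point is not between \<open>-1\<close> and \<open>t\<close>.\<close>

lemma turn_fixed_point:
  assumes st: "\<sigma> > 0" "\<tau> > 0" "\<sigma> * (\<tau> - \<sigma>) \<ge> t" "t > 0"
    and x: "x \<noteq> 0" "herm x x = 0" "sym2 \<sigma> \<tau> 0 (1 / \<sigma>) *v x = l *s x"
  shows "\<exists>(a::real) (b::real). (a, b) \<noteq> (0, 0) \<and> cline x = cline (pvec a b) \<and> (a + b) * (a - t * b) \<ge> 0"
proof (cases "x $ 3 = 0")
  case True
  then have "x $ 2 = 0" using null_orth_3 x(2) by blast
  then have x1: "x = x$1 *s pvec 1 0" using True by (simp add: vec_eq_iff_3)
  then have "x$1 \<noteq> 0" using x(1) by auto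
  then have "cline x = cline (pvec 1 0)" using x1 cline_smult by metis
  then show ?thesis by (intro exI[of _ 1] exI[of _ 0]) simp
next
  case False
  let ?A = "sym2 \<sigma> \<tau> 0 (1 / \<sigma>)"
  have "(?A *v x) $ 3 = l * x$3" using x(3) by simp
  then have "l * x$3 = of_real (1 / \<sigma>^2) * x$3" by (simp add: matrix_vector_nth_3 sym2_nth power_divide)
  then have l: "l = of_real (1 / \<sigma>^2)" using False mult_right_cancel by blast
  have r2: "x$2 - rt2 * of_real (\<tau> / \<sigma>) * x$3 = of_real (1 / \<sigma>^2) * x$2"
    using arg_cong[OF x(3), of "\<lambda>v. v $ 2"] st(1) by (simp add: matrix_vector_nth_3 sym2_nth l)
  \<comment> \<open>For \<sigma> = 1 the map is a translation, with \<infinity> as its only fixed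
    point.\<close>
  have s1: "\<sigma> \<noteq> 1"
  proof
    assume "\<sigma> = 1"
    then have "rt2 * of_real \<tau> * x$3 = 0" using r2 by simp
    then show False using st(2) False by simp
  qed
  then have s2: "\<sigma>^2 \<noteq> 1" "\<sigma>^2 > 0" using st(1) by (auto simp: power2_eq_1_iff)
  \<comment> \<open>The finite fixed point of z -> \<sigma>^2 * z + \<sigma> * \<tau>.\<close>
  define \<xi> where "\<xi> = - (\<tau> * \<sigma>) / (\<sigma>^2 - 1)"
  have xi: "\<xi> = \<sigma>^2 * \<xi> + \<sigma> * \<tau>" using s2 by (simp add: \<xi>_def field_simps)
  have xi': "\<sigma> * \<xi> + \<tau> = \<xi> / \<sigma>"
  proof -
    have "\<sigma> * (\<sigma> * \<xi> + \<tau>) = \<xi>" using xi by (simp add: power2_eq_square algebra_simps)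
    then show ?thesis using st(1) by (simp add: field_simps)
  qed
  have ev: "?A *v pvec \<xi> 1 = l *s pvec \<xi> 1"
  proof -
    have "?A *v pvec \<xi> 1 = pvec (of_real (1 / \<sigma>) * of_real \<xi>) (of_real (1 / \<sigma>) * 1)"
      unfolding sym2_pvec using xi' by (simp flip: of_real_mult of_real_add)
    also have "\<dots> = l *s pvec \<xi> 1" unfolding pvec_smult by (simp add: l power_divide)
    finally show ?thesis .
  qed
  \<comment> \<open>An eigenvector for the same \<open>l\<close> with third coordinate 0. The other
    diagonal entries 1 and \<sigma>^2 differ from l = 1/\<sigma>^2, so it vanishes.\<close>
  define y where "y = x + x$3 *s pvec \<xi> 1"
  have yA: "?A *v y = l *s y"
    by (simp add: y_def matrix_vector_right_distrib matrix_vector_mult_smult x(3) ev vec_eq_iff_3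
        algebra_simps)
  have y3: "y $ 3 = 0" by (simp add: y_def)
  have "of_real (1 - 1 / \<sigma>^2) * y$2 = 0"
    using arg_cong[OF yA, of "\<lambda>v. v $ 2"] st(1)
        by (simp add: matrix_vector_nth_3 sym2_nth l y3 algebra_simps)
  then have y2: "y $ 2 = 0" using s2 by (simp add: field_simps del: of_real_diff)
  have "of_real (\<sigma>^2 - 1 / \<sigma>^2) * y$1 = 0"
    using arg_cong[OF yA, of "\<lambda>v. v $ 1"] st(1)
        by (simp add: matrix_vector_nth_3 sym2_nth l y2 y3 algebra_simps)
  moreover have "\<sigma>^2 - 1 / \<sigma>^2 \<noteq> 0"
  proof
    assume "\<sigma>^2 - 1 / \<sigma>^2 = 0"
    then have "\<sigma>^2 * \<sigma>^2 = 1" using s2 by (simp add: field_simps)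
    then show False using s2 by (metis (no_types, lifting) abs_of_pos power2_eq_1_iff
        power2_eq_square abs_minus_cancel abs_1)
  qed
  ultimately have "y $ 1 = 0" by (simp del: of_real_diff)
  then have "y = 0" using y2 y3 by (simp add: vec_eq_iff_3)
  then have "x = (- x$3) *s pvec \<xi> 1" by (simp add: y_def vec_eq_iff_3 eq_neg_iff_add_eq_0)
  then have "cline x = cline ((- x$3) *s pvec \<xi> 1)" by (rule arg_cong)
  also have "\<dots> = cline (pvec \<xi> 1)" using False by (intro cline_smult) simp
  finally have "cline x = cline (pvec \<xi> 1)" .
  \<comment> \<open>The map is increasing: if \<xi> > -1, then \<xi>, being its own image, exceeds
    the image \<sigma> * (\<tau> - \<sigma>) \<ge> t of -1.\<close>
  moreover have "(\<xi> + 1) * (\<xi> - t) \<ge> 0"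
  proof (cases "\<xi> > -1")
    case True
    then have "\<sigma>^2 * (\<xi> + 1) > 0" using s2 by simp
    then have "\<xi> > \<sigma> * (\<tau> - \<sigma>)" using xi by (simp add: power2_eq_square algebra_simps)
    then show ?thesis using True st(3) by simp
  next
    case False
    then show ?thesis using st(4) by (simp add: mult_nonpos_nonpos)
  qed
  ultimately show ?thesis by (rule_tac exI[of _ \<xi>], rule_tac exI[of _ 1]) simp
qed

context triangulated
begin

definition vertex_loop :: "walk \<Rightarrow> nat \<Rightarrow> walk" where
  "vertex_loop w n = w @ turn n @ walk_inverse w"

lemma vertex_loop_homotopic: "walk_homotopic (vertex_loop w n @ w) (w @ turn n)"
  using homotopic_left[OF walk_inverse_append_self, of "w @ turn n" w] by (simp add: vertex_loop_def)

lemma vertex_loop_closed: "\<exists>n\<ge>2. closed_walk (vertex_loop w n)"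
proof -
  have d: "walk_end T w d0 \<in> darts T" using walk_end_darts base by blast
  obtain n where "n \<ge> 2" "walk_end T (turn n) (walk_end T w d0) = walk_end T w d0"
    using turn_period[OF d] by blast
  then show ?thesis using walk_end_inverse[OF base, of w]
    by (intro exI[of _ n]) (simp add: vertex_loop_def walk_end_append)
qed

lemma vertex_loop_not_trivial: "n \<ge> 1 \<Longrightarrow> \<not> walk_homotopic (vertex_loop w n) []"
proof
  assume n: "n \<ge> 1" and h: "walk_homotopic (vertex_loop w n) []"
  have "walk_homotopic (w @ turn n) (w @ [])"
    using homotopic_trans[OF homotopic_sym[OF vertex_loop_homotopic] homotopic_right[OF h, of w]]
        by simp
  then show False using homotopic_cancel_left turn_not_trivial n by blast
qed

end

lemma cline_pvec_real_eq:
  assumes F: "F \<in> carrier U21" and eq: "cline (F *v pvec (of_real a) (of_real b))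
      = cline (F *v pvec (of_real c) (of_real d))"
  shows "a * d = b * c"
proof -
  have "cline (pvec (of_real a) (of_real b)) = cline (pvec (of_real c) (of_real d))"
    by (rule cline_U21_cancel[OF F eq])
  then obtain k where "pvec (of_real a) (of_real b) = k *s pvec (of_real c) (of_real d)"
      using cline_eqD by blast
  then have "herm (pvec (of_real a) (of_real b)) (pvec (of_real c) (of_real d)) = 0"
    by (simp add: herm_smult_left herm_pvec)
  then have "(of_real (a * d - b * c) :: complex)^2 = 0" by (simp add: herm_pvec)
  then have "a * d - b * c = 0" by (metis of_real_eq_0_iff power_eq_0_iff)
  then show ?thesis by simp
qed

text \<open>Here \<phi> is the developing framing provided by \<open>hyperbolic_holonomy\<close>,
  which may differ from the framing that comes with the representation.\<close>

locale hyperbolic_bent = bent +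
  assumes PO21: "\<rho> ` carrier (fund_group T d0) \<subseteq> PO21"
    and faithful: "inj_on \<rho> (carrier (fund_group T d0))"
    and disjoint: "lift_triangle (walk_class u) \<noteq> lift_triangle (walk_class v)
      \<Longrightarrow> walk_triangle (walk_framing \<phi>) u \<inter> walk_triangle (walk_framing \<phi>) v = {}"
begin

lemma rep_trivial: "\<rho> (walk_class []) = proj_class (mat 1)"
proof -
  obtain P where P: "P \<in> \<rho> (walk_class [])" using lift_ex[of "[]"] by auto
  note P' = T_bent_equivariant[OF bent _ P, simplified]
  obtain F where F: "walk_frame f [] F" using frame_ex by blast
  then have "walk_frame f [] (P ** F)" using P'(4)[of "[]" F] by simp
  then obtain c where c: "cmod c = 1" "P ** F = mat c ** F" using walk_frame_unique F by blast
  have FU: "F \<in> carrier U21" using F walk_frame_U21 by blast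
  have "P = (P ** F) ** matrix_inv F" by (simp add: matrix_mul_assoc[symmetric] U21_matrix_inv[OF FU])
  also have "\<dots> = mat c ** mat 1" unfolding c(2)
      by (simp add: matrix_mul_assoc[symmetric] U21_matrix_inv[OF FU])
  finally show ?thesis using P'(2) proj_class_unit[OF c(1)] by metis
qed

text \<open>The value is fixed by the image of a loop around the vertex. By faithfulness this image
  is not the identity, so \<open>SO_comp_fixed_point_real\<close> applies.\<close>

lemma framing_real: "\<exists>x\<in>real_vectors. x \<noteq> 0 \<and> f w = cline x"
proof -
  obtain n where n: "n \<ge> 2" "closed_walk (vertex_loop w n)" using vertex_loop_closed by blast
  let ?g = "vertex_loop w n"
  have mem: "walk_class ?g \<in> carrier (fund_group T d0)" "walk_class [] \<in> carrier (fund_group T d0)"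
    using n(2) unfolding carrier_fund_group by auto
  then obtain P where P: "P \<in> SO_comp" "\<rho> (walk_class ?g) = proj_class P"
    using PO21 unfolding PO21_def proj_class_coset by blast
  have "walk_class ?g \<noteq> walk_class []" using vertex_loop_not_trivial n(1) walk_class_eq_iff by simp
  then have "\<rho> (walk_class ?g) \<noteq> \<rho> (walk_class [])" using faithful mem by (meson inj_onD)
  then have "P \<noteq> mat 1" using P rep_trivial by metis
  have Pm: "P \<in> \<rho> (walk_class ?g)" unfolding P(2) by (rule proj_class_self)
  obtain F where F: "walk_frame f w F" using frame_ex by blast
  have U: "F \<in> carrier U21" using F walk_frame_U21 by blast
  define v where "v = F *v pvec 1 0"
  have v: "v \<noteq> 0" "herm v v = 0" "f w = cline v"
    using U F by (simp_all add: v_def U21_eq_0_iff pvec_eq_0_iff U21_herm herm_pvec walk_frame_def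
        frame_def)
  have "cline (P *v v) = f (?g @ w)"
    using T_bent_equivariant(3)[OF bent n(2) Pm, of w] by (simp add: v(3) cline_image)
  also have "\<dots> = cline v" using f_homotopic[OF vertex_loop_homotopic] f_turn_power v(3) by simp
  finally obtain m where "P *v v = m *s v" using cline_eqD by blast
  then show ?thesis using SO_comp_fixed_point_real[OF P(1) \<open>P \<noteq> mat 1\<close> v(1,2)] v(3) by metis
qed

text \<open>All four lifts can be taken real. Conjugation then only replaces the polar vector by its
  conjugate, which is another admissible choice.\<close>

lemma Z_real: "Z_walk f w \<in> \<real>"
proof -
  obtain F where F: "walk_frame f w F" using frame_ex by blast
  have U: "F \<in> carrier U21" using F walk_frame_U21 by blast
  obtain q1 where q1: "q1 \<in> real_vectors" "q1 \<noteq> 0" "f (w @ [Nxt]) = cline q1" using framing_real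
      by blast
  obtain q2 where q2: "q2 \<in> real_vectors" "q2 \<noteq> 0" "f (w @ [Nxt, Nxt]) = cline q2"
      using framing_real by blast
  obtain q3 where q3: "q3 \<in> real_vectors" "q3 \<noteq> 0" "f w = cline q3" using framing_real by blast
  obtain q4 where q4: "q4 \<in> real_vectors" "q4 \<noteq> 0" "f (w @ [Opp, Nxt, Nxt]) = cline q4"
      using framing_real by blast
  have fr: "cline q1 = cline (F *v pvec 0 1)" "cline q3 = cline (F *v pvec 1 0)"
    using F q1 q3 by (simp_all add: walk_frame_def frame_def)
  define v where "v = F *v vec3 0 1 0"
  have "vec3 0 1 0 \<noteq> 0" by (simp add: vec_eq_iff_3)
  then have v0: "v \<noteq> 0" using U by (simp add: v_def U21_eq_0_iff)
  have "q1 \<in> cline (F *v pvec 0 1)" "q3 \<in> cline (F *v pvec 1 0)" using cline_self fr by metis+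
  then obtain k1 k3 where "q1 = k1 *s (F *v pvec 0 1)" "q3 = k3 *s (F *v pvec 1 0)"
      by (auto simp: cline_def)
  then have v: "herm v q1 = 0" "herm v q3 = 0"
    unfolding v_def by (simp_all add: herm_smult_right U21_herm[OF U]) (simp_all add: herm_def)
  note c = cnj_vec_real[OF q1(1)] cnj_vec_real[OF q2(1)] cnj_vec_real[OF q3(1)] cnj_vec_real[OF q4(1)]
  have cv: "herm (cnj_vec v) q1 = 0" "herm (cnj_vec v) q3 = 0"
    using v herm_cnj_vec[of v q1] herm_cnj_vec[of v q3] by (simp_all add: c)
  have cv0: "cnj_vec v \<noteq> 0" using v0 by (auto simp: cnj_vec_def vec_eq_iff_3)
  have 1: "Z_walk f w = - (herm q4 v * herm q2 q1) / (herm q2 v * herm q4 q1)"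
    unfolding Z_walk_def q1 q2 q3 q4 by (rule Z_inv_eq[OF U fr q1(2) q2(2) q3(2) q4(2) v0 v])
  have 2: "Z_walk f w = - (herm q4 (cnj_vec v) * herm q2 q1) / (herm q2 (cnj_vec v) * herm q4 q1)"
    unfolding Z_walk_def q1 q2 q3 q4 by (rule Z_inv_eq[OF U fr q1(2) q2(2) q3(2) q4(2) cv0 cv])
  have 3: "herm q4 (cnj_vec v) = cnj (herm q4 v)" "herm q2 (cnj_vec v) = cnj (herm q2 v)"
    "cnj (herm q2 q1) = herm q2 q1" "cnj (herm q4 q1) = herm q4 q1"
    using herm_cnj_vec[of q4 v] herm_cnj_vec[of q2 v] herm_cnj_vec[of q2 q1] herm_cnj_vec[of q4 q1]
        by (simp_all add: c)
  have "cnj (Z_walk f w) = - (herm q4 (cnj_vec v) * herm q2 q1) / (herm q2 (cnj_vec v) * herm q4 q1)"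
    unfolding 1 by (simp add: 3)
  then have "cnj (Z_walk f w) = Z_walk f w" unfolding 2 .
  then show ?thesis by (metis Reals_cnj_iff)
qed

text \<open>The walks to the two triangles have different numbers of crossings modulo 2.\<close>

lemma lift_triangle_opp: "lift_triangle (walk_class w) \<noteq> lift_triangle (walk_class (w @ [Opp]))"
proof
  assume "lift_triangle (walk_class w) = lift_triangle (walk_class (w @ [Opp]))"
  then have "walk_class (w @ [Opp]) \<in> lift_triangle (walk_class w)"
      by (simp add: lift_triangle_walk_class)
  then have "walk_homotopic (w @ [Opp]) w \<or> walk_homotopic (w @ [Opp]) (w @ [Nxt])
      \<or> walk_homotopic (w @ [Opp]) (w @ [Nxt, Nxt])"
    by (simp add: lift_triangle_walk_class walk_class_eq_iff)
  then show False by (auto dest!: homotopic_parity)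
qed

sublocale unbent: unbent_framing f
proof
  fix w
  obtain F where F: "walk_frame f w F" using frame_ex by blast
  note o = walk_frame_opp[OF F]
  have "bending_of f w \<in> \<real>" using Z_real[of w] by (simp add: bending_of_def)
  then obtain y where y: "bending_of f w = of_real y" by (auto elim: Reals_cases)
  then have "y = 1 \<or> y = -1" using o(2) by auto
  moreover have "y \<noteq> -1"
  proof
    assume y1: "y = -1"
    define s where "s = t w"
    have s: "s > 0" using o(1) by (simp add: s_def)
    have fr: "walk_frame f (w @ [Opp]) (F ** bend s (-1))" using o(3) y y1 by (simp add: s_def)
    \<comment> \<open>With phase -1 the change of frame acts on the real boundary as z -> s/z. This
      folds the neighbour back onto the triangle; the reflection axis from -sqrt s to sqrt s enters
      the standard triangle, and this is one of its points there.\<close>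
    have "bend s (-1) *v triangle_point s (1 / s) 1 = (-1) *s triangle_point s (1 / s) 1"
      using s by (simp add: vec_eq_iff_3 matrix_vector_nth_3 bend_nth triangle_point_def field_simps)
    then have "(F ** bend s (-1)) *v triangle_point s (1 / s) 1
        = (-1) *s (F *v triangle_point s (1 / s) 1)"
      by (simp only: matrix_vector_mul_assoc[symmetric] matrix_vector_mult_smult)
    then have "cline ((F ** bend s (-1)) *v triangle_point s (1 / s) 1)
        = cline (F *v triangle_point s (1 / s) 1)"
      by (simp only:) (rule cline_smult, simp)
    moreover have "cline ((F ** bend s (-1)) *v triangle_point s (1 / s) 1)
        \<in> walk_triangle f (w @ [Opp])"
      unfolding walk_triangle_frame[OF fr] using s zero_less_one zero_less_divide_1_iff by blast
    moreover have "cline (F *v triangle_point s (1 / s) 1) \<in> walk_triangle f w"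
      unfolding walk_triangle_frame[OF F] using s zero_less_one zero_less_divide_1_iff by blast
    ultimately show False using disjoint[OF lift_triangle_opp[of w]] by auto
  qed
  ultimately show "bending_of f w = 1" using y by simp
qed

text \<open>Any other framing of the same representation sends a vertex to one of the fixed points of its
  stabiliser.\<close>

lemma other_framing_position:
  assumes \<phi>': "T_bent T d0 \<rho> \<phi>'" and F: "walk_frame f w F"
  shows "\<exists>(a::real) (b::real). (a, b) \<noteq> (0, 0) \<and> walk_framing \<phi>' w = cline (F *v pvec a b)
      \<and> (a + b) * (a - t w * b) \<ge> 0"
proof -
  interpret f': framing "walk_framing \<phi>'" by (rule framing_T_bent[OF \<phi>'])
  obtain n where n: "n \<ge> 2" "closed_walk (vertex_loop w n)" using vertex_loop_closed by blast
  let ?g = "vertex_loop w n"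
  obtain P where P: "P \<in> \<rho> (walk_class ?g)" using lift_ex n(2) by blast
  have U: "F \<in> carrier U21" using F walk_frame_U21 by blast
  have tw: "t w > 0" using walk_frame_opp(1)[OF F] .
  obtain \<sigma> \<tau> where st: "\<sigma> > 0" "\<tau> > 0" "\<sigma> * (\<tau> - \<sigma>) \<ge> t w"
    "holonomy t w (turn n) = mat ((-1)^n) ** sym2 \<sigma> \<tau> 0 (1 / \<sigma>)"
    using holonomy_turn[OF shear_shear_of, of n w] n(1) by auto
  have "walk_frame f (w @ turn n) (P ** F)"
    using T_bent_equivariant(4)[OF bent n(2) P F] walk_frame_homotopic[OF vertex_loop_homotopic]
        by blast
  then obtain k where k: "cmod k = 1" "P ** F = mat k ** (F ** (mat ((-1)^n) ** sym2 \<sigma> \<tau> 0 (1 / \<sigma>)))"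
    using walk_frame_unique unbent.walk_frame_holonomy[OF F, of "turn n"] unfolding st(4) by blast
  obtain F' where F': "walk_frame (walk_framing \<phi>') w F'" using f'.frame_ex by blast
  have U': "F' \<in> carrier U21" using F' f'.walk_frame_U21 by blast
  define q where "q = F' *v pvec 1 0"
  have q: "q \<noteq> 0" "herm q q = 0" "walk_framing \<phi>' w = cline q"
    using U' F' by (simp_all add: q_def U21_eq_0_iff pvec_eq_0_iff U21_herm herm_pvec walk_frame_def
        frame_def)
  have "cline (P *v q) = walk_framing \<phi>' (?g @ w)"
    using T_bent_equivariant(3)[OF \<phi>' n(2) P, of w] by (simp add: q(3) cline_image)
  also have "\<dots> = cline q" using f'.f_homotopic[OF vertex_loop_homotopic] f'.f_turn_power q(3) by simp
  finally obtain m where m: "P *v q = m *s q" using cline_eqD by blast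
  define x where "x = matrix_inv F *v q"
  have x: "q = F *v x" using U by (simp add: x_def matrix_vector_mul_assoc U21_matrix_inv)
  have x': "x \<noteq> 0" "herm x x = 0" using q(1,2) unfolding x U21_herm[OF U] by auto
  define e where "e = k * (-1)^n"
  have e0: "e \<noteq> 0" using k(1) by (auto simp: e_def)
  have "m *s (F *v x) = (P ** F) *v x" using m x by (simp add: matrix_vector_mul_assoc[symmetric])
  also have "\<dots> = e *s (F *v (sym2 \<sigma> \<tau> 0 (1 / \<sigma>) *v x))"
    unfolding k(2) e_def matrix_vector_mul_assoc[symmetric] mat_mult_vector matrix_vector_mult_smult
        vector_smult_assoc
    by (simp only: mult.commute)
  finally have "(1 / e) *s (e *s (F *v (sym2 \<sigma> \<tau> 0 (1 / \<sigma>) *v x))) = (1 / e) *s (m *s (F *v x))" by simp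
  then have "F *v (sym2 \<sigma> \<tau> 0 (1 / \<sigma>) *v x) = F *v ((m / e) *s x)"
    using e0 by (simp add: vector_smult_assoc matrix_vector_mult_smult)
  then have "sym2 \<sigma> \<tau> 0 (1 / \<sigma>) *v x = (m / e) *s x" by (rule U21_inj[OF U])
  then obtain a :: real and b :: real where ab: "(a, b) \<noteq> (0, 0)" "cline x = cline (pvec a b)"
      "(a + b) * (a - t w * b) \<ge> 0"
    using turn_fixed_point[OF st(1-3) tw x'] by blast
  have "cline q = cline (F *v pvec a b)" unfolding x using ab(2) by (metis cline_image)
  then show ?thesis using ab q(3) by metis
qed

text \<open>The same in the coordinates of a base frame: \<open>(p, q, r, s)\<close> is the holonomy from the base to
  the frame at the vertex.\<close>

lemma other_framing_position_from:
  assumes \<phi>': "T_bent T d0 \<rho> \<phi>'" and F: "walk_frame f w F"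
    and hol: "holonomy t w u = mat e ** sym2 p q r s" "cmod e = 1" "p * s - q * r = 1"
    and xy: "walk_framing \<phi>' (w @ u) = cline (F *v pvec (of_real x) (of_real y))"
  shows "((s * x - q * y) + (p * y - r * x)) * ((s * x - q * y) - t (w @ u) * (p * y - r * x)) \<ge> 0"
proof -
  have U: "F \<in> carrier U21" using F walk_frame_U21 by blast
  have e0: "e \<noteq> 0" using hol(2) by auto
  have "walk_frame f (w @ u) (F ** (mat e ** sym2 p q r s))"
    using unbent.walk_frame_holonomy[OF F, of u] hol(1) by simp
  from other_framing_position[OF \<phi>' this]
  obtain a :: real and b :: real where ab: "(a, b) \<noteq> (0, 0)"
    "walk_framing \<phi>' (w @ u) = cline ((F ** (mat e ** sym2 p q r s)) *v pvec a b)"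
    "(a + b) * (a - t (w @ u) * b) \<ge> 0" by blast
  have "(F ** (mat e ** sym2 p q r s)) *v pvec a b
      = e *s (F *v pvec (of_real (p * a + q * b)) (of_real (r * a + s * b)))"
    unfolding matrix_vector_mul_assoc[symmetric] mat_mult_vector sym2_pvec matrix_vector_mult_smult
        by simp
  then have "cline (F *v pvec (of_real x) (of_real y)) = cline (F *v pvec (of_real (p * a + q * b))
      (of_real (r * a + s * b)))"
    using ab(2) xy cline_smult[OF e0] by metis
  then have par: "x * (r * a + s * b) = y * (p * a + q * b)" by (rule cline_pvec_real_eq[OF U])
  define x' y' where "x' = s * x - q * y" and "y' = p * y - r * x"
  have "x' * b = y' * a" using par by (simp add: x'_def y'_def algebra_simps)
  then obtain k where k: "x' = k * a" "y' = k * b"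
  proof (cases "a = 0")
    case True
    then show ?thesis using that[of "y' / b"] ab(1) \<open>x' * b = y' * a\<close> by auto
  next
    case False
    then show ?thesis using that[of "x' / a"] \<open>x' * b = y' * a\<close> by (simp add: field_simps)
  qed
  have "(x' + y') * (x' - t (w @ u) * y') = k^2 * ((a + b) * (a - t (w @ u) * b))"
    by (simp add: k power2_eq_square algebra_simps)
  also have "\<dots> \<ge> 0" using ab(3) by simp
  finally show ?thesis unfolding x'_def y'_def .
qed

end

text \<open>\<open>b, a, d, x/y\<close> are new positions of the vertices \<open>-1, 0, t0, \<infinity>\<close> of a quadrilateral. The far
  vertices of the four adjacent triangles are \<open>-1 - 1/t2\<close>, \<open>-1/(1 + t1)\<close>, \<open>t0 * t4/(1 + t4)\<close> and
  \<open>t0 * (1 + t3)\<close>, and each vertex of the quadrilateral stays between two consecutive ones. The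
  coordinates \<open>x, y\<close> are homogeneous.\<close>

lemma interlaced:
  fixes a b d x y :: real
  assumes t: "t0 > 0" "t1 > 0" "t2 > 0" "t3 > 0" "t4 > 0"
    and a: "a * (1 + t1) + 1 \<ge> 0" "a * (1 + t4) - t4 * t0 \<le> 0"
    and b: "b * (1 + t1) + 1 \<le> 0" "b * (t2 * b + (1 + t2)) \<le> 0"
    and d: "d * (d - t0 * (1 + t3)) \<le> 0" "d * (1 + t4) - t4 * t0 \<ge> 0"
    and c: "(x + y) * (x - t0 * y) \<ge> 0" "x * (t2 * x + (1 + t2) * y) \<ge> 0"
        "x * (x - t0 * (1 + t3) * y) \<ge> 0"
  shows "b \<le> a" "a \<le> d" "(d * y - x) * (b * y - x) \<ge> 0"
proof -
  have "b * (1 + t1) \<le> a * (1 + t1)" using a b by linarith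
  then show ba: "b \<le> a" using t by (simp add: mult_le_cancel_right)
  have "a * (1 + t4) \<le> d * (1 + t4)" using a d by linarith
  then show ad: "a \<le> d" using t by (simp add: mult_le_cancel_right)
  show "(d * y - x) * (b * y - x) \<ge> 0"
  proof (cases "y = 0")
    case False
    define z where "z = x / y"
    have x: "x = z * y" using False by (simp add: z_def)
    have y2: "y * y > 0" using False by (simp add: zero_less_mult_iff) linarith
    have "y * y * ((z + 1) * (z - t0)) \<ge> 0" "y * y * (z * (t2 * z + (1 + t2))) \<ge> 0"
        "y * y * (z * (z - t0 * (1 + t3))) \<ge> 0"
      using c unfolding x by (simp_all only: algebra_simps)
    then have z: "(z + 1) * (z - t0) \<ge> 0" "z * (t2 * z + (1 + t2)) \<ge> 0" "z * (z - t0 * (1 + t3)) \<ge> 0"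
      using zero_le_mult_iff[of "y * y"] y2 by auto
    have S: "t0 * (1 + t3) > 0" using t by simp
    have dS: "d \<le> t0 * (1 + t3)"
    proof (rule ccontr)
      assume "\<not> d \<le> t0 * (1 + t3)"
      then have "d * (d - t0 * (1 + t3)) > 0" using S by (intro mult_pos_pos) linarith+
      then show False using d by linarith
    qed
    have b0: "b < 0"
    proof (rule ccontr)
      assume "\<not> b < 0"
      then have "b * (1 + t1) \<ge> 0" using t by simp
      then show False using b by linarith
    qed
    have bP: "t2 * b + (1 + t2) \<ge> 0"
    proof (rule ccontr)
      assume "\<not> t2 * b + (1 + t2) \<ge> 0"
      then have "b * (t2 * b + (1 + t2)) > 0" using b0 by (intro mult_neg_neg) linarith+
      then show False using b by linarith
    qed
    have "(d - z) * (b - z) \<ge> 0"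
    proof (cases "z > 0")
      case True
      then have "z \<ge> t0 * (1 + t3)" using z(3) by (simp add: zero_le_mult_iff)
      then have "d - z \<le> 0" "b - z \<le> 0" using dS b0 True by linarith+
      then show ?thesis by (rule mult_nonpos_nonpos)
    next
      case False
      have "z < 0"
      proof (rule ccontr)
        assume "\<not> z < 0"
        then have "z = 0" using False by simp
        then show False using z(1) t by simp
      qed
      then have "t2 * z + (1 + t2) \<le> 0" using z(2) by (simp add: zero_le_mult_iff)
      then have "t2 * z \<le> t2 * b" using bP by linarith
      then have "z \<le> b" using t by simp
      then show ?thesis using ba ad by simp
    qed
    then have "y * y * ((d - z) * (b - z)) \<ge> 0" using y2 by simp
    then show ?thesis by (simp add: x algebra_simps)
  qed simp
qed

context hyperbolic_bent
begin

text \<open>The opposite dart starts at the vertex 0 of the frame at \<open>w @ u\<close>. Seen from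
  that frame, the inequality for its origin is reversed: the new position of 0 lies between -1 and
  the parameter of the edge.\<close>

lemma other_framing_position_opp:
  assumes \<phi>': "T_bent T d0 \<rho> \<phi>'" and F: "walk_frame f w F"
    and hol: "holonomy t w u = mat e ** sym2 p q r s" "cmod e = 1" "p * s - q * r = 1"
    and xy: "walk_framing \<phi>' (w @ u @ [Opp]) = cline (F *v pvec (of_real x) (of_real y))"
  shows "((s * x - q * y) + (p * y - r * x)) * ((s * x - q * y) - t (w @ u) * (p * y - r * x)) \<le> 0"
proof -
  have tp: "t (w @ u) > 0" "t (w @ u @ [Opp]) = t (w @ u)"
    using shear_shear_of unfolding shear_def by (blast, metis append_assoc)
  define \<sigma> where "\<sigma> = sqrt (t (w @ u))"
  have \<sigma>: "\<sigma> > 0" "t (w @ u) = \<sigma>^2" using tp by (simp_all add: \<sigma>_def)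
  have "holonomy t w (u @ [Opp]) = (mat e ** sym2 p q r s) ** (mat (-1) ** sym2 0 \<sigma> (- 1 / \<sigma>) 0)"
    by (simp add: holonomy_append hol(1) \<sigma>(2) bend_sym2[OF \<sigma>(1)])
  also have "\<dots> = mat (- e) ** sym2 (- q / \<sigma>) (p * \<sigma>) (- s / \<sigma>) (r * \<sigma>)"
    unfolding mat_mult_mult sym2_mult by simp
  finally have h: "holonomy t w (u @ [Opp]) = \<dots>" .
  have "- q / \<sigma> * (r * \<sigma>) - p * \<sigma> * (- s / \<sigma>) = 1" using \<sigma>(1) hol(3) by simp
  then have "((r * \<sigma> * x - p * \<sigma> * y) + (- q / \<sigma> * y - - s / \<sigma> * x)) *
      ((r * \<sigma> * x - p * \<sigma> * y) - t (w @ u @ [Opp]) * (- q / \<sigma> * y - - s / \<sigma> * x)) \<ge> 0"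
    using other_framing_position_from[OF \<phi>' F h _ _ xy] hol(2) by simp
  also have "((r * \<sigma> * x - p * \<sigma> * y) + (- q / \<sigma> * y - - s / \<sigma> * x)) *
      ((r * \<sigma> * x - p * \<sigma> * y) - t (w @ u @ [Opp]) * (- q / \<sigma> * y - - s / \<sigma> * x))
    = - (((s * x - q * y) + (p * y - r * x)) * ((s * x - q * y) - t (w @ u) * (p * y - r * x)))"
    using \<sigma>(1) unfolding tp(2) \<sigma>(2) by (simp add: field_simps power2_eq_square)
  finally show ?thesis by simp
qed

lemma other_framing_coordinates:
  assumes \<phi>': "T_bent T d0 \<rho> \<phi>'" and F: "walk_frame f w F"
  shows "\<exists>(x::real) (y::real). (x, y) \<noteq> (0 :: real, 0 :: real) \<and> walk_framing \<phi>' (w @ u)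
      = cline (F *v pvec x y)"
proof -
  obtain e a b c d where h: "e = 1 \<or> e = -1" "a * d - b * c = 1" "holonomy t w u
      = mat e ** sym2 a b c d"
    using holonomy_sym2[OF shear_shear_of] by blast
  have e0: "e \<noteq> 0" using h(1) by auto
  have "walk_frame f (w @ u) (F ** (mat e ** sym2 a b c d))"
    using unbent.walk_frame_holonomy[OF F, of u] h(3) by simp
  from other_framing_position[OF \<phi>' this] obtain x :: real and y :: real where xy:
      "(x, y) \<noteq> (0 :: real, 0 :: real)"
    "walk_framing \<phi>' (w @ u) = cline ((F ** (mat e ** sym2 a b c d)) *v pvec x y)" by blast
  have "(F ** (mat e ** sym2 a b c d)) *v pvec x y
      = e *s (F *v pvec (of_real (a * x + b * y)) (of_real (c * x + d * y)))"
    unfolding matrix_vector_mul_assoc[symmetric] mat_mult_vector sym2_pvec matrix_vector_mult_smult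
        by simp
  then have "walk_framing \<phi>' (w @ u) = cline (F *v pvec (of_real (a * x + b * y)) (of_real (c * x +
      d * y)))"
    using xy(2) cline_smult[OF e0] by metis
  moreover have "(a * x + b * y, c * x + d * y) \<noteq> (0, 0)"
  proof
    assume "(a * x + b * y, c * x + d * y) = (0, 0)"
    then have z: "a * x + b * y = 0" "c * x + d * y = 0" by auto
    have "(a * d - b * c) * x = d * (a * x + b * y) - b * (c * x + d * y)"
      "(a * d - b * c) * y = a * (c * x + d * y) - c * (a * x + b * y)" by (simp_all add: algebra_simps)
    then have "x = 0" "y = 0" unfolding z h(2) by simp_all
    then show False using xy(1) by simp
  qed
  ultimately show ?thesis by blast
qed

lemma cline_pvec_normalize:
  assumes "y \<noteq> 0"
  shows "cline (F *v pvec (of_real x) (of_real y)) = cline (F *v pvec (of_real (x / y)) (of_real 1))"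
proof -
  have "pvec (of_real x) (of_real y) = (of_real y ^ 2) *s pvec (of_real (x / y)) (of_real 1)"
    unfolding pvec_smult[symmetric] using assms by simp
  then show ?thesis using assms by (simp add: matrix_vector_mult_smult cline_smult)
qed

text \<open>In a frame of the developing framing the quadrilateral is -1, 0, t0, \<infinity>. Each
  of its five edges constrains the new positions of its end points; together the constraints
  preserve the cyclic order, so the cross ratio \<open>Z_walk\<close> stays positive.\<close>

theorem other_framing_unbent:
  assumes \<phi>': "T_bent T d0 \<rho> \<phi>'"
  shows "unbent_framing (walk_framing \<phi>')"
proof -
  interpret f': framing "walk_framing \<phi>'" by (rule framing_T_bent[OF \<phi>'])
  define f' where "f' = walk_framing \<phi>'"
  have "bending_of f' w = 1" for w
  proof -
    obtain F where F: "walk_frame f w F" using frame_ex by blast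
    have U: "F \<in> carrier U21" using F walk_frame_U21 by blast
    have tpos: "t u > 0" for u using shear_shear_of by (simp add: shear_def)
    define s where "s = sqrt (t w)"
    have s: "s > 0" "t w = s^2" using tpos[of w] by (simp_all add: s_def)
    have hol: "holonomy t w [] = mat 1 ** sym2 1 0 0 1" "holonomy t w [Nxt] = mat 1 ** sym2 0 (-1) 1 1"
      "holonomy t w [Nxt, Nxt] = mat 1 ** sym2 (-1) (-1) 1 0"
      "holonomy t w [Opp, Nxt] = mat (-1) ** sym2 s s 0 (1 / s)"
      "holonomy t w [Opp, Nxt, Nxt] = mat (-1) ** sym2 s 0 (1 / s) (1 / s)"
      by (simp_all add: sym2_one rot_square s(2) bend_rot[OF s(1)] bend_rot_rot[OF s(1), unfolded
          rot_square])
    define t0 t1 t2 t3 t4 where "t0 = t w" and "t1 = t (w @ [Nxt])" and "t2 = t (w @ [Nxt, Nxt])"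
      and "t3 = t (w @ [Opp, Nxt])" and "t4 = t (w @ [Opp, Nxt, Nxt])"
    note tdefs = t0_def t1_def t2_def t3_def t4_def
    have tp: "t0 > 0" "t1 > 0" "t2 > 0" "t3 > 0" "t4 > 0" unfolding tdefs by (rule tpos)+
    note pos = other_framing_position_from[OF \<phi>' F, folded f'_def]
    note opp = other_framing_position_opp[OF \<phi>' F, folded f'_def]
    note coords = other_framing_coordinates[OF \<phi>' F, folded f'_def]
    have NNN: "f' (w @ [Nxt, Nxt, Opp]) = f' w" "f' (w @ [Opp]) = f' (w @ [Nxt])"
        "f' (w @ [Nxt, Opp]) = f' (w @ [Nxt, Nxt])"
      "f' (w @ [Opp, Nxt]) = f' w"
      "f' (w @ [Opp, Nxt, Opp]) = f' (w @ [Opp, Nxt, Nxt])" "f' (w @ [Opp, Nxt, Nxt, Opp])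
          = f' (w @ [Nxt])"
      using f'.f_opp[of "w @ [Nxt, Nxt]"] f'.f_opp[of w] f'.f_opp[of "w @ [Nxt]"] f'.f_opp[of
          "w @ [Opp, Nxt]"]
        f'.f_opp[of "w @ [Opp, Nxt, Nxt]"] f'.f_homotopic[OF homotopic_NNN[of w "[]"]]
        f'.f_homotopic[OF homotopic_NNN[of "w @ [Opp]" "[]"]] by (simp_all add: f'_def)
    have ss: "s \<noteq> 0" using s by simp
    \<comment> \<open>The vertex \<infinity>, as an end point of the edges with parameters t0, t2,
      t3.\<close>
    have P0: "(x + y) * (x - t0 * y) \<ge> 0" "x * (t2 * x + (1 + t2) * y) \<ge> 0"
        "x * (x - t0 * (1 + t3) * y) \<ge> 0"
      if "f' w = cline (F *v pvec (of_real x) (of_real y))" for x y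
    proof -
      show "(x + y) * (x - t0 * y) \<ge> 0" using pos[OF hol(1), of x y] that by (simp add: tdefs)
      show "x * (t2 * x + (1 + t2) * y) \<ge> 0" using opp[OF hol(3), of x y] that NNN
          by (simp add: tdefs algebra_simps)
      have "(1 / s * x - s * y + (s * y - 0 * x)) * (1 / s * x - s * y - t3 * (s * y - 0 * x)) \<ge> 0"
        using pos[OF hol(4), of x y] that NNN ss by (simp add: t3_def)
      then have "s^2 * ((1 / s * x - s * y + (s * y - 0 * x)) * (1 / s * x - s * y - t3 * (s * y - 0
          * x))) \<ge> 0" by (rule mult_nonneg_nonneg[OF zero_le_power2])
      also have "s^2 * ((1 / s * x - s * y + (s * y - 0 * x)) * (1 / s * x - s * y - t3 * (s * y - 0
          * x))) = x * (x - t0 * (1 + t3) * y)"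
        using ss by (simp add: t0_def s(2) power2_eq_square field_simps)
      finally show "x * (x - t0 * (1 + t3) * y) \<ge> 0" .
    qed
    \<comment> \<open>The vertex 0, as an end point of the edges with parameters t0, t1, t4.\<close>
    have P1: "(x + y) * (x - t0 * y) \<le> 0" "y * ((1 + t1) * x + y) \<ge> 0"
        "y * ((1 + t4) * x - t4 * t0 * y) \<le> 0"
      if "f' (w @ [Nxt]) = cline (F *v pvec (of_real x) (of_real y))" for x y
    proof -
      show "(x + y) * (x - t0 * y) \<le> 0" using opp[OF hol(1), of x y] that NNN by (simp add: tdefs)
      show "y * ((1 + t1) * x + y) \<ge> 0" using pos[OF hol(2), of x y] that
          by (simp add: tdefs algebra_simps)
      have "(1 / s * x - 0 * y + (s * y - 1 / s * x)) * (1 / s * x - 0 * y - t4 * (s * y - 1 / s *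
          x)) \<le> 0"
        using opp[OF hol(5), of x y] that NNN ss by (simp add: t4_def)
      also have "(1 / s * x - 0 * y + (s * y - 1 / s * x)) * (1 / s * x - 0 * y - t4 * (s * y - 1 /
          s * x)) = y * ((1 + t4) * x - t4 * t0 * y)"
        using ss by (simp add: t0_def s(2) power2_eq_square field_simps)
      finally show "y * ((1 + t4) * x - t4 * t0 * y) \<le> 0" .
    qed
    \<comment> \<open>The vertex -1, with the edges of parameters t1 and t2.\<close>
    have P2: "y * ((1 + t1) * x + y) \<le> 0" "x * (t2 * x + (1 + t2) * y) \<le> 0"
      if "f' (w @ [Nxt, Nxt]) = cline (F *v pvec (of_real x) (of_real y))" for x y
    proof -
      show "y * ((1 + t1) * x + y) \<le> 0" using opp[OF hol(2), of x y] that NNN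
          by (simp add: tdefs algebra_simps)
      show "x * (t2 * x + (1 + t2) * y) \<le> 0" using pos[OF hol(3), of x y] that
          by (simp add: tdefs algebra_simps)
    qed
    \<comment> \<open>The vertex t0, with the edges of parameters t3 and t4.\<close>
    have P3: "x * (x - t0 * (1 + t3) * y) \<le> 0" "y * ((1 + t4) * x - t4 * t0 * y) \<ge> 0"
      if "f' (w @ [Opp, Nxt, Nxt]) = cline (F *v pvec (of_real x) (of_real y))" for x y
    proof -
      have "(1 / s * x - s * y + (s * y - 0 * x)) * (1 / s * x - s * y - t3 * (s * y - 0 * x)) \<le> 0"
        using opp[OF hol(4), of x y] that NNN ss by (simp add: t3_def)
      then have "s^2 * ((1 / s * x - s * y + (s * y - 0 * x)) * (1 / s * x - s * y - t3 * (s * y - 0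
          * x))) \<le> 0" by (rule mult_nonneg_nonpos[OF zero_le_power2])
      also have "s^2 * ((1 / s * x - s * y + (s * y - 0 * x)) * (1 / s * x - s * y - t3 * (s * y - 0
          * x))) = x * (x - t0 * (1 + t3) * y)"
        using ss by (simp add: t0_def s(2) power2_eq_square field_simps)
      finally show "x * (x - t0 * (1 + t3) * y) \<le> 0" .
      have "(1 / s * x - 0 * y + (s * y - 1 / s * x)) * (1 / s * x - 0 * y - t4 * (s * y - 1 / s *
          x)) \<ge> 0"
        using pos[OF hol(5), of x y] that ss by (simp add: t4_def)
      also have "(1 / s * x - 0 * y + (s * y - 1 / s * x)) * (1 / s * x - 0 * y - t4 * (s * y - 1 /
          s * x)) = y * ((1 + t4) * x - t4 * t0 * y)"
        using ss by (simp add: t0_def s(2) power2_eq_square field_simps)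
      finally show "y * ((1 + t4) * x - t4 * t0 * y) \<ge> 0" .
    qed
    obtain x :: real and y :: real where c: "(x, y) \<noteq> (0 :: real, 0 :: real)"
        "f' w = cline (F *v pvec x y)"
      using coords[of "[]"] by auto
    \<comment> \<open>For the vertices 0, -1 and t0 a position with y = 0 would force x = 0 by the
      constraints, so they have an affine coordinate. The vertex \<infinity> keeps homogeneous
      ones.\<close>
    have affine: "\<exists>z :: real. f' (w @ u) = cline (F *v pvec (of_real z) (of_real 1))"
      if "\<And>x. f' (w @ u) = cline (F *v pvec (of_real x) (of_real 0)) \<Longrightarrow> x = 0" for u
    proof -
      obtain x :: real and y :: real where xy: "(x, y) \<noteq> (0 :: real, 0 :: real)"
          "f' (w @ u) = cline (F *v pvec x y)"
        using coords by blast
      have "y \<noteq> 0" using that[of x] xy by auto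
      then show ?thesis using cline_pvec_normalize xy(2) by metis
    qed
    have sq: "x = 0" if "x * x \<le> 0" for x :: real using that by (auto simp: mult_le_0_iff)
    have "x = 0" if "f' (w @ [Nxt]) = cline (F *v pvec (of_real x) (of_real 0))" for x
      using P1(1)[OF that] sq[of x] by simp
    from affine[OF this] obtain a where a: "f' (w @ [Nxt]) = cline (F *v pvec (of_real a) (of_real 1))"
      by blast
    have "x = 0" if "f' (w @ [Nxt, Nxt]) = cline (F *v pvec (of_real x) (of_real 0))" for x
      using P2(2)[OF that] sq[of x] tp(3)
          by (simp add: mult_le_0_iff zero_le_mult_iff mult.left_commute[of x t2])
    from affine[OF this] obtain b where b: "f' (w @ [Nxt, Nxt])
        = cline (F *v pvec (of_real b) (of_real 1))"
      by blast
    have "x = 0" if "f' (w @ [Opp, Nxt, Nxt]) = cline (F *v pvec (of_real x) (of_real 0))" for x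
      using P3(1)[OF that] sq[of x] by simp
    from affine[OF this] obtain d where d: "f' (w @ [Opp, Nxt, Nxt])
        = cline (F *v pvec (of_real d) (of_real 1))"
      by blast
    have I: "b \<le> a" "a \<le> d" "(d * y - x) * (b * y - x) \<ge> 0"
      using interlaced[OF tp, of a b d x y] P0[OF c(2)] P1[OF a] P2[OF b] P3[OF d]
      by (simp_all add: mult.commute)
    obtain F' where F': "walk_frame f' w F'" using f'.frame_ex f'_def by blast
    obtain G' where G': "walk_frame f' (w @ [Opp]) G'" using f'.frame_ex f'_def by blast
    have dist: "f' w \<noteq> f' (w @ [Nxt])" "f' (w @ [Nxt]) \<noteq> f' (w @ [Nxt, Nxt])"
        "f' w \<noteq> f' (w @ [Nxt, Nxt])"
      "f' w \<noteq> f' (w @ [Opp, Nxt, Nxt])" "f' (w @ [Nxt]) \<noteq> f' (w @ [Opp, Nxt, Nxt])"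
      using frame_distinct[OF F'[unfolded walk_frame_def]] frame_distinct[OF G'[unfolded
          walk_frame_def]] NNN by simp_all
    have ne: "z * y - x \<noteq> 0" if "f' w \<noteq> cline (F *v pvec (of_real z) (of_real 1))" for z
    proof
      assume z: "z * y - x = 0"
      then have "y \<noteq> 0" using c(1) by auto
      then have "f' w = cline (F *v pvec (of_real (x / y)) (of_real 1))"
          using cline_pvec_normalize c(2) by metis
      moreover have "x / y = z" using z \<open>y \<noteq> 0\<close> by (simp add: field_simps)
      ultimately show False using that by simp
    qed
    have strict: "b < a" "a < d" "d * y - x \<noteq> 0" "b * y - x \<noteq> 0" "a * y - x \<noteq> 0"
      using I(1,2) dist a b d ne[of a] ne[of b] ne[of d] by (auto simp: less_le)
    then have I3: "(d * y - x) * (b * y - x) > 0" using I(3) by (simp add: less_le)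
    \<comment> \<open>Polar to the points a and x/y: its product with \<open>pvec z u\<close> is the
      quadratic form in z, u that vanishes at these two points.\<close>
    define v where "v = vec3 (- of_real (x * a)) (- of_real (x + a * y) / rt2) (of_real y)"
    have hv: "herm (pvec (of_real z) (of_real u)) v = of_real ((z * y - u * x) * (z - u * a))" for z u
      by (simp add: herm_def v_def power2_eq_square field_simps)
    have v0: "F *v v \<noteq> 0"
    proof -
      have "v \<noteq> 0" using hv[of d 1] strict by (auto simp flip: of_real_mult)
      then show ?thesis using U by (simp add: U21_eq_0_iff)
    qed
    have vo: "herm (F *v v) (F *v pvec (of_real a) (of_real 1)) = 0"
        "herm (F *v v) (F *v pvec (of_real x) (of_real y)) = 0"
      unfolding U21_herm[OF U] using hv[of a 1] hv[of x y]
        herm_commute[of v "pvec (of_real a) (of_real 1)"] herm_commute[of v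
            "pvec (of_real x) (of_real y)"] by simp_all
    have pn: "F *v pvec (of_real z) (of_real 1) \<noteq> 0" "F *v pvec (of_real x) (of_real y) \<noteq> 0" for z
      using U c(1) by (auto simp: U21_eq_0_iff pvec_eq_0_iff)
    have U': "F' \<in> carrier U21" using F' f'.walk_frame_U21 f'_def by simp
    have fr: "cline (F *v pvec (of_real a) (of_real 1)) = cline (F' *v pvec 0 1)"
      "cline (F *v pvec (of_real x) (of_real y)) = cline (F' *v pvec 1 0)"
      using F' a c(2) by (simp_all add: walk_frame_def frame_def)
    have "Z_walk f' w = - (herm (F *v pvec (of_real d) (of_real 1)) (F *v v) * herm (F *v pvec
        (of_real b) (of_real 1)) (F *v pvec (of_real a) (of_real 1)))
        / (herm (F *v pvec (of_real b) (of_real 1)) (F *v v) * herm (F *v pvec (of_real d) (of_real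
            1)) (F *v pvec (of_real a) (of_real 1)))"
      unfolding Z_walk_def a b c(2) d by (rule Z_inv_eq[OF U' fr pn(1) pn(1) pn(2) pn(1) v0 vo])
    also have "\<dots> = of_real (- (((d * y - x) * (d - a)) * - ((b - a)^2)) / (((b * y - x) * (b - a)) *
        - ((d - a)^2)))"
      unfolding U21_herm[OF U] hv herm_pvec by simp
    finally have Z: "Z_walk f' w = \<dots>" .
    \<comment> \<open>Up to a positive factor the cross ratio is a product of the three order
      relations found above.\<close>
    have "- (((d * y - x) * (d - a)) * - ((b - a)^2)) / (((b * y - x) * (b - a)) * - ((d - a)^2))
        = ((d * y - x) * (b * y - x)) * (a - b) / ((b * y - x)^2 * (d - a))"
      using strict by (simp add: power2_eq_square divide_simps) (simp add: algebra_simps)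
    moreover have "((d * y - x) * (b * y - x)) * (a - b) / ((b * y - x)^2 * (d - a)) > 0"
      using strict by (intro divide_pos_pos mult_pos_pos[OF I3] mult_pos_pos[of
          "(b * y - x)^2"]) simp_all
    ultimately obtain z where z: "Z_walk f' w = of_real z" "z > 0" using Z by metis
    then show ?thesis by (simp add: bending_of_def)
  qed
  then show ?thesis by unfold_locales (simp add: f'_def)
qed

end

text \<open>Without bending, one frame \<open>G\<close> at the base dart and the shear parameters
  determine all other frames, so \<open>G\<close> itself carries the standard framing and
  representation to the given ones.\<close>

lemma unbent_isometric:
  assumes tri: "triangulated T d0" and t: "shear t" and b: "T_bent T d0 \<rho> \<phi>"
    and u: "unbent_framing (walk_framing \<phi>)" and sh: "shear_of (walk_framing \<phi>) = t"
  shows "isometric_pairs T d0 (fuchsian_rep t) (fuchsian_map t) \<rho> \<phi>"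
proof -
  interpret triangulated T d0 by (rule tri)
  interpret unbent_framing "walk_framing \<phi>" by (rule u)
  obtain G where G: "walk_frame (walk_framing \<phi>) [] G" using frame_ex by blast
  have GU: "G \<in> carrier U21" using G walk_frame_U21 by blast
  have fr: "walk_frame (walk_framing \<phi>) w (G ** holonomy t [] w)" for w
    using walk_frame_holonomy[OF G, of w] sh by simp
  have "\<rho> \<gamma> = {M'. \<exists>M \<in> fuchsian_rep t \<gamma>. \<forall>x. M' *v (G *v x) = G *v (M *v x)}"
    if \<gamma>: "\<gamma> \<in> carrier (fund_group T d0)" for \<gamma>
  proof -
    obtain g where g: "\<gamma> = walk_class g" "closed_walk g" using \<gamma> by (auto simp: carrier_fund_group)
    obtain P where P: "P \<in> \<rho> \<gamma>" using T_bent_PU21[OF b g(2)] PU21_nonempty g(1) by blast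
    note P' = T_bent_equivariant[OF b g(2) P[unfolded g(1)]]
    have "walk_frame (walk_framing \<phi>) g (P ** G)" using P'(4)[OF G] by simp
    then obtain k where k: "cmod k = 1" "P ** G = mat k ** (G ** holonomy t [] g)"
      using walk_frame_unique fr by blast
    have k0: "k \<noteq> 0" using k by auto
    have eq: "(\<forall>x. M' *v (G *v x) = G *v (M *v x)) \<longleftrightarrow> M' ** G = G ** M" for M M' :: "complex^3^3"
      by (simp add: matrix_vector_mul_assoc matrix_eq)
    show ?thesis unfolding eq
    proof (intro equalityI subsetI)
      fix M' assume "M' \<in> \<rho> \<gamma>"
      then obtain c where c: "M' = mat c ** P" "cmod c = 1" using P'(2) g(1)
          by (auto simp: proj_class_def)
      have "M' ** G = mat c ** (P ** G)" by (simp add: c matrix_mul_assoc)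
      also have "\<dots> = mat (c * k) ** G ** holonomy t [] g"
          by (simp add: k(2) matrix_mul_assoc mat_mult_mat)
      also have "\<dots> = G ** (mat (c * k) ** holonomy t [] g)"
        unfolding mat_commute[symmetric, of _ G] by (simp add: matrix_mul_assoc)
      finally have "M' ** G = G ** (mat (c * k) ** holonomy t [] g)" .
      moreover have "mat (c * k) ** holonomy t [] g \<in> fuchsian_rep t \<gamma>"
        unfolding g(1) fuchsian_rep_walk_class[OF t] proj_class_def using c k by (auto simp: norm_mult)
      ultimately show "M' \<in> {M'. \<exists>M \<in> fuchsian_rep t \<gamma>. M' ** G = G ** M}" by blast
    next
      fix M' assume "M' \<in> {M'. \<exists>M \<in> fuchsian_rep t \<gamma>. M' ** G = G ** M}"
      then obtain c where c: "M' ** G = G ** (mat c ** holonomy t [] g)" "cmod c = 1"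
        unfolding g(1) fuchsian_rep_walk_class[OF t] proj_class_def by auto
      have "M' ** G = mat c ** (G ** holonomy t [] g)"
        unfolding c(1) by (simp add: matrix_mul_assoc mat_commute)
      also have "\<dots> = mat (c / k) ** (P ** G)" using k0 by (simp add: k(2) matrix_mul_assoc mat_mult_mat)
      finally have "(M' ** G) ** matrix_inv G = (mat (c / k) ** P ** G) ** matrix_inv G"
        by (simp add: matrix_mul_assoc)
      then have "M' = mat (c / k) ** P"
        by (simp add: matrix_mul_assoc[symmetric] U21_matrix_inv[OF GU])
      then show "M' \<in> \<rho> \<gamma>" using P'(2) g(1) c(2) k(1) by (auto simp: proj_class_def norm_divide)
    qed
  qed
  moreover have "\<phi> V = ((*v) G) ` fuchsian_map t V" if V: "V \<in> lifted_vertices" for V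
  proof -
    obtain w where w: "V = origin (walk_class w)" using V by (auto simp: lifted_vertices_eq)
    have "\<phi> V = cline ((G ** holonomy t [] w) *v pvec 1 0)"
      using fr[of w] by (simp add: w walk_frame_def frame_def walk_framing_def)
    moreover have "fuchsian_map t V = cline (holonomy t [] w *v pvec 1 0)"
      using walk_framing_fuchsian_map[OF t, THEN fun_cong, of w]
          by (simp add: w walk_framing_def fuchsian_framing_def)
    ultimately show ?thesis by (simp add: cline_image matrix_vector_mul_assoc)
  qed
  moreover have "isometry_lift ((*v) G)" unfolding isometry_lift_def using GU by blast
  ultimately show ?thesis unfolding isometric_pairs_def by blast
qed

lemma hyperbolic_bentI:
  assumes "triangulated T d0" "discrete_faithful_PO21 T d0 \<rho>" "hyperbolic_holonomy T d0 \<rho>"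
  shows "\<exists>\<psi>. hyperbolic_bent T d0 \<rho> \<psi>"
proof -
  obtain \<psi> where b: "T_bent T d0 \<rho> \<psi>" and disj: "\<And>X Y. X \<in> lifted_darts \<Longrightarrow> Y \<in> lifted_darts \<Longrightarrow>
      lift_triangle X \<noteq> lift_triangle Y \<Longrightarrow>
      open_ideal_triangle (\<psi> (origin X)) (\<psi> (origin (lift_nxt X))) (\<psi> (origin (lift_nxt (lift_nxt
          X)))) \<inter>
      open_ideal_triangle (\<psi> (origin Y)) (\<psi> (origin (lift_nxt Y))) (\<psi> (origin (lift_nxt (lift_nxt
          Y)))) = {}"
    using assms(3) unfolding hyperbolic_holonomy_def by blast
  interpret triangulated T d0 by (rule assms(1))
  have "hyperbolic_bent T d0 \<rho> \<psi>"
  proof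
    show "T_bent T d0 \<rho> \<psi>" by (rule b)
    show "\<rho> ` carrier (fund_group T d0) \<subseteq> PO21" "inj_on \<rho> (carrier (fund_group T d0))"
      using assms(2) by (simp_all add: discrete_faithful_PO21_def)
    show "walk_triangle (walk_framing \<psi>) u \<inter> walk_triangle (walk_framing \<psi>) v = {}"
      if "lift_triangle (walk_class u) \<noteq> lift_triangle (walk_class v)" for u v
      using disj[OF _ _ that] by (simp add: lifted_darts_def walk_triangle_def walk_framing_def
          lift_nxt_walk_class)
  qed
  then show ?thesis by blast
qed

theorem theorem1p5:
  fixes g k :: nat
    and T :: "'d triangulation" and d0 :: 'd
    and \<rho> :: "walk set \<Rightarrow> (complex^3^3) set"
    and \<phi> :: "walk set set \<Rightarrow> (complex^3) set"
  assumes "k \<ge> 1" and "2 - 2 * int g - int k < 0"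
    and "ideal_triangulation g k T" and "bipartite_triangulation T" and "d0 \<in> darts T"
    and "T_bent T d0 \<rho> \<phi>"
  shows "\<exists>\<rho>\<^sub>0 \<phi>\<^sub>0.
     T_bent T d0 \<rho>\<^sub>0 \<phi>\<^sub>0 \<and> same_bending_fiber \<phi> \<phi>\<^sub>0 \<and>
       discrete_faithful_PO21 T d0 \<rho>\<^sub>0 \<and> hyperbolic_holonomy T d0 \<rho>\<^sub>0 \<and>
     (\<forall>\<rho>\<^sub>1 \<phi>\<^sub>1. T_bent T d0 \<rho>\<^sub>1 \<phi>\<^sub>1 \<and> same_bending_fiber \<phi> \<phi>\<^sub>1 \<and>
       discrete_faithful_PO21 T d0 \<rho>\<^sub>1 \<and> hyperbolic_holonomy T d0 \<rho>\<^sub>1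
        \<longrightarrow> isometric_pairs T d0 \<rho>\<^sub>0 \<phi>\<^sub>0 \<rho>\<^sub>1 \<phi>\<^sub>1) \<and>
     (\<forall>\<gamma> \<in> carrier (fund_group T d0).
        translation_length (\<rho> \<gamma>) \<le> translation_length (\<rho>\<^sub>0 \<gamma>)) \<and>
     (\<forall>\<gamma> \<in> carrier (fund_group T d0). peripheral T d0 \<gamma>
        \<longrightarrow> translation_length (\<rho> \<gamma>) = translation_length (\<rho>\<^sub>0 \<gamma>))"
proof -
  have tri: "triangulated T d0" by (rule triangulated_ideal[OF assms(3,5)])
  interpret triangulated T d0 by (rule tri)
  interpret bent T d0 \<rho> \<phi> by unfold_locales (rule assms(6))
  define t where "t = shear_of (walk_framing \<phi>)"
  have t: "shear t" unfolding t_def by (rule shear_shear_of)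
  \<comment> \<open>The shear parameter is the reciprocal modulus of the invariant, so a bending
    fiber is a fiber of \<open>shear_of\<close>.\<close>
  have fiber: "same_bending_fiber \<phi> \<phi>' \<longleftrightarrow> shear_of (walk_framing \<phi>') = t" for \<phi>'
  proof -
    have inj: "1 / x = 1 / y \<longleftrightarrow> x = y" for x y :: real
        by (metis divide_divide_eq_right mult_1 div_by_1 inverse_eq_divide inverse_inverse_eq)
    show ?thesis unfolding same_bending_fiber_def walk_class_all Z_edge_walk_class t_def fun_eq_iff
        shear_of_def inj
      by auto
  qed
  show ?thesis
  proof (intro exI[of _ "fuchsian_rep t"] exI[of _ "fuchsian_map t"] conjI allI impI ballI)
    show "T_bent T d0 (fuchsian_rep t) (fuchsian_map t)"
      unfolding t_def by (rule fuchs.T_bent_fuchsian)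
    show "same_bending_fiber \<phi> (fuchsian_map t)"
      unfolding fiber walk_framing_fuchsian_map[OF t] by (rule unbent_fuchsian(2)[OF t])
    show "discrete_faithful_PO21 T d0 (fuchsian_rep t)"
      unfolding t_def by (rule fuchs.discrete_faithful_fuchsian)
    show "hyperbolic_holonomy T d0 (fuchsian_rep t)"
      unfolding t_def by (rule fuchs.hyperbolic_holonomy_fuchsian)
  next
    fix \<rho>\<^sub>1 \<phi>\<^sub>1
    assume h: "T_bent T d0 \<rho>\<^sub>1 \<phi>\<^sub>1 \<and> same_bending_fiber \<phi> \<phi>\<^sub>1 \<and>
       discrete_faithful_PO21 T d0 \<rho>\<^sub>1 \<and> hyperbolic_holonomy T d0 \<rho>\<^sub>1"
    then have b: "T_bent T d0 \<rho>\<^sub>1 \<phi>\<^sub>1" and sh: "shear_of (walk_framing \<phi>\<^sub>1) = t"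
      and d: "discrete_faithful_PO21 T d0 \<rho>\<^sub>1" and hol: "hyperbolic_holonomy T d0 \<rho>\<^sub>1"
      unfolding fiber by simp_all
    \<comment> \<open>The framing \<psi> that develops is not assumed to be
      \<open>\<phi>\<^sub>1\<close>, whose moduli are the prescribed ones;
      \<open>other_framing_unbent\<close> passes from one to the other.\<close>
    obtain \<psi> where "hyperbolic_bent T d0 \<rho>\<^sub>1 \<psi>" using hyperbolic_bentI[OF tri d hol] by blast
    then have "unbent_framing (walk_framing \<phi>\<^sub>1)" using b by (rule hyperbolic_bent.other_framing_unbent)
    then show "isometric_pairs T d0 (fuchsian_rep t) (fuchsian_map t) \<rho>\<^sub>1 \<phi>\<^sub>1"
      using sh by (rule unbent_isometric[OF tri t b])
  next
    fix \<gamma> assume "\<gamma> \<in> carrier (fund_group T d0)"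
    then obtain g where g: "\<gamma> = walk_class g" "closed_walk g" by (auto simp: carrier_fund_group)
    show "translation_length (\<rho> \<gamma>) \<le> translation_length (fuchsian_rep t \<gamma>)"
      unfolding g(1) fuchsian_rep_walk_class[OF t] unfolding t_def by (rule dominated[OF g(2)])
  next
    fix \<gamma> assume "\<gamma> \<in> carrier (fund_group T d0)" and p: "peripheral T d0 \<gamma>"
    then obtain g where g: "\<gamma> = walk_class g" "closed_walk g" by (auto simp: carrier_fund_group)
    show "translation_length (\<rho> \<gamma>) = translation_length (fuchsian_rep t \<gamma>)"
      using peripheral_equal[OF g(2)] p unfolding g(1) fuchsian_rep_walk_class[OF t] unfolding t_def
          by blast
  qed
qed

end
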